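(* Let $0 < d \le 1/2$ be fixed. Then: (1) The threshold for the property $\mathscr{G}_{d,n} \cup \mathbb{G}(n,p) \xrightarrow{\mathrm{rbw}} K_4$ is $n^{-5/4}$. (2) The threshold for the property $\mathscr{G}_{d,n} \cup \mathbb{G}(n,p) \xrightarrow{\mathrm{rbw}} K_5$ is $n^{-1}$. (3) The threshold for the property $\mathscr{G}_{d,n} \cup \mathbb{G}(n,p) \xrightarrow{\mathrm{rbw}} K_7$ is $n^{-7/15}$. Explicitly, for $(\ell,\hat p) \in \{(4,n^{-5/4}),(5,n^{-1}),(7,n^{-7/15})\}$: if $p=\omega(\hat p)$ then for every sequence $(G_n)$ with $G_n\in\mathscr{G}_{d,n}$ we have $\Pr[G_n\cup\mathbb{G}(n,p)\xrightarrow{\mathrm{rbw}} K_\ell]\to 1$; and if $p=o(\hat p)$ then there exists a sequence $(G_n)$ with $G_n\in\mathscr{G}_{d,n}$ such that $\Pr[G_n\cup\mathbb{G}(n,p)\xrightarrow{\mathrm{rbw}} K_\ell]\to 0$.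
   Context: For graphs $G,H$, write $G \xrightarrow{\mathrm{rbw}} H$ if every proper edge-colouring of $G$ contains a rainbow copy of $H$ (a subgraph all of whose edges receive distinct colours). $\mathbb{G}(n,p)$ is the binomial random graph. $\mathscr{G}_{d,n}$ denotes the family of $n$-vertex graphs with edge density at least $d$ (at least $d\binom n2$ edges). $G\cup\mathbb{G}(n,p)$ denotes the union of a fixed $n$-vertex graph $G$ with an independent random graph $\mathbb{G}(n,p)$ on the same vertex set. A sequence $\hat p(n)$ is a threshold for a property $\mathcal P$ in this perturbed model if (a) whenever $p=\omega(\hat p)$, for every sequence $G_n\in\mathscr{G}_{d,n}$, $G_n\cup\mathbb{G}(n,p)\in\mathcal P$ with probability tending to $1$, and (b) whenever $p=o(\hat p)$, there exists a sequence $G_n\in\mathscr{G}_{d,n}$ with $\Pr[G_n\cup\mathbb{G}(n,p)\in\mathcal P]\to 0$. *)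

theory Defs
  imports Complex_Main
begin

text \<open>Graphs on the vertex set {0..<n} are represented by their edge sets,
  edges being 2-element sets of vertices.\<close>

definition all_edges :: "nat \<Rightarrow> nat set set" where
  "all_edges n = {e. \<exists>u v. u < n \<and> v < n \<and> u \<noteq> v \<and> e = {u, v}}"

definition clique_edges :: "nat set \<Rightarrow> nat set set" where
  "clique_edges S = {e. \<exists>u v. u \<in> S \<and> v \<in> S \<and> u \<noteq> v \<and> e = {u, v}}"

text \<open>Proper edge-colouring: edges sharing a vertex get distinct colours.
  Colours are natural numbers (w.l.o.g., since graphs are finite).\<close>
definition proper_colouring :: "nat set set \<Rightarrow> (nat set \<Rightarrow> nat) \<Rightarrow> bool" where
  "proper_colouring E c \<longleftrightarrow>
     (\<forall>e\<in>E. \<forall>f\<in>E. e \<noteq> f \<and> e \<inter> f \<noteq> {} \<longrightarrow> c e \<noteq> c f)"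

definition has_rainbow_clique :: "nat set set \<Rightarrow> (nat set \<Rightarrow> nat) \<Rightarrow> nat \<Rightarrow> bool" where
  "has_rainbow_clique E c l \<longleftrightarrow>
     (\<exists>S. finite S \<and> card S = l \<and> clique_edges S \<subseteq> E \<and> inj_on c (clique_edges S))"

definition rbw_arrow :: "nat set set \<Rightarrow> nat \<Rightarrow> bool" where
  "rbw_arrow E l \<longleftrightarrow> (\<forall>c. proper_colouring E c \<longrightarrow> has_rainbow_clique E c l)"

definition dense_family :: "real \<Rightarrow> nat \<Rightarrow> nat set set set" where
  "dense_family d n = {E. E \<subseteq> all_edges n \<and> real (card E) \<ge> d * real (n choose 2)}"

text \<open>Pr[G \<union> G(n,p) -rbw-> K_l], the binomial random graph G(n,p) on the same
  vertex set being given by its distribution on edge sets.\<close>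
definition rbw_prob :: "nat \<Rightarrow> nat set set \<Rightarrow> real \<Rightarrow> nat \<Rightarrow> real" where
  "rbw_prob n E p l =
     (\<Sum>F\<in>Pow (all_edges n).
        (if rbw_arrow (E \<union> F) l
         then p ^ card F * (1 - p) ^ (card (all_edges n) - card F) else 0))"

definition is_rbw_threshold :: "real \<Rightarrow> nat \<Rightarrow> (nat \<Rightarrow> real) \<Rightarrow> bool" where
  "is_rbw_threshold d l phat \<longleftrightarrow>
     (\<forall>p :: nat \<Rightarrow> real. (\<forall>n. 0 \<le> p n \<and> p n \<le> 1) \<and>
         filterlim (\<lambda>n. p n / phat n) at_top sequentially \<longrightarrow>
        (\<forall>G :: nat \<Rightarrow> nat set set. (\<forall>n. G n \<in> dense_family d n) \<longrightarrow>
           (\<lambda>n. rbw_prob n (G n) (p n) l) \<longlonglongrightarrow> 1)) \<and>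
     (\<forall>p :: nat \<Rightarrow> real. (\<forall>n. 0 \<le> p n \<and> p n \<le> 1) \<and>
         (\<lambda>n. p n / phat n) \<longlonglongrightarrow> 0 \<longrightarrow>
        (\<exists>G :: nat \<Rightarrow> nat set set. (\<forall>n. G n \<in> dense_family d n) \<and>
           (\<lambda>n. rbw_prob n (G n) (p n) l) \<longlonglongrightarrow> 0))"

end

theory Submission
  imports Defs "HOL-Analysis.Convex" "HOL-Library.FuncSet" "HOL-Library.Sublist"
    "HOL-Library.Nat_Bijection"
begin

text \<open>For the 1-statements, a rainbow clique \<open>Z\<close> extends by one of any \<open>branching (card Z)\<close> candidates,
  because properness lets each pair of a vertex and an opposite edge of \<open>Z\<close> spoil at most one of them.
  Hence \<open>K\<^sub>l\<close> is forced by two tree-like patterns, one on each side of a complete bipartite graph: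
  an edge and the star \<open>K\<^sub>1\<^sub>,\<^sub>4\<close> for \<open>l = 4\<close>, a triangle and a star forest for \<open>l = 5\<close>, four copies of
  \<open>K\<^sub>4\<close> on a common triangle (7 vertices, 15 edges) and a 2-degenerate graph for \<open>l = 7\<close>. A dense graph
  contains a positive proportion of all bicliques, and the second moment method finds the pattern
  in the random graph inside one of them.

  For the 0-statements, the dense graph is complete balanced bipartite and the first moment method
  makes the random graph locally sparse. For \<open>l = 5\<close> no side contains a triangle. For \<open>l = 7\<close> it
  suffices to colour without a rainbow \<open>K\<^sub>4\<close>, which is done by choosing a perfect matching in every
  \<open>K\<^sub>4\<close>, with disjoint choices; a minimal family without such a choice would grow, \<open>K\<^sub>4\<close> by \<open>K\<^sub>4\<close>, to
  a subgraph of density at least \<open>15/7\<close>. For \<open>l = 4\<close> the components on either side are trees with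
  at most four vertices, and any two of them can be joined by an explicit colouring.\<close>

section \<open>Edges, cliques and the binomial random graph\<close>

text \<open>The exponents reflect \<open>branching 3 = 4\<close>. Adding a vertex to a rainbow
  triangle takes four candidates, so the extremal patterns are K_{1,4} (5 vertices, 4 edges) for l =
  4 and four K_4 on a triangle for l = 7; a third vertex still takes a single candidate, so for l =
  5 the triangle itself decides. Both halves meet at the same ratio a of vertices to edges: the
  pattern attains a e(S) = |S|, while below the threshold the first moment excludes even equality.

  The first moment controls only vertex sets of bounded size, so each colouring argument must reach
  its contradiction on few vertices: 3 for l = 5, 5 for l = 4, 12 for l = 7. Below n^(-7/15) copies
  of K_4 may still be plentiful; only the way they overlap is restricted. For odd l = 2k - 1 some
  side holds k vertices of the clique, so cross edges can have private colours. For l = 4 the clique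
  may have just one edge on each side, and a repeated colour must in general come from opposite
  cross edges, which leads to an explicit table.\<close>

lemma clique_edges_eq: "clique_edges S = {e. e \<subseteq> S \<and> card e = 2}"
  unfolding clique_edges_def card_2_iff by blast

lemma all_edges_eq: "all_edges n = clique_edges {..<n}"
  unfolding all_edges_def clique_edges_def by auto

lemma clique_edges_mono: "S \<subseteq> T \<Longrightarrow> clique_edges S \<subseteq> clique_edges T"
  by (auto simp: clique_edges_eq)

lemma finite_clique_edges: "finite S \<Longrightarrow> finite (clique_edges S)"
  by (rule finite_subset[of _ "Pow S"]) (auto simp: clique_edges_eq)

lemma card_clique_edges: "finite S \<Longrightarrow> card (clique_edges S) = card S choose 2"
  by (simp add: clique_edges_eq n_subsets)

lemma finite_all_edges: "finite (all_edges n)"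
  by (simp add: all_edges_eq finite_clique_edges)

section \<open>Expectations, containment probabilities and the second moment in the binomial random
  graph\<close>

definition gnp_expectation :: "nat \<Rightarrow> real \<Rightarrow> (nat set set \<Rightarrow> real) \<Rightarrow> real" where
  "gnp_expectation n p X =
     (\<Sum>F\<in>Pow (all_edges n). X F * (p ^ card F * (1 - p) ^ (card (all_edges n) - card F)))"

abbreviation gnp_prob :: "nat \<Rightarrow> real \<Rightarrow> (nat set set \<Rightarrow> bool) \<Rightarrow> real" where
  "gnp_prob n p P \<equiv> gnp_expectation n p (\<lambda>F. of_bool (P F))"

lemma rbw_prob_eq: "rbw_prob n E p l = gnp_prob n p (\<lambda>F. rbw_arrow (E \<union> F) l)"
  unfolding rbw_prob_def gnp_expectation_def by (intro sum.cong) auto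

lemma gnp_expectation_mono:
  assumes "0 \<le> p" "p \<le> 1" and "\<And>F. F \<subseteq> all_edges n \<Longrightarrow> X F \<le> Y F"
  shows "gnp_expectation n p X \<le> gnp_expectation n p Y"
  unfolding gnp_expectation_def
  using assms by (intro sum_mono mult_right_mono) auto

lemma gnp_expectation_sum:
  "gnp_expectation n p (\<lambda>F. \<Sum>i\<in>I. X i F) = (\<Sum>i\<in>I. gnp_expectation n p (X i))"
  unfolding gnp_expectation_def sum_distrib_right by (rule sum.swap)

text \<open>The product of \<open>p + b e\<close> over all edges, where \<open>b e\<close> is 0 on
  \<open>T\<close> and \<open>1 - p\<close> elsewhere, has value \<open>p ^ card T\<close>.
  Expanding it over subsets kills exactly those that miss an edge of \<open>T\<close>.\<close>

lemma gnp_prob_superset: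
  assumes "T \<subseteq> all_edges n"
  shows "gnp_prob n p (\<lambda>F. T \<subseteq> F) = p ^ card T"
proof -
  let ?N = "all_edges n"
  have fin: "finite ?N" by (rule finite_all_edges)
  define b :: "nat set \<Rightarrow> real" where "b = (\<lambda>e. if e \<in> T then 0 else 1 - p)"
  have "p ^ card T = (\<Prod>e\<in>?N. p + b e)"
  proof -
    have "(\<Prod>e\<in>?N. p + b e) = (\<Prod>e\<in>T. p + b e) * (\<Prod>e\<in>?N - T. p + b e)"
      using prod.subset_diff[OF assms fin] by (simp add: mult.commute)
    also have "(\<Prod>e\<in>T. p + b e) = p ^ card T" by (simp add: b_def)
    also have "(\<Prod>e\<in>?N - T. p + b e) = 1" by (intro prod.neutral) (auto simp: b_def)
    finally show ?thesis by simp
  qed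
  also have "\<dots> = (\<Sum>F\<in>Pow ?N. (\<Prod>e\<in>F. p) * (\<Prod>e\<in>?N - F. b e))"
    by (rule prod_add[OF fin])
  also have "\<dots> = gnp_prob n p (\<lambda>F. T \<subseteq> F)"
    unfolding gnp_expectation_def
  proof (intro sum.cong refl)
    fix F assume F: "F \<in> Pow ?N"
    hence finF: "finite F" using fin finite_subset by auto
    show "(\<Prod>e\<in>F. p) * (\<Prod>e\<in>?N - F. b e) =
      of_bool (T \<subseteq> F) * (p ^ card F * (1 - p) ^ (card ?N - card F))"
    proof (cases "T \<subseteq> F")
      case True
      have "(\<Prod>e\<in>?N - F. b e) = (\<Prod>e\<in>?N - F. 1 - p)"
        using True by (intro prod.cong) (auto simp: b_def)
      thus ?thesis using True F finF by (simp add: card_Diff_subset)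
    next
      case False
      then obtain e where "e \<in> T" "e \<notin> F" by auto
      hence "(\<Prod>e\<in>?N - F. b e) = 0"
        using assms fin by (intro prod_zero) (auto simp: b_def intro!: bexI[of _ e])
      thus ?thesis using False by simp
    qed
  qed
  finally show ?thesis by simp
qed

lemma gnp_prob_le_1:
  assumes "0 \<le> p" "p \<le> 1"
  shows "gnp_prob n p P \<le> 1"
proof -
  have "gnp_prob n p P \<le> gnp_prob n p (\<lambda>F. {} \<subseteq> F)"
    using assms by (intro gnp_expectation_mono) auto
  thus ?thesis by (subst (asm) gnp_prob_superset) auto
qed

lemma gnp_prob_nonneg:
  assumes "0 \<le> p" "p \<le> 1"
  shows "0 \<le> gnp_prob n p P"
  unfolding gnp_expectation_def using assms by (intro sum_nonneg) auto

text \<open>Cauchy--Schwarz applied to the product of \<open>X\<close> and the indicator of \<open>X > 0\<close>.\<close>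

lemma gnp_second_moment:
  assumes p: "0 \<le> p" "p \<le> 1" and X: "\<And>F. 0 \<le> X F"
  shows "(gnp_expectation n p X)\<^sup>2 \<le>
    gnp_expectation n p (\<lambda>F. (X F)\<^sup>2) * gnp_prob n p (\<lambda>F. 0 < X F)"
proof -
  define w where "w F = p ^ card F * (1 - p) ^ (card (all_edges n) - card F)" for F :: "nat set set"
  have w: "w F \<ge> 0" for F using p by (simp add: w_def)
  have "gnp_expectation n p X =
      (\<Sum>F\<in>Pow (all_edges n). (X F * sqrt (w F)) * (of_bool (0 < X F) * sqrt (w F)))"
    unfolding gnp_expectation_def w_def[symmetric]
  proof (intro sum.cong refl)
    fix F
    have "X F = X F * of_bool (0 < X F)" using X[of F] by auto
    thus "X F * w F = X F * sqrt (w F) * (of_bool (0 < X F) * sqrt (w F))"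
      using w[of F] by (metis (no_types, lifting) mult.assoc mult.left_commute real_sqrt_mult_self abs_of_nonneg)
  qed
  moreover have "(\<Sum>F\<in>Pow (all_edges n). (X F * sqrt (w F))\<^sup>2) = gnp_expectation n p (\<lambda>F. (X F)\<^sup>2)"
    unfolding gnp_expectation_def w_def[symmetric]
    by (intro sum.cong refl) (simp add: power_mult_distrib w)
  moreover have "(\<Sum>F\<in>Pow (all_edges n). (of_bool (0 < X F) * sqrt (w F))\<^sup>2) =
      gnp_prob n p (\<lambda>F. 0 < X F)"
    unfolding gnp_expectation_def w_def[symmetric]
    by (intro sum.cong refl) (simp add: power_mult_distrib w)
  ultimately show ?thesis
    using Cauchy_Schwarz_ineq_sum[of "\<lambda>F. X F * sqrt (w F)" "\<lambda>F. of_bool (0 < X F) * sqrt (w F)"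
        "Pow (all_edges n)"] by simp
qed

section \<open>First moment: local sparseness\<close>

definition edge_count :: "nat set set \<Rightarrow> nat set \<Rightarrow> nat" where
  "edge_count F S = card (F \<inter> clique_edges S)"

text \<open>The inequality is strict because for p = o(n^(-a)) even a set with a e(S) = |S| is
  unlikely to occur; the extremal patterns of the 1-statements have exactly this density.\<close>

definition locally_sparse :: "real \<Rightarrow> nat \<Rightarrow> nat set set \<Rightarrow> bool" where
  "locally_sparse a K F \<longleftrightarrow>
     (\<forall>S. finite S \<longrightarrow> S \<noteq> {} \<longrightarrow> card S \<le> K \<longrightarrow> a * edge_count F S < card S)"

text \<open>There are at most n^k sets of size k, which cancels the weight, so each of the sizes 1,
  ..., \<open>K\<close> contributes at most \<open>w\<close>.\<close>

lemma sum_card_bounded_le: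
  fixes w :: real
  assumes n: "n \<ge> 1" and w: "w \<ge> 0"
  shows "(\<Sum>S\<in>{S. S \<subseteq> {..<n} \<and> S \<noteq> {} \<and> card S \<le> K}. w / real n ^ card S) \<le> K * w"
proof -
  let ?A = "{S. S \<subseteq> {..<n} \<and> S \<noteq> {} \<and> card S \<le> K}"
  have fin: "finite ?A" by (rule finite_subset[of _ "Pow {..<n}"]) auto
  have "(\<Sum>S\<in>?A. w / real n ^ card S) = (\<Sum>k\<in>{1..K}. \<Sum>S\<in>{S\<in>?A. card S = k}. w / real n ^ card S)"
    by (rule sum.group[symmetric])
       (use fin finite_subset[of _ "{..<n}"] in \<open>auto simp: Suc_le_eq card_gt_0_iff\<close>)
  also have "\<dots> \<le> (\<Sum>k\<in>{1..K}. w)"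
  proof (rule sum_mono)
    fix k assume k: "k \<in> {1..K}"
    have "card {S\<in>?A. card S = k} \<le> card {S. S \<subseteq> {..<n} \<and> card S = k}"
      by (intro card_mono) (auto intro: finite_subset[of _ "Pow {..<n}"])
    also have "\<dots> = n choose k" using n_subsets[of "{..<n}" k] by simp
    also have "\<dots> \<le> n ^ k" by (cases "k \<le> n") (simp_all add: binomial_le_pow binomial_eq_0)
    finally have c: "real (card {S\<in>?A. card S = k}) \<le> real n ^ k"
      unfolding of_nat_power[symmetric] of_nat_le_iff .
    have "(\<Sum>S\<in>{S\<in>?A. card S = k}. w / real n ^ card S) = card {S\<in>?A. card S = k} * (w / real n ^ k)"
      by simp
    also have "\<dots> \<le> real n ^ k * (w / real n ^ k)"
      using c w by (intro mult_right_mono) auto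
    also have "\<dots> = w" using n by simp
    finally show "(\<Sum>S\<in>{S\<in>?A. card S = k}. w / real n ^ card S) \<le> w" .
  qed
  also have "\<dots> = K * w" by simp
  finally show ?thesis .
qed

text \<open>Union bound over vertex sets \<open>S\<close> and edge sets \<open>T\<close> on
  \<open>S\<close> with |S| <= a |T|. Such a \<open>T\<close> is nonempty, so p^|T| = w^|T|
  n^(-a|T|) <= w n^(-|S|), and each \<open>S\<close> carries at most 2^(K choose 2) sets
  \<open>T\<close>.\<close>

lemma prob_not_locally_sparse:
  fixes p w a :: real
  assumes n: "n \<ge> 1" and p: "0 \<le> p" "p \<le> 1" and w: "0 \<le> w" "w \<le> 1"
    and pw: "p = w * real n powr (-a)"
  shows "gnp_prob n p (\<lambda>F. \<not> locally_sparse a K F) \<le> K * (2 ^ (K choose 2) * w)"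
proof -
  define AA where "AA = {S. S \<subseteq> {..<n} \<and> S \<noteq> {} \<and> card S \<le> K}"
  define TT where "TT S = {T. T \<subseteq> clique_edges S \<and> card S \<le> a * card T}" for S :: "nat set"
  have finAA: "finite AA" unfolding AA_def by (rule finite_subset[of _ "Pow {..<n}"]) auto
  have finS: "finite S" if "S \<in> AA" for S
    using that by (auto simp: AA_def intro: finite_subset)
  have finTT: "finite (TT S)" if "S \<in> AA" for S
    using finite_clique_edges[OF finS[OF that]] by (simp add: TT_def)
  have "gnp_prob n p (\<lambda>F. \<not> locally_sparse a K F) \<le>
      gnp_expectation n p (\<lambda>F. \<Sum>S\<in>AA. \<Sum>T\<in>TT S. of_bool (T \<subseteq> F))"
  proof (rule gnp_expectation_mono[OF p])
    fix F assume F: "F \<subseteq> all_edges n"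
    have nonneg: "0 \<le> (\<Sum>S\<in>AA. \<Sum>T\<in>TT S. of_bool (T \<subseteq> F) :: real)"
      by (intro sum_nonneg) auto
    show "of_bool (\<not> locally_sparse a K F) \<le> (\<Sum>S\<in>AA. \<Sum>T\<in>TT S. of_bool (T \<subseteq> F) :: real)"
    proof (cases "locally_sparse a K F")
      case False
      then obtain S0 where S0: "finite S0" "S0 \<noteq> {}" "card S0 \<le> K" "a * edge_count F S0 \<ge> card S0"
        unfolding locally_sparse_def by (auto simp: not_less)
      \<comment> \<open>A violating set may contain numbers beyond the vertex set; cutting them off
        loses no edge and only shrinks the set.\<close>
      define S where "S = S0 \<inter> {..<n}"
      define T where "T = F \<inter> clique_edges S"
      have TS0: "F \<inter> clique_edges S0 = T"
        using F unfolding T_def S_def all_edges_eq by (auto simp: clique_edges_eq)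
      have cS: "card S \<le> card S0" using S0(1) by (auto simp: S_def intro: card_mono)
      have le: "card S0 \<le> a * card T" using S0(4) TS0 by (simp add: edge_count_def)
      have "card S0 > 0" using S0 by (simp add: card_gt_0_iff)
      hence "T \<noteq> {}" using le by auto
      hence "S \<noteq> {}" by (auto simp: T_def clique_edges_eq)
      hence S: "S \<in> AA" using S0 cS by (auto simp: AA_def S_def)
      have T: "T \<in> TT S" using le cS by (auto simp: TT_def T_def)
      have "(1::real) = of_bool (T \<subseteq> F)" by (simp add: T_def)
      also have "\<dots> \<le> (\<Sum>T\<in>TT S. of_bool (T \<subseteq> F))"
        using finTT[OF S] T by (intro member_le_sum) auto
      also have "\<dots> \<le> (\<Sum>S\<in>AA. \<Sum>T\<in>TT S. of_bool (T \<subseteq> F))"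
        using finAA S
        by (intro member_le_sum[of S AA "\<lambda>S. \<Sum>T\<in>TT S. of_bool (T \<subseteq> F)"]) (auto intro: sum_nonneg)
      finally show ?thesis using False by simp
    qed (use nonneg in simp)
  qed
  also have "\<dots> = (\<Sum>S\<in>AA. \<Sum>T\<in>TT S. gnp_prob n p (\<lambda>F. T \<subseteq> F))"
    by (simp add: gnp_expectation_sum)
  also have "\<dots> \<le> (\<Sum>S\<in>AA. (2 ^ (K choose 2) * w) / real n ^ card S)"
  proof (rule sum_mono)
    fix S assume S: "S \<in> AA"
    have "(\<Sum>T\<in>TT S. gnp_prob n p (\<lambda>F. T \<subseteq> F)) \<le> (\<Sum>T\<in>TT S. w / real n ^ card S)"
    proof (rule sum_mono)
      fix T assume T: "T \<in> TT S"
      have "T \<subseteq> all_edges n"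
        using T S clique_edges_mono[of S "{..<n}"] by (auto simp: TT_def AA_def all_edges_eq)
      hence "gnp_prob n p (\<lambda>F. T \<subseteq> F) = p ^ card T" by (rule gnp_prob_superset)
      also have "\<dots> = w ^ card T * real n powr (- (a * card T))"
        using n by (simp add: pw power_mult_distrib powr_powr flip: powr_realpow)
      also have "\<dots> \<le> w * real n powr (- real (card S))"
      proof (intro mult_mono)
        have "S \<noteq> {}" using S by (auto simp: AA_def)
        hence "card S > 0" using finS[OF S] by (simp add: card_gt_0_iff)
        moreover have "card S \<le> a * card T" using T by (simp add: TT_def)
        ultimately have "card T \<noteq> 0" by (intro notI) auto
        thus "w ^ card T \<le> w" using w power_decreasing[of 1 "card T" w] by simp
        show "real n powr (- (a * card T)) \<le> real n powr (- real (card S))"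
          using n T by (intro powr_mono) (auto simp: TT_def)
      qed (use w in auto)
      also have "\<dots> = w / real n ^ card S"
        using n by (simp add: powr_minus divide_inverse powr_realpow)
      finally show "gnp_prob n p (\<lambda>F. T \<subseteq> F) \<le> w / real n ^ card S" .
    qed
    also have "\<dots> = card (TT S) * (w / real n ^ card S)" by simp
    also have "\<dots> \<le> 2 ^ (K choose 2) * (w / real n ^ card S)"
    proof (intro mult_right_mono)
      have "card (TT S) \<le> card (Pow (clique_edges S))"
        using finite_clique_edges[OF finS[OF S]] by (intro card_mono) (auto simp: TT_def)
      also have "\<dots> = 2 ^ (card S choose 2)"
        using finS[OF S] by (simp add: card_Pow finite_clique_edges card_clique_edges)
      also have "\<dots> \<le> 2 ^ (K choose 2)"
        using S by (intro power_increasing binomial_right_mono) (auto simp: AA_def)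
      finally show "real (card (TT S)) \<le> 2 ^ (K choose 2)" by (metis of_nat_le_iff of_nat_numeral of_nat_power)
    qed (use w in auto)
    finally show "(\<Sum>T\<in>TT S. gnp_prob n p (\<lambda>F. T \<subseteq> F)) \<le> (2 ^ (K choose 2) * w) / real n ^ card S"
      by simp
  qed
  also have "\<dots> \<le> K * (2 ^ (K choose 2) * w)"
    unfolding AA_def by (rule sum_card_bounded_le) (use n w in auto)
  finally show ?thesis .
qed

lemma zero_statement:
  fixes a :: real and p :: "nat \<Rightarrow> real" and G :: "nat \<Rightarrow> nat set set"
  assumes p: "\<And>n. 0 \<le> p n \<and> p n \<le> 1" and lim: "(\<lambda>n. p n / real n powr (-a)) \<longlonglongrightarrow> 0"
    and col: "\<And>n F. F \<subseteq> all_edges n \<Longrightarrow> locally_sparse a K F \<Longrightarrow> \<not> rbw_arrow (G n \<union> F) l"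
  shows "(\<lambda>n. rbw_prob n (G n) (p n) l) \<longlonglongrightarrow> 0"
proof (rule tendsto_sandwich[OF _ _ tendsto_const])
  define w where "w n = p n / real n powr (-a)" for n
  show "\<forall>\<^sub>F n in sequentially. 0 \<le> rbw_prob n (G n) (p n) l"
    using p by (intro always_eventually) (simp add: rbw_prob_eq gnp_prob_nonneg)
  show "(\<lambda>n. K * (2 ^ (K choose 2) * w n)) \<longlonglongrightarrow> 0"
    using tendsto_mult_left[OF tendsto_mult_left[OF lim, of "2 ^ (K choose 2)"], of "real K"]
    by (simp add: w_def)
  have "\<forall>\<^sub>F n in sequentially. w n < 1"
    using order_tendstoD(2)[OF lim, of 1] by (simp add: w_def)
  thus "\<forall>\<^sub>F n in sequentially. rbw_prob n (G n) (p n) l \<le> K * (2 ^ (K choose 2) * w n)"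
    using eventually_ge_at_top[of 1]
  proof eventually_elim
    case (elim n)
    have "rbw_prob n (G n) (p n) l \<le> gnp_prob n (p n) (\<lambda>F. \<not> locally_sparse a K F)"
      unfolding rbw_prob_eq using p col by (intro gnp_expectation_mono) auto
    also have "\<dots> \<le> K * (2 ^ (K choose 2) * w n)"
      using elim p[of n] by (intro prob_not_locally_sparse) (auto simp: w_def)
    finally show ?case .
  qed
qed

section \<open>Second moment: copies of a pattern graph\<close>

definition embeddings :: "'v set \<Rightarrow> nat \<Rightarrow> ('v \<Rightarrow> nat) set" where
  "embeddings I n = {\<phi> \<in> I \<rightarrow>\<^sub>E {..<n}. inj_on \<phi> I}"

lemma finite_embeddings: "finite I \<Longrightarrow> finite (embeddings I n)"
  unfolding embeddings_def by (rule finite_subset[of _ "I \<rightarrow>\<^sub>E {..<n}"]) (auto intro: finite_PiE)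

text \<open>The sum factorises over the pattern vertices because \<open>n ^ card {\<dots>}\<close> is a product over \<open>I\<close>.\<close>

lemma sum_embeddings_overlap:
  fixes n :: nat
  assumes I: "finite I" and \<phi>: "\<phi> \<in> embeddings I n"
  shows "(\<Sum>\<psi>\<in>embeddings I n. real n ^ card {i\<in>I. \<psi> i \<in> \<phi> ` I}) \<le> (real (card I + 1) * n) ^ card I"
proof -
  define f :: "nat \<Rightarrow> real" where "f x = (if x \<in> \<phi> ` I then real n else 1)" for x
  have f: "f x \<ge> 0" for x by (simp add: f_def)
  have sub: "\<phi> ` I \<subseteq> {..<n}" and inj: "inj_on \<phi> I" using \<phi> by (auto simp: embeddings_def)
  have "(\<Sum>\<psi>\<in>embeddings I n. real n ^ card {i\<in>I. \<psi> i \<in> \<phi> ` I}) =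
      (\<Sum>\<psi>\<in>embeddings I n. \<Prod>i\<in>I. f (\<psi> i))"
    by (intro sum.cong refl) (use I in \<open>simp add: f_def prod.If_cases Int_def\<close>)
  also have "\<dots> \<le> (\<Sum>\<psi>\<in>I \<rightarrow>\<^sub>E {..<n}. \<Prod>i\<in>I. f (\<psi> i))"
    using I f by (intro sum_mono2 finite_PiE) (auto simp: embeddings_def intro: prod_nonneg)
  also have "\<dots> = (\<Prod>i\<in>I. \<Sum>x<n. f x)"
    using I by (intro prod_sum_PiE[symmetric]) auto
  also have "(\<Sum>x<n. f x) = real (card I) * n + real (card ({..<n} - \<phi> ` I))"
    using sub inj by (simp add: f_def sum.If_cases Int_absorb1 card_image Diff_eq)
  also have "(\<Prod>i\<in>I. real (card I) * n + real (card ({..<n} - \<phi> ` I))) \<le> (\<Prod>i\<in>I. real (card I + 1) * n)"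
  proof (intro prod_mono conjI)
    have "card ({..<n} - \<phi> ` I) \<le> card {..<n}" by (intro card_mono) auto
    thus "real (card I) * n + real (card ({..<n} - \<phi> ` I)) \<le> real (card I + 1) * n"
      by (simp add: algebra_simps)
  qed auto
  also have "\<dots> = (real (card I + 1) * n) ^ card I" by simp
  finally show ?thesis .
qed

text \<open>For \<open>a > 0\<close>: every subgraph of the pattern has at most 1/a edges per
  vertex. This makes the expected number of copies of each subgraph with an edge tend to infinity
  when p n^a does, as the second moment method requires.\<close>

definition dense_bounded :: "real \<Rightarrow> 'v set \<Rightarrow> 'v set set \<Rightarrow> bool" where
  "dense_bounded a I H \<longleftrightarrow> (\<forall>S\<subseteq>I. a * card {e\<in>H. e \<subseteq> S} \<le> card S)"

lemma card_image_edges: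
  assumes "inj_on \<phi> I" "H \<subseteq> Pow I"
  shows "card ((`) \<phi> ` H) = card H"
  using inj_on_image_Pow[OF assms(1)] assms(2) by (intro card_image) (rule inj_on_subset)

text \<open>Shared edges of the two copies lie over \<open>S\<close>, the pattern vertices that
  \<open>\<psi>\<close> sends into the other copy. If there are any, the density bound gives p^|A
  \<inter> B| >= w n^(-|S|), which is the factor by which the pair exceeds independence; otherwise
  the summand 1 suffices. Bounding through |S| alone is what lets the sum over \<open>\<psi>\<close>
  factorise.\<close>

lemma overlap_weight:
  fixes p w a :: real
  assumes I: "finite I" and H: "H \<subseteq> Pow I"
    and dens: "dense_bounded a I H"
    and \<phi>: "\<phi> \<in> embeddings I n" and \<psi>: "\<psi> \<in> embeddings I n"
    and n: "n \<ge> 1" and w: "w \<ge> 1" and pw: "p = w * real n powr (-a)"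
  shows "p ^ card ((`) \<phi> ` H \<union> (`) \<psi> ` H) \<le>
    (p ^ card H)\<^sup>2 * (1 + real n ^ card {i\<in>I. \<psi> i \<in> \<phi> ` I} / w)"
proof -
  define A where "A = (`) \<phi> ` H"
  define B where "B = (`) \<psi> ` H"
  define S where "S = {i\<in>I. \<psi> i \<in> \<phi> ` I}"
  have finH: "finite H" using I H by (simp add: finite_subset)
  have p: "p > 0" using n w pw by simp
  have cA: "card A = card H" and cB: "card B = card H"
    using \<phi> \<psi> H unfolding A_def B_def by (auto simp: embeddings_def intro: card_image_edges)
  have finA: "finite A" and finB: "finite B" using finH by (auto simp: A_def B_def)
  have cU: "card (A \<union> B) + card (A \<inter> B) = 2 * card H"
    using card_Un_Int[OF finA finB] cA cB by simp
  have bound: "p ^ card (A \<union> B) * p ^ card (A \<inter> B) = (p ^ card H)\<^sup>2"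
    unfolding power_add[symmetric] cU by (simp add: power_mult[symmetric] mult.commute)
  show ?thesis
  proof (cases "A \<inter> B = {}")
    case True
    hence "p ^ card (A \<union> B) = (p ^ card H)\<^sup>2" using bound by simp
    moreover have "(p ^ card H)\<^sup>2 * 1 \<le> (p ^ card H)\<^sup>2 * (1 + real n ^ card S / w)"
      using w by (intro mult_left_mono) auto
    ultimately show ?thesis unfolding A_def B_def S_def by simp
  next
    case False
    define J where "J = {e\<in>H. e \<subseteq> S}"
    have "A \<inter> B \<subseteq> (`) \<psi> ` J"
    proof
      fix x assume x: "x \<in> A \<inter> B"
      then obtain e e' where e: "e \<in> H" "x = \<psi> ` e" "e' \<in> H" "x = \<phi> ` e'" by (auto simp: A_def B_def)
      have "\<phi> ` e' \<subseteq> \<phi> ` I" using e(3) H by (intro image_mono) auto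
      hence "\<psi> ` e \<subseteq> \<phi> ` I" using e by simp
      hence "e \<subseteq> S" using e(1) H by (auto simp: S_def)
      thus "x \<in> (`) \<psi> ` J" using e by (auto simp: J_def)
    qed
    hence 1: "card (A \<inter> B) \<le> card J"
      using finH by (intro surj_card_le) (auto simp: J_def)
    have 2: "a * card J \<le> card S"
      using dens unfolding dense_bounded_def J_def S_def by auto
    have 3: "a * card (A \<inter> B) \<le> card S"
    proof (cases "a \<ge> 0")
      case True
      have "a * card (A \<inter> B) \<le> a * card J" using 1 True by (intro mult_left_mono) auto
      thus ?thesis using 2 by simp
    next
      case False
      hence "a * card (A \<inter> B) \<le> 0" by (simp add: mult_le_0_iff)
      thus ?thesis by linarith
    qed
    have c0: "card (A \<inter> B) \<ge> 1" using False finA by (simp add: Suc_le_eq card_gt_0_iff)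
    have "p ^ card (A \<inter> B) = w ^ card (A \<inter> B) * real n powr (- (a * card (A \<inter> B)))"
      using n by (simp add: pw power_mult_distrib powr_powr flip: powr_realpow)
    also have "\<dots> \<ge> w * real n powr (- real (card S))"
      using w n 3 power_increasing[OF c0 w] by (intro mult_mono powr_mono) auto
    also have "w * real n powr (- real (card S)) = w / real n ^ card S"
      using n by (simp add: powr_minus divide_inverse powr_realpow)
    finally have "w / real n ^ card S \<le> p ^ card (A \<inter> B)" by simp
    hence "p ^ card (A \<union> B) * (w / real n ^ card S) \<le> p ^ card (A \<union> B) * p ^ card (A \<inter> B)"
      using p by (intro mult_left_mono) auto
    hence "p ^ card (A \<union> B) \<le> (p ^ card H)\<^sup>2 * (real n ^ card S / w)"
      unfolding bound using n w by (simp add: field_simps)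
    also have "\<dots> \<le> (p ^ card H)\<^sup>2 * (1 + real n ^ card S / w)"
      by (intro mult_left_mono) auto
    finally show ?thesis unfolding A_def B_def S_def .
  qed
qed

text \<open>The bound is (E X)^2 / E X^2 for the number \<open>X\<close> of embeddings in
  \<open>\<Phi>\<close> that appear. Once \<open>\<Phi>\<close> has order n^|I| elements, the error
  term is O(1/w). Counting only \<open>\<Phi>\<close> restricts attention to copies that sit well
  inside the dense graph.\<close>

lemma prob_contains_embedding:
  fixes p w a :: real
  assumes I: "finite I" and H: "H \<subseteq> {e. e \<subseteq> I \<and> card e = 2}"
    and dens: "dense_bounded a I H"
    and \<Phi>: "\<Phi> \<subseteq> embeddings I n" "\<Phi> \<noteq> {}"
    and n: "n \<ge> 1" and p: "0 \<le> p" "p \<le> 1" and w: "w \<ge> 1" and pw: "p = w * real n powr (-a)"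
  shows "gnp_prob n p (\<lambda>F. \<exists>\<phi>\<in>\<Phi>. (`) \<phi> ` H \<subseteq> F) \<ge>
    1 / (1 + (real (card I + 1) * n) ^ card I / (w * card \<Phi>))"
proof -
  define X :: "nat set set \<Rightarrow> real" where "X F = (\<Sum>\<phi>\<in>\<Phi>. of_bool ((`) \<phi> ` H \<subseteq> F))" for F
  define M where "M = (real (card I + 1) * n) ^ card I"
  have HI: "H \<subseteq> Pow I" using H by auto
  have fin\<Phi>: "finite \<Phi>" using \<Phi>(1) finite_embeddings[OF I] finite_subset by auto
  have p0: "p > 0" using n w pw by simp
  have sub: "(`) \<phi> ` H \<subseteq> all_edges n" if "\<phi> \<in> \<Phi>" for \<phi>
  proof
    fix x assume "x \<in> (`) \<phi> ` H"
    then obtain e where e: "e \<subseteq> I" "card e = 2" "x = \<phi> ` e" using H by auto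
    moreover have \<phi>: "inj_on \<phi> I" "\<phi> ` I \<subseteq> {..<n}" using that \<Phi> by (auto simp: embeddings_def)
    moreover have "card x = 2" using e card_image[OF inj_on_subset[OF \<phi>(1) e(1)]] by simp
    ultimately show "x \<in> all_edges n" by (auto simp: all_edges_eq clique_edges_eq)
  qed
  have EX: "gnp_expectation n p X = card \<Phi> * p ^ card H"
  proof -
    have "gnp_expectation n p X = (\<Sum>\<phi>\<in>\<Phi>. p ^ card ((`) \<phi> ` H))"
      unfolding X_def gnp_expectation_sum using sub by (intro sum.cong refl gnp_prob_superset) auto
    also have "\<dots> = (\<Sum>\<phi>\<in>\<Phi>. p ^ card H)"
      using \<Phi> HI by (intro sum.cong refl arg_cong[of _ _ "(^) p"] card_image_edges) (auto simp: embeddings_def)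
    finally show ?thesis by simp
  qed
  have "gnp_expectation n p (\<lambda>F. (X F)\<^sup>2) =
      (\<Sum>\<phi>\<in>\<Phi>. \<Sum>\<psi>\<in>\<Phi>. gnp_prob n p (\<lambda>F. (`) \<phi> ` H \<union> (`) \<psi> ` H \<subseteq> F))"
    unfolding X_def power2_eq_square sum_product gnp_expectation_sum
    by (simp add: of_bool_conj flip: gnp_expectation_sum)
  also have "\<dots> = (\<Sum>\<phi>\<in>\<Phi>. \<Sum>\<psi>\<in>\<Phi>. p ^ card ((`) \<phi> ` H \<union> (`) \<psi> ` H))"
    using sub by (intro sum.cong refl gnp_prob_superset) auto
  also have "\<dots> \<le> (\<Sum>\<phi>\<in>\<Phi>. \<Sum>\<psi>\<in>\<Phi>. (p ^ card H)\<^sup>2 * (1 + real n ^ card {i\<in>I. \<psi> i \<in> \<phi> ` I} / w))"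
    using \<Phi> by (intro sum_mono overlap_weight[OF I HI dens _ _ n w pw]) auto
  also have "\<dots> \<le> (\<Sum>\<phi>\<in>\<Phi>. (p ^ card H)\<^sup>2 * (card \<Phi> + M / w))"
  proof (rule sum_mono)
    fix \<phi> assume \<phi>: "\<phi> \<in> \<Phi>"
    have "(\<Sum>\<psi>\<in>\<Phi>. real n ^ card {i\<in>I. \<psi> i \<in> \<phi> ` I}) \<le>
        (\<Sum>\<psi>\<in>embeddings I n. real n ^ card {i\<in>I. \<psi> i \<in> \<phi> ` I})"
      using \<Phi> finite_embeddings[OF I] by (intro sum_mono2) auto
    also have "\<dots> \<le> M" unfolding M_def using \<phi> \<Phi> by (intro sum_embeddings_overlap[OF I]) auto
    finally have "(\<Sum>\<psi>\<in>\<Phi>. real n ^ card {i\<in>I. \<psi> i \<in> \<phi> ` I}) / w \<le> M / w"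
      using w by (intro divide_right_mono) auto
    hence "(p ^ card H)\<^sup>2 * (card \<Phi> + (\<Sum>\<psi>\<in>\<Phi>. real n ^ card {i\<in>I. \<psi> i \<in> \<phi> ` I}) / w)
       \<le> (p ^ card H)\<^sup>2 * (card \<Phi> + M / w)"
      by (intro mult_left_mono) auto
    thus "(\<Sum>\<psi>\<in>\<Phi>. (p ^ card H)\<^sup>2 * (1 + real n ^ card {i\<in>I. \<psi> i \<in> \<phi> ` I} / w)) \<le>
      (p ^ card H)\<^sup>2 * (card \<Phi> + M / w)"
      by (simp add: sum.distrib flip: sum_distrib_left sum_divide_distrib)
  qed
  also have "\<dots> = card \<Phi> * (p ^ card H)\<^sup>2 * (card \<Phi> + M / w)" by simp
  finally have EX2: "gnp_expectation n p (\<lambda>F. (X F)\<^sup>2) \<le> card \<Phi> * (p ^ card H)\<^sup>2 * (card \<Phi> + M / w)" .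
  define P where "P = gnp_prob n p (\<lambda>F. 0 < X F)"
  have c0: "real (card \<Phi>) > 0" using fin\<Phi> \<Phi>(2) by (simp add: card_gt_0_iff)
  have M0: "M \<ge> 0" by (simp add: M_def)
  have "(card \<Phi> * p ^ card H)\<^sup>2 \<le> gnp_expectation n p (\<lambda>F. (X F)\<^sup>2) * P"
    using gnp_second_moment[OF p, of X n] EX by (simp add: P_def X_def sum_nonneg)
  also have "\<dots> \<le> card \<Phi> * (p ^ card H)\<^sup>2 * (card \<Phi> + M / w) * P"
    using EX2 gnp_prob_nonneg[OF p] by (intro mult_right_mono) (auto simp: P_def)
  finally have "(card \<Phi> * (p ^ card H)\<^sup>2) * card \<Phi> \<le> (card \<Phi> * (p ^ card H)\<^sup>2) * ((card \<Phi> + M / w) * P)"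
    by (simp add: power2_eq_square mult_ac)
  hence "card \<Phi> \<le> (card \<Phi> + M / w) * P"
    using c0 p0 by (subst (asm) mult_le_cancel_left_pos) auto
  hence "1 / (1 + M / (w * card \<Phi>)) \<le> P"
  proof -
    have pos: "w * card \<Phi> + M > 0" using c0 w M0 by (intro add_pos_nonneg mult_pos_pos) auto
    have "w * card \<Phi> \<le> w * ((card \<Phi> + M / w) * P)"
      using \<open>card \<Phi> \<le> (card \<Phi> + M / w) * P\<close> w by (intro mult_left_mono) auto
    also have "\<dots> = (w * card \<Phi> + M) * P" using w by (simp add: field_simps)
    finally have "w * card \<Phi> / (w * card \<Phi> + M) \<le> P"
      using pos by (simp add: pos_divide_le_eq mult.commute)
    moreover have "1 / (1 + M / (w * card \<Phi>)) = w * card \<Phi> / (w * card \<Phi> + M)"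
      using c0 w pos by (simp add: field_simps)
    ultimately show ?thesis by simp
  qed
  also have "P \<le> gnp_prob n p (\<lambda>F. \<exists>\<phi>\<in>\<Phi>. (`) \<phi> ` H \<subseteq> F)"
    unfolding P_def
  proof (rule gnp_expectation_mono[OF p])
    fix F
    show "of_bool (0 < X F) \<le> (of_bool (\<exists>\<phi>\<in>\<Phi>. (`) \<phi> ` H \<subseteq> F) :: real)"
      by (cases "\<exists>\<phi>\<in>\<Phi>. (`) \<phi> ` H \<subseteq> F") (auto simp: X_def)
  qed
  finally show ?thesis unfolding M_def .
qed

section \<open>Complete bipartite subgraphs of dense graphs\<close>

lemma convex_on_power_nonneg: "convex_on {0::real..} (\<lambda>x. x ^ k)"
  using convex_power_even[of k] convex_power_odd[of k]
  by (cases "even k") (auto intro: convex_on_subset)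

text \<open>Jensen's inequality for x^(k+1), with denominators cleared so that the empty set is
  included.\<close>

lemma power_sum_le:
  fixes f :: "'a \<Rightarrow> real"
  assumes S: "finite S" and f: "\<And>x. x \<in> S \<Longrightarrow> 0 \<le> f x"
  shows "(\<Sum>x\<in>S. f x) ^ Suc k \<le> real (card S) ^ k * (\<Sum>x\<in>S. f x ^ Suc k)"
proof (cases "S = {}")
  case False
  define m where "m = real (card S)"
  have m: "m > 0" using S False by (simp add: m_def card_gt_0_iff)
  have "(\<Sum>x\<in>S. (1 / m) *\<^sub>R f x) ^ Suc k \<le> (\<Sum>x\<in>S. (1 / m) * f x ^ Suc k)"
    using S False f m
    by (intro convex_on_sum[where f = "\<lambda>x. x ^ Suc k" and C = "{0..}"] convex_on_power_nonneg)
       (auto simp: m_def)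
  hence "((\<Sum>x\<in>S. f x) / m) ^ Suc k \<le> (\<Sum>x\<in>S. f x ^ Suc k) / m"
    by (simp add: sum_divide_distrib)
  hence "(\<Sum>x\<in>S. f x) ^ Suc k \<le> m ^ Suc k * ((\<Sum>x\<in>S. f x ^ Suc k) / m)"
    using m by (simp add: power_divide field_simps)
  also have "\<dots> = m ^ k * (\<Sum>x\<in>S. f x ^ Suc k)" using m by simp
  finally show ?thesis by (simp add: m_def)
qed auto

text \<open>Handshake: the map from ordered adjacent pairs to edges is two-to-one.\<close>

lemma sum_adjacency:
  assumes E: "E \<subseteq> all_edges n"
  shows "(\<Sum>v<n. \<Sum>u<n. of_bool ({u, v} \<in> E)) = 2 * real (card E)"
proof -
  have finE: "finite E" using E finite_all_edges finite_subset by auto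
  define P where "P = {(v, u). {u, v} \<in> E}"
  have P: "P \<subseteq> {..<n} \<times> {..<n}" using E by (auto simp: P_def all_edges_eq clique_edges_eq)
  hence finP: "finite P" by (rule finite_subset) auto
  have "(\<Sum>v<n. \<Sum>u<n. of_bool ({u, v} \<in> E)) = (\<Sum>(v, u)\<in>{..<n} \<times> {..<n}. of_bool ((v, u) \<in> P) :: real)"
    by (simp only: sum.cartesian_product P_def mem_Collect_eq prod.case)
  also have "\<dots> = (\<Sum>x\<in>P. 1)"
    using P by (intro sum.mono_neutral_cong_right) auto
  also have "\<dots> = (\<Sum>e\<in>E. \<Sum>x\<in>{x\<in>P. (\<lambda>(v, u). {u, v}) x = e}. 1)"
    by (rule sum.group[symmetric]) (use finE finP in \<open>auto simp: P_def\<close>)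
  also have "\<dots> = (\<Sum>e\<in>E. 2)"
  proof (rule sum.cong[OF refl])
    fix e assume e: "e \<in> E"
    then obtain a b where ab: "e = {a, b}" "a \<noteq> b"
      using E by (auto simp: all_edges_eq clique_edges_def)
    have "{x\<in>P. (\<lambda>(v, u). {u, v}) x = e} = {(a, b), (b, a)}"
      using e ab by (auto simp: P_def doubleton_eq_iff insert_commute)
    thus "(\<Sum>x\<in>{x\<in>P. (\<lambda>(v, u). {u, v}) x = e}. 1) = (2::real)" using ab by simp
  qed
  finally show ?thesis by simp
qed

text \<open>Homomorphisms rather than embeddings of the complete bipartite graph: without
  injectivity their number factorises. Injectivity is recovered afterwards by discarding a
  lower-order term.\<close>

definition biclique_maps :: "'v set \<Rightarrow> 'v set \<Rightarrow> nat \<Rightarrow> nat set set \<Rightarrow> ('v \<Rightarrow> nat) set" where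
  "biclique_maps A B n E = {\<phi> \<in> A \<union> B \<rightarrow>\<^sub>E {..<n}. \<forall>i\<in>A. \<forall>j\<in>B. {\<phi> i, \<phi> j} \<in> E}"

text \<open>Once the images of \<open>A\<close> are fixed, each vertex of \<open>B\<close> is placed
  independently on a common neighbour.\<close>

lemma card_biclique_maps_eq:
  assumes A: "finite A" and B: "finite B" and AB: "A \<inter> B = {}"
  shows "real (card (biclique_maps A B n E)) =
    (\<Sum>x\<in>A \<rightarrow>\<^sub>E {..<n}. (\<Sum>v<n. \<Prod>i\<in>A. of_bool ({x i, v} \<in> E)) ^ card B)"
proof -
  let ?X = "A \<rightarrow>\<^sub>E {..<n}" and ?Y = "B \<rightarrow>\<^sub>E {..<n}"
  have ob: "(\<Prod>k\<in>K. of_bool (P k)) = (of_bool (\<forall>k\<in>K. P k) :: real)" if "finite K" for K :: "'a set" and P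
    using that by (induction K) auto
  have "(\<Sum>x\<in>?X. (\<Sum>v<n. \<Prod>i\<in>A. of_bool ({x i, v} \<in> E)) ^ card B) =
      (\<Sum>x\<in>?X. \<Sum>y\<in>?Y. of_bool (\<forall>j\<in>B. \<forall>i\<in>A. {x i, y j} \<in> E) :: real)"
  proof (rule sum.cong[OF refl])
    fix x
    have "(\<Sum>v<n. \<Prod>i\<in>A. of_bool ({x i, v} \<in> E) :: real) ^ card B =
        (\<Prod>j\<in>B. \<Sum>v<n. of_bool (\<forall>i\<in>A. {x i, v} \<in> E))"
      by (simp add: ob A)
    also have "\<dots> = (\<Sum>y\<in>?Y. \<Prod>j\<in>B. of_bool (\<forall>i\<in>A. {x i, y j} \<in> E))"
      by (intro prod_sum_PiE B) auto
    finally show "(\<Sum>v<n. \<Prod>i\<in>A. of_bool ({x i, v} \<in> E)) ^ card B =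
        (\<Sum>y\<in>?Y. of_bool (\<forall>j\<in>B. \<forall>i\<in>A. {x i, y j} \<in> E) :: real)"
      by (simp add: ob B)
  qed
  also have "\<dots> = (\<Sum>(x, y)\<in>?X \<times> ?Y. of_bool (\<forall>j\<in>B. \<forall>i\<in>A. {x i, y j} \<in> E))"
    by (simp add: sum.cartesian_product)
  also have "\<dots> = (\<Sum>z\<in>{(x, y). x \<in> ?X \<and> y \<in> ?Y \<and> (\<forall>j\<in>B. \<forall>i\<in>A. {x i, y j} \<in> E)}. 1)"
    using A B by (intro sum.mono_neutral_cong_right) (auto intro!: finite_PiE)
  also have "\<dots> = (\<Sum>\<phi>\<in>biclique_maps A B n E. 1)"
    by (rule sum.reindex_bij_witness[of _ "\<lambda>\<phi>. (restrict \<phi> A, restrict \<phi> B)"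
          "\<lambda>(x, y). (\<lambda>k. if k \<in> A then x k else y k)"])
       (use AB in \<open>auto simp: biclique_maps_def PiE_def extensional_def Pi_def fun_eq_iff restrict_def\<close>)
  finally show ?thesis by simp
qed

text \<open>The power mean inequality is applied once to the degrees and once to the common degrees.\<close>

lemma card_biclique_maps_ge:
  assumes A: "finite A" "A \<noteq> {}" and B: "finite B" "B \<noteq> {}" and AB: "A \<inter> B = {}"
    and E: "E \<subseteq> all_edges n" and n: "n \<ge> 1"
    and \<delta>: "0 \<le> \<delta>" "\<delta> * real n ^ 2 \<le> 2 * card E"
  shows "\<delta> ^ (card A * card B) * real n ^ (card A + card B) \<le> card (biclique_maps A B n E)"
proof -
  obtain s where s: "card A = Suc s" using A by (metis card_0_eq not0_implies_Suc)
  obtain t where t: "card B = Suc t" using B by (metis card_0_eq not0_implies_Suc)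
  let ?X = "A \<rightarrow>\<^sub>E {..<n}"
  define N where "N x = (\<Sum>v<n. \<Prod>i\<in>A. of_bool ({x i, v} \<in> E) :: real)" for x
  have N: "N x \<ge> 0" for x unfolding N_def by (intro sum_nonneg prod_nonneg) auto
  have cX: "card ?X = n ^ Suc s" using A s by (simp add: card_PiE)
  \<comment> \<open>Double counting of stars: summing over their centres \<open>v\<close> instead
    turns common degrees into powers of degrees.\<close>
  have "(\<Sum>x\<in>?X. N x) = (\<Sum>v<n. \<Sum>x\<in>?X. \<Prod>i\<in>A. of_bool ({x i, v} \<in> E))"
    unfolding N_def by (rule sum.swap)
  also have "\<dots> = (\<Sum>v<n. (\<Sum>u<n. of_bool ({u, v} \<in> E)) ^ Suc s)"
  proof (rule sum.cong[OF refl])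
    fix v
    have "(\<Sum>x\<in>?X. \<Prod>i\<in>A. of_bool ({x i, v} \<in> E)) = (\<Prod>i\<in>A. \<Sum>u<n. of_bool ({u, v} \<in> E) :: real)"
      by (intro prod_sum_PiE[symmetric] A) auto
    thus "(\<Sum>x\<in>?X. \<Prod>i\<in>A. of_bool ({x i, v} \<in> E)) = (\<Sum>u<n. of_bool ({u, v} \<in> E) :: real) ^ Suc s"
      using s by simp
  qed
  finally have sumN: "(\<Sum>x\<in>?X. N x) = (\<Sum>v<n. (\<Sum>u<n. of_bool ({u, v} \<in> E)) ^ Suc s)" .
  have "(\<delta> * real n ^ 2) ^ Suc s \<le> (2 * real (card E)) ^ Suc s"
    using \<delta> by (intro power_mono) auto
  also have "\<dots> = (\<Sum>v<n. \<Sum>u<n. of_bool ({u, v} \<in> E) :: real) ^ Suc s"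
    by (simp only: sum_adjacency[OF E])
  also have "\<dots> \<le> real (card {..<n}) ^ s * (\<Sum>x\<in>?X. N x)"
    unfolding sumN
    by (rule power_sum_le[of "{..<n}" "\<lambda>v. \<Sum>u<n. of_bool ({u, v} \<in> E)" s]) (auto intro: sum_nonneg)
  finally have 1: "(\<delta> * real n ^ 2) ^ Suc s \<le> real n ^ s * (\<Sum>x\<in>?X. N x)" by simp
  have "(\<Sum>x\<in>?X. N x) ^ Suc t \<le> real (card ?X) ^ t * (\<Sum>x\<in>?X. N x ^ Suc t)"
    using A N by (intro power_sum_le finite_PiE) auto
  also have "(\<Sum>x\<in>?X. N x ^ Suc t) = card (biclique_maps A B n E)"
    unfolding card_biclique_maps_eq[OF A(1) B(1) AB] N_def t ..
  finally have 2: "(\<Sum>x\<in>?X. N x) ^ Suc t \<le> (real n ^ Suc s) ^ t * card (biclique_maps A B n E)"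
    unfolding cX by simp
  have "((\<delta> * real n ^ 2) ^ Suc s) ^ Suc t \<le> (real n ^ s * (\<Sum>x\<in>?X. N x)) ^ Suc t"
    using 1 \<delta> by (intro power_mono) auto
  also have "\<dots> = (real n ^ s) ^ Suc t * (\<Sum>x\<in>?X. N x) ^ Suc t" by (simp add: power_mult_distrib)
  also have "\<dots> \<le> (real n ^ s) ^ Suc t * ((real n ^ Suc s) ^ t * card (biclique_maps A B n E))"
    using 2 by (intro mult_left_mono) auto
  finally have 3: "((\<delta> * real n ^ 2) ^ Suc s) ^ Suc t \<le>
    ((real n ^ s) ^ Suc t * (real n ^ Suc s) ^ t) * card (biclique_maps A B n E)" by simp
  have "((\<delta> * real n ^ 2) ^ Suc s) ^ Suc t =
      \<delta> ^ (Suc s * Suc t) * real n ^ (2 * (Suc s * Suc t))"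
    by (simp only: power_mult_distrib mult.assoc flip: power_mult)
  \<comment> \<open>The first summand is the power of n lost in the two power mean steps; cancelling
    it leaves exactly |A| + |B|.\<close>
  also have "2 * (Suc s * Suc t) = (s * Suc t + Suc s * t) + (Suc s + Suc t)" by (simp add: algebra_simps)
  also have "real n ^ \<dots> = ((real n ^ s) ^ Suc t * (real n ^ Suc s) ^ t) * real n ^ (Suc s + Suc t)"
    by (simp only: power_add power_mult)
  finally have "((real n ^ s) ^ Suc t * (real n ^ Suc s) ^ t) * (\<delta> ^ (Suc s * Suc t) * real n ^ (Suc s + Suc t))
     = ((\<delta> * real n ^ 2) ^ Suc s) ^ Suc t"
    by (simp only: mult.left_commute[of "(real n ^ s) ^ Suc t * (real n ^ Suc s) ^ t"])
  hence "((real n ^ s) ^ Suc t * (real n ^ Suc s) ^ t) * (\<delta> ^ (Suc s * Suc t) * real n ^ (Suc s + Suc t))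
     \<le> ((real n ^ s) ^ Suc t * (real n ^ Suc s) ^ t) * card (biclique_maps A B n E)"
    using 3 by (simp only:)
  thus ?thesis unfolding s t
    using n by (subst (asm) mult_le_cancel_left_pos) auto
qed

text \<open>If i and j collide, the value at i is determined by the remaining ones, so each ordered
  pair accounts for at most n^(|I| - 1) maps.\<close>

lemma card_non_injective_maps:
  assumes I: "finite I"
  shows "card ((I \<rightarrow>\<^sub>E {..<n}) - embeddings I n) \<le> card I ^ 2 * n ^ (card I - 1)"
proof -
  define C where "C z = (case z of (i, j) \<Rightarrow> {\<phi> \<in> I \<rightarrow>\<^sub>E {..<n}. \<phi> i = \<phi> j})" for z
  define Q where "Q = {(i, j). i \<in> I \<and> j \<in> I \<and> i \<noteq> j}"
  have finQ: "finite Q" by (rule finite_subset[of _ "I \<times> I"]) (use I in \<open>auto simp: Q_def\<close>)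
  have cQ: "card Q \<le> card I ^ 2"
    using card_mono[of "I \<times> I" Q] I by (auto simp: Q_def card_cartesian_product power2_eq_square)
  have "(I \<rightarrow>\<^sub>E {..<n}) - embeddings I n \<subseteq> (\<Union>z\<in>Q. C z)"
    by (auto simp: embeddings_def inj_on_def C_def Q_def)
  moreover have "finite (\<Union>z\<in>Q. C z)"
    using finQ finite_PiE[OF I, of "\<lambda>_. {..<n}"] by (auto simp: C_def)
  ultimately have "card ((I \<rightarrow>\<^sub>E {..<n}) - embeddings I n) \<le> card (\<Union>z\<in>Q. C z)"
    by (intro card_mono)
  also have "\<dots> \<le> (\<Sum>z\<in>Q. card (C z))" by (rule card_UN_le[OF finQ])
  also have "\<dots> \<le> (\<Sum>z\<in>Q. n ^ (card I - 1))"
  proof (rule sum_mono)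
    fix z assume "z \<in> Q"
    then obtain i j where z: "z = (i, j)" "i \<in> I" "j \<in> I" "i \<noteq> j" by (auto simp: Q_def)
    have "card (C z) \<le> card ((I - {i}) \<rightarrow>\<^sub>E {..<n})"
    proof (rule card_inj_on_le[where f = "\<lambda>\<phi>. restrict \<phi> (I - {i})"])
      show "inj_on (\<lambda>\<phi>. restrict \<phi> (I - {i})) (C z)"
      proof (rule inj_onI)
        fix \<phi> \<psi> assume as: "\<phi> \<in> C z" "\<psi> \<in> C z" "restrict \<phi> (I - {i}) = restrict \<psi> (I - {i})"
        have eq: "\<phi> x = \<psi> x" if "x \<in> I - {i}" for x
          using fun_cong[OF as(3), of x] that by simp
        have "\<phi> x = \<psi> x" if "x \<in> I" for x
          using eq[of x] eq[of j] as(1,2) that z by (cases "x = i") (auto simp: C_def)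
        thus "\<phi> = \<psi>" using as(1,2) z by (intro PiE_ext[where k = I and s = "\<lambda>_. {..<n}"]) (auto simp: C_def)
      qed
      show "(\<lambda>\<phi>. restrict \<phi> (I - {i})) ` C z \<subseteq> (I - {i}) \<rightarrow>\<^sub>E {..<n}"
        by (auto simp: C_def z PiE_def Pi_def)
    qed (use I in \<open>auto intro: finite_PiE\<close>)
    also have "\<dots> = n ^ (card I - 1)" using I z by (simp add: card_PiE)
    finally show "card (C z) \<le> n ^ (card I - 1)" .
  qed
  also have "\<dots> \<le> card I ^ 2 * n ^ (card I - 1)" using cQ by simp
  finally show ?thesis .
qed

text \<open>The assumption \<open>big\<close> makes the non-injective maps at most half of the main
  term.\<close>

lemma card_biclique_embeddings_ge:
  assumes A: "finite A" "A \<noteq> {}" and B: "finite B" "B \<noteq> {}" and AB: "A \<inter> B = {}"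
    and E: "E \<subseteq> all_edges n" and n: "n \<ge> 1"
    and \<delta>: "0 \<le> \<delta>" "\<delta> * real n ^ 2 \<le> 2 * card E"
    and big: "2 * real (card (A \<union> B)) ^ 2 \<le> \<delta> ^ (card A * card B) * n"
  shows "\<delta> ^ (card A * card B) / 2 * real n ^ card (A \<union> B) \<le>
    card (biclique_maps A B n E \<inter> embeddings (A \<union> B) n)"
proof -
  let ?I = "A \<union> B"
  define c where "c = \<delta> ^ (card A * card B)"
  have I: "finite ?I" using A B by simp
  have cI: "card ?I = card A + card B" using A B AB by (simp add: card_Un_disjoint)
  have k: "card ?I \<ge> 1" using A I by (simp add: Suc_le_eq card_gt_0_iff)
  have "card (biclique_maps A B n E) \<le> card ((biclique_maps A B n E \<inter> embeddings ?I n) \<union>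
      ((?I \<rightarrow>\<^sub>E {..<n}) - embeddings ?I n))"
    using I finite_embeddings[OF I] by (intro card_mono) (auto simp: biclique_maps_def intro!: finite_PiE)
  also have "\<dots> \<le> card (biclique_maps A B n E \<inter> embeddings ?I n) + card ((?I \<rightarrow>\<^sub>E {..<n}) - embeddings ?I n)"
    by (rule card_Un_le)
  also have "\<dots> \<le> card (biclique_maps A B n E \<inter> embeddings ?I n) + card ?I ^ 2 * n ^ (card ?I - 1)"
    using card_non_injective_maps[OF I] by simp
  finally have "real (card (biclique_maps A B n E)) \<le>
      real (card (biclique_maps A B n E \<inter> embeddings ?I n)) + real (card ?I) ^ 2 * real n ^ (card ?I - 1)"
    by (metis (no_types, lifting) of_nat_add of_nat_le_iff of_nat_mult of_nat_power)
  moreover have "c * real n ^ card ?I \<le> card (biclique_maps A B n E)"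
    using card_biclique_maps_ge[OF A B AB E n \<delta>] by (simp add: c_def cI)
  moreover have "real (card ?I) ^ 2 * real n ^ (card ?I - 1) \<le> c / 2 * real n * real n ^ (card ?I - 1)"
    using big by (intro mult_right_mono) (auto simp: c_def)
  moreover have "c / 2 * real n * real n ^ (card ?I - 1) = c / 2 * real n ^ card ?I"
    using k by (simp add: power_eq_if)
  ultimately show ?thesis unfolding c_def[symmetric] by linarith
qed

section \<open>The 1-statement for a pattern\<close>

text \<open>The only combinatorial input is \<open>arrow\<close>: a copy of the pattern in the
  random graph, placed over a biclique of the dense graph, forces the rainbow clique. A positive
  proportion of all maps are such placements, so the failure probability is O(1/w).\<close>

lemma one_statement:
  fixes a d :: real and p :: "nat \<Rightarrow> real" and G :: "nat \<Rightarrow> nat set set"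
  assumes A: "finite A" "A \<noteq> {}" and B: "finite B" "B \<noteq> {}" and AB: "A \<inter> B = {}"
    and H: "H \<subseteq> {e. e \<subseteq> A \<union> B \<and> card e = 2}" and dens: "dense_bounded a (A \<union> B) H"
    and d: "d > 0" and p: "\<And>n. 0 \<le> p n \<and> p n \<le> 1"
    and lim: "filterlim (\<lambda>n. p n / real n powr (-a)) at_top sequentially"
    and G: "\<And>n. G n \<in> dense_family d n"
    and arrow: "\<And>n E F \<phi>. \<phi> \<in> embeddings (A \<union> B) n \<Longrightarrow> \<phi> \<in> biclique_maps A B n E \<Longrightarrow>
      (`) \<phi> ` H \<subseteq> F \<Longrightarrow> rbw_arrow (E \<union> F) l"
  shows "(\<lambda>n. rbw_prob n (G n) (p n) l) \<longlonglongrightarrow> 1"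
proof (rule tendsto_sandwich[OF _ _ _ tendsto_const])
  let ?k = "card (A \<union> B)"
  define w where "w n = p n / real n powr (-a)" for n
  \<comment> \<open>The ordered edge density drops from d to d/2 because n(n-1) >= n^2/2 is used for
    n >= 2.\<close>
  define c where "c = (d / 2) ^ (card A * card B)"
  have c: "c > 0" using d by (simp add: c_def)
  have I: "finite (A \<union> B)" using A B by simp
  show "\<forall>\<^sub>F n in sequentially. rbw_prob n (G n) (p n) l \<le> 1"
    using p by (intro always_eventually) (simp add: rbw_prob_eq gnp_prob_le_1)
  show "(\<lambda>n. 1 / (1 + (real ?k + 1) ^ ?k * (2 / c) / w n)) \<longlonglongrightarrow> 1"
  proof -
    have "(\<lambda>n. (real ?k + 1) ^ ?k * (2 / c) / w n) \<longlonglongrightarrow> 0"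
      by (intro real_tendsto_divide_at_top[OF tendsto_const]) (use lim in \<open>simp add: w_def\<close>)
    hence "(\<lambda>n. 1 / (1 + (real ?k + 1) ^ ?k * (2 / c) / w n)) \<longlonglongrightarrow> 1 / (1 + 0)"
      by (intro tendsto_intros) auto
    thus ?thesis by simp
  qed
  have "\<forall>\<^sub>F n in sequentially. w n \<ge> 1"
    using lim unfolding filterlim_at_top w_def by blast
  moreover have "\<forall>\<^sub>F n in sequentially. real n \<ge> 2 * real ?k ^ 2 / c"
    using filterlim_real_sequentially unfolding filterlim_at_top by blast
  ultimately show "\<forall>\<^sub>F n in sequentially. 1 / (1 + (real ?k + 1) ^ ?k * (2 / c) / w n) \<le> rbw_prob n (G n) (p n) l"
    using eventually_ge_at_top[of 2]
  proof eventually_elim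
    case (elim n)
    let ?\<Phi> = "biclique_maps A B n (G n) \<inter> embeddings (A \<union> B) n"
    define m where "m = real (card ?\<Phi>)"
    have GE: "G n \<subseteq> all_edges n" and Gd: "real (card (G n)) \<ge> d * real (n choose 2)"
      using G[of n] by (auto simp: dense_family_def)
    have ch: "real (n choose 2) = real n * (real n - 1) / 2"
      using elim by (simp add: choose_two real_of_nat_div of_nat_diff)
    have "d * real n * (real n / 2) \<le> d * real n * (real n - 1)"
      using elim d by (intro mult_left_mono) auto
    hence "d / 2 * real n ^ 2 \<le> 2 * (d * real (n choose 2))"
      unfolding ch by (simp add: power2_eq_square)
    hence "d / 2 * real n ^ 2 \<le> 2 * card (G n)" using Gd by simp
    hence m: "c / 2 * real n ^ ?k \<le> m"
      unfolding m_def c_def using elim d c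
      by (intro card_biclique_embeddings_ge A B AB GE) (auto simp: c_def field_simps)
    have "0 < c / 2 * real n ^ ?k" using c elim by simp
    hence m0: "m > 0" using m by linarith
    hence ne: "?\<Phi> \<noteq> {}" by (auto simp: m_def)
    have "(real (?k + 1) * n) ^ ?k / (w n * m) \<le> (real (?k + 1) * n) ^ ?k / (w n * (c / 2 * real n ^ ?k))"
      using m m0 elim c by (intro divide_left_mono mult_left_mono mult_pos_pos) auto
    also have "\<dots> = (real ?k + 1) ^ ?k * (2 / c) / w n"
      unfolding power_mult_distrib using elim c by (simp add: add.commute)
    finally have "1 / (1 + (real ?k + 1) ^ ?k * (2 / c) / w n) \<le>
        1 / (1 + (real (?k + 1) * n) ^ ?k / (w n * m))"
      using elim m0 c by (intro divide_left_mono mult_pos_pos add_pos_nonneg) auto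
    also have "\<dots> \<le> gnp_prob n (p n) (\<lambda>F. \<exists>\<phi>\<in>?\<Phi>. (`) \<phi> ` H \<subseteq> F)"
      unfolding m_def
      by (rule prob_contains_embedding[OF I H dens _ ne])
         (use elim p[of n] in \<open>auto simp: w_def\<close>)
    also have "\<dots> \<le> rbw_prob n (G n) (p n) l"
      unfolding rbw_prob_eq
    proof (rule gnp_expectation_mono)
      fix F
      show "of_bool (\<exists>\<phi>\<in>?\<Phi>. (`) \<phi> ` H \<subseteq> F) \<le> (of_bool (rbw_arrow (G n \<union> F) l) :: real)"
        using arrow by (cases "\<exists>\<phi>\<in>?\<Phi>. (`) \<phi> ` H \<subseteq> F") auto
    qed (use p in auto)
    finally show ?case .
  qed
qed

section \<open>Finding rainbow cliques greedily\<close>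

definition rainbow_clique :: "nat set set \<Rightarrow> (nat set \<Rightarrow> nat) \<Rightarrow> nat set \<Rightarrow> bool" where
  "rainbow_clique E c Z \<longleftrightarrow> finite Z \<and> clique_edges Z \<subseteq> E \<and> inj_on c (clique_edges Z)"

lemma clique_edges_insert:
  "y \<notin> Z \<Longrightarrow> clique_edges (insert y Z) = clique_edges Z \<union> (\<lambda>z. {z, y}) ` Z"
  by (auto simp: clique_edges_def insert_commute)

text \<open>One more than the number of candidates that a rainbow K_j can spoil. The values for j =
  0, ..., 4 are 1, 1, 1, 4, 13: spoiling needs an edge opposite to a vertex, hence j >= 3.\<close>

definition branching :: "nat \<Rightarrow> nat" where
  "branching j = j * ((j - 1) choose 2) + 1"

text \<open>For \<open>z \<in> Z\<close> and an edge \<open>e\<close> of the clique avoiding \<open>z\<close>, at most one candidate \<open>y\<close> satisfies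
  \<open>c {z, y} = c e\<close>; edges through \<open>z\<close> never clash with \<open>{z, y}\<close>.\<close>

lemma rainbow_clique_extend:
  assumes c: "proper_colouring E c" and Z: "rainbow_clique E c Z"
    and Y: "finite Y" "card Y \<ge> branching (card Z)"
    and adj: "\<And>y z. y \<in> Y \<Longrightarrow> z \<in> Z \<Longrightarrow> {z, y} \<in> E" and disj: "Y \<inter> Z = {}"
  shows "\<exists>y\<in>Y. rainbow_clique E c (insert y Z)"
proof -
  have finZ: "finite Z" using Z by (simp add: rainbow_clique_def)
  have proper: "c e \<noteq> c f" if "e \<in> E" "f \<in> E" "e \<noteq> f" "e \<inter> f \<noteq> {}" for e f
    using c that by (auto simp: proper_colouring_def)
  define Bad where "Bad = (\<Union>z\<in>Z. \<Union>e\<in>clique_edges (Z - {z}). {y\<in>Y. c {z, y} = c e})"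
  have finC: "finite (clique_edges (Z - {z}))" for z using finZ by (simp add: finite_clique_edges)
  have "card Bad \<le> (\<Sum>z\<in>Z. card (\<Union>e\<in>clique_edges (Z - {z}). {y\<in>Y. c {z, y} = c e}))"
    unfolding Bad_def by (rule card_UN_le[OF finZ])
  also have "\<dots> \<le> (\<Sum>z\<in>Z. (card Z - 1) choose 2)"
  proof (rule sum_mono)
    fix z assume z: "z \<in> Z"
    have "card (\<Union>e\<in>clique_edges (Z - {z}). {y\<in>Y. c {z, y} = c e}) \<le>
        (\<Sum>e\<in>clique_edges (Z - {z}). card {y\<in>Y. c {z, y} = c e})"
      by (rule card_UN_le[OF finC])
    also have "\<dots> \<le> (\<Sum>e\<in>clique_edges (Z - {z}). 1)"
    proof (rule sum_mono)
      fix e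
      have "y = y'" if "y \<in> Y" "y' \<in> Y" "c {z, y} = c e" "c {z, y'} = c e" for y y'
        using proper[of "{z, y}" "{z, y'}"] adj[OF that(1) z] adj[OF that(2) z] that(3,4)
        by (auto simp: doubleton_eq_iff)
      thus "card {y\<in>Y. c {z, y} = c e} \<le> 1"
        using Y by (subst card_le_Suc0_iff_eq[folded One_nat_def]) auto
    qed
    also have "\<dots> = (card Z - 1) choose 2"
      using finZ z by (simp add: card_clique_edges)
    finally show "card (\<Union>e\<in>clique_edges (Z - {z}). {y\<in>Y. c {z, y} = c e}) \<le> (card Z - 1) choose 2" .
  qed
  also have "\<dots> < card Y" using Y by (simp add: branching_def)
  finally have "card Bad < card Y" .
  moreover have "finite Bad" using finZ finC Y by (auto simp: Bad_def)
  ultimately have "\<not> Y \<subseteq> Bad" using card_mono leD by blast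
  then obtain y where y: "y \<in> Y" "y \<notin> Bad" by auto
  have yZ: "y \<notin> Z" using y disj by auto
  have new: "c {z, y} \<noteq> c e" if z: "z \<in> Z" and e: "e \<in> clique_edges Z" for z e
  proof (cases "z \<in> e")
    case True
    moreover have "e \<in> E" using e Z by (auto simp: rainbow_clique_def)
    moreover have "e \<noteq> {z, y}" using e yZ by (auto simp: clique_edges_eq)
    ultimately show ?thesis using proper[of "{z, y}" e] adj[OF y(1) z] by auto
  next
    case False
    hence "e \<in> clique_edges (Z - {z})" using e by (auto simp: clique_edges_eq)
    thus ?thesis using y z by (auto simp: Bad_def)
  qed
  have "inj_on c (clique_edges Z \<union> (\<lambda>z. {z, y}) ` Z)"
  proof (rule inj_onI)
    fix e f assume ef: "e \<in> clique_edges Z \<union> (\<lambda>z. {z, y}) ` Z" "f \<in> clique_edges Z \<union> (\<lambda>z. {z, y}) ` Z" "c e = c f"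
    consider "e \<in> clique_edges Z" "f \<in> clique_edges Z" | "e \<in> clique_edges Z" "f \<in> (\<lambda>z. {z, y}) ` Z" |
      "f \<in> clique_edges Z" "e \<in> (\<lambda>z. {z, y}) ` Z" | "e \<in> (\<lambda>z. {z, y}) ` Z" "f \<in> (\<lambda>z. {z, y}) ` Z"
      using ef by auto
    thus "e = f"
    proof cases
      case 1
      thus ?thesis using Z ef by (auto simp: rainbow_clique_def inj_on_def)
    next
      case 2
      thus ?thesis using new ef by fastforce
    next
      case 3
      thus ?thesis using new ef by fastforce
    next
      case 4
      then obtain z z' where zz: "e = {z, y}" "f = {z', y}" "z \<in> Z" "z' \<in> Z" by auto
      thus ?thesis using proper[of e f] adj[OF y(1) zz(3)] adj[OF y(1) zz(4)] ef(3) by auto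
    qed
  qed
  hence "rainbow_clique E c (insert y Z)"
    using Z adj[OF y(1)] yZ by (auto simp: rainbow_clique_def clique_edges_insert)
  thus ?thesis using y by blast
qed

section \<open>Tree patterns that force rainbow cliques\<close>

text \<open>Here \<open>a\<close> counts the clique vertices already chosen on the other side, so
  \<open>a + length xs\<close> is the size of the clique that the choice \<open>x\<close>
  extends.\<close>

fun tree_path :: "nat \<Rightarrow> nat list \<Rightarrow> bool" where
  "tree_path a [] \<longleftrightarrow> True"
| "tree_path a (x # xs) \<longleftrightarrow> x < branching (a + length xs) \<and> tree_path a xs"

text \<open>The vertices are the nonempty root paths of a tree, newest choice first, so that the
  ancestors of a vertex are its nonempty suffixes; the edges join each vertex to all its
  ancestors. The tag keeps the two sides of the bipartition apart.\<close>

definition tree_vertices :: "bool \<Rightarrow> nat \<Rightarrow> nat \<Rightarrow> (bool \<times> nat list) set" where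
  "tree_vertices b a m = {(b, xs) | xs. xs \<noteq> [] \<and> length xs \<le> m \<and> tree_path a xs}"

definition tree_edges :: "bool \<Rightarrow> nat \<Rightarrow> nat \<Rightarrow> (bool \<times> nat list) set set" where
  "tree_edges b a m = {{(b, xs), (b, ys)} | xs ys.
     xs \<noteq> [] \<and> strict_suffix xs ys \<and> length ys \<le> m \<and> tree_path a ys}"

lemma branching_pos: "branching j > 0"
  by (simp add: branching_def)

lemma tree_path_suffix: "suffix xs ys \<Longrightarrow> tree_path a ys \<Longrightarrow> tree_path a xs"
  by (induction ys) (auto simp: suffix_Cons)

lemma finite_tree_vertices: "finite (tree_vertices b a m)"
proof -
  have "finite {xs. length xs = k \<and> tree_path a xs}" for k
  proof (induction k)
    case (Suc k)
    have "{xs. length xs = Suc k \<and> tree_path a xs} \<subseteq>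
        (\<lambda>(x, xs). x # xs) ` ({..<branching (a + k)} \<times> {xs. length xs = k \<and> tree_path a xs})"
      by (auto simp: length_Suc_conv image_iff)
    thus ?case by (rule finite_subset) (use Suc in auto)
  qed auto
  hence "finite (\<Union>k\<le>m. Pair b ` {xs. length xs = k \<and> tree_path a xs})" by auto
  thus ?thesis by (rule finite_subset[rotated]) (auto simp: tree_vertices_def)
qed

lemma tree_vertices_nonempty: "m \<ge> 1 \<Longrightarrow> tree_vertices b a m \<noteq> {}"
proof -
  assume "m \<ge> 1"
  hence "(b, [0]) \<in> tree_vertices b a m" by (auto simp: tree_vertices_def branching_pos)
  thus ?thesis by blast
qed

lemma tree_edges_subset: "tree_edges b a m \<subseteq> {e. e \<subseteq> tree_vertices b a m \<and> card e = 2}"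
proof
  fix e assume "e \<in> tree_edges b a m"
  then obtain xs ys where e: "e = {(b, xs), (b, ys)}" "xs \<noteq> []" "strict_suffix xs ys" "length ys \<le> m" "tree_path a ys"
    unfolding tree_edges_def by auto
  have "suffix xs ys" "xs \<noteq> ys" using e(3) by (auto simp: strict_suffix_def)
  moreover from this have "length xs \<le> length ys" by (simp add: suffix_length_le)
  ultimately show "e \<in> {e. e \<subseteq> tree_vertices b a m \<and> card e = 2}"
    using e tree_path_suffix by (auto simp: tree_vertices_def)
qed

text \<open>The root path of \<open>xs\<close>, including \<open>xs\<close> itself. It is a clique
  of the pattern, and a run of the greedy extension always holds such a path on each side.\<close>

definition branch :: "nat list \<Rightarrow> nat list set" where
  "branch xs = {u. u \<noteq> [] \<and> suffix u xs}"

lemma branch_simps: "branch [] = {}" "branch (x # xs) = insert (x # xs) (branch xs)"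
  by (auto simp: branch_def suffix_Cons)

lemma finite_branch: "finite (branch xs)"
  by (induction xs) (auto simp: branch_simps)

lemma card_branch: "card (branch xs) = length xs"
proof (induction xs)
  case (Cons x xs)
  have "x # xs \<notin> branch xs" by (auto simp: branch_def suffix_def)
  thus ?case using Cons by (simp add: branch_simps finite_branch)
qed (simp add: branch_simps)

lemma branch_subset_tree:
  "length xs \<le> m \<Longrightarrow> tree_path a xs \<Longrightarrow> Pair b ` branch xs \<subseteq> tree_vertices b a m"
  using tree_path_suffix suffix_length_le by (fastforce simp: branch_def tree_vertices_def)

lemma tree_edge_branch:
  assumes "u \<in> branch xs" "length (x # xs) \<le> m" "tree_path a (x # xs)"
  shows "{(b, u), (b, x # xs)} \<in> tree_edges b a m"
proof -
  have "suffix u (x # xs)" "u \<noteq> x # xs" "u \<noteq> []"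
    using assms(1) by (auto simp: branch_def suffix_Cons) (auto simp: suffix_def)
  thus ?thesis using assms(2,3) unfolding tree_edges_def strict_suffix_def by blast
qed

text \<open>Walk down both trees. The current rainbow clique is a root path, and the children of its
  end are as many as \<open>branching\<close> demands and adjacent to the whole path; on the second
  side the biclique supplies the adjacency to the first path. Hence some child always extends the
  clique.\<close>

lemma tree_pattern_arrow:
  fixes s t n :: nat
  defines "A \<equiv> tree_vertices False 0 s" and "B \<equiv> tree_vertices True s t"
  assumes \<phi>: "\<phi> \<in> embeddings (A \<union> B) n" "\<phi> \<in> biclique_maps A B n E"
    and F: "(`) \<phi> ` (tree_edges False 0 s \<union> tree_edges True s t) \<subseteq> F"
  shows "rbw_arrow (E \<union> F) (s + t)"
  unfolding rbw_arrow_def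
proof (intro allI impI)
  fix c assume c: "proper_colouring (E \<union> F) c"
  have inj: "inj_on \<phi> (A \<union> B)" using \<phi> by (simp add: embeddings_def)
  have cross: "{\<phi> i, \<phi> j} \<in> E" if "i \<in> A" "j \<in> B" for i j
    using \<phi>(2) that by (auto simp: biclique_maps_def)
  have edge: "{\<phi> i, \<phi> j} \<in> F" if "{i, j} \<in> tree_edges False 0 s \<union> tree_edges True s t" for i j
  proof -
    have "\<phi> ` {i, j} \<in> F" using F that by blast
    thus ?thesis by simp
  qed
  define P where "P xs ys = Pair False ` branch xs \<union> Pair True ` branch ys" for xs ys
  have finP: "finite (P xs ys)" for xs ys by (simp add: P_def finite_branch)
  have cP: "card (P xs ys) = length xs + length ys" for xs ys
    unfolding P_def by (subst card_Un_disjoint) (auto simp: finite_branch card_image inj_on_def card_branch)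
  \<comment> \<open>Both walks use this step; \<open>b\<close> and \<open>zs\<close> say on which
    side and below which vertex the children lie.\<close>
  have step: "\<exists>x<branching (length xs + length ys). rainbow_clique (E \<union> F) c (\<phi> ` insert (b, x # zs) (P xs ys))"
    if "rainbow_clique (E \<union> F) c (\<phi> ` P xs ys)" and sub: "P xs ys \<subseteq> A \<union> B"
      and new: "\<And>x. x < branching (length xs + length ys) \<Longrightarrow> (b, x # zs) \<in> (A \<union> B) - P xs ys"
      and adj: "\<And>x i. x < branching (length xs + length ys) \<Longrightarrow> i \<in> P xs ys \<Longrightarrow> {\<phi> i, \<phi> (b, x # zs)} \<in> E \<union> F"
    for xs ys b zs
  proof -
    let ?D = "{..<branching (length xs + length ys)}"
    let ?N = "(\<lambda>x. (b, x # zs)) ` ?D"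
    let ?Y = "\<phi> ` ?N"
    have injY: "inj_on \<phi> ?N" using new by (intro inj_on_subset[OF inj]) auto
    have cN: "card ?N = branching (length xs + length ys)" by (subst card_image) (auto simp: inj_on_def)
    have cZ: "card (\<phi> ` P xs ys) = length xs + length ys"
      using cP card_image[OF inj_on_subset[OF inj sub]] by simp
    have "?Y \<inter> \<phi> ` P xs ys = \<phi> ` (?N \<inter> P xs ys)"
      using new sub by (intro inj_on_image_Int[OF inj, symmetric]) auto
    also have "?N \<inter> P xs ys = {}" using new by auto
    finally have "?Y \<inter> \<phi> ` P xs ys = {}" by simp
    moreover have "{z, y} \<in> E \<union> F" if "y \<in> ?Y" "z \<in> \<phi> ` P xs ys" for y z
      using adj that by blast
    ultimately have "\<exists>y\<in>?Y. rainbow_clique (E \<union> F) c (insert y (\<phi> ` P xs ys))"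
      by (intro rainbow_clique_extend[OF c that(1)]) (simp_all add: cZ cN card_image[OF injY])
    thus ?thesis by auto
  qed
  have "\<exists>xs. length xs = k \<and> tree_path 0 xs \<and> rainbow_clique (E \<union> F) c (\<phi> ` P xs [])" if "k \<le> s" for k
    using that
  proof (induction k)
    case 0
    show ?case by (auto simp: P_def branch_simps rainbow_clique_def clique_edges_def)
  next
    case (Suc k)
    then obtain xs where xs: "length xs = k" "tree_path 0 xs" "rainbow_clique (E \<union> F) c (\<phi> ` P xs [])" by auto
    have "\<exists>x<branching (length xs + length ([] :: nat list)). rainbow_clique (E \<union> F) c (\<phi> ` insert (False, x # xs) (P xs []))"
    proof (rule step[OF xs(3)])
      show "P xs [] \<subseteq> A \<union> B"
        using xs Suc.prems branch_subset_tree[of xs s 0 False] by (auto simp: P_def A_def branch_simps)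
    next
      fix x assume x: "x < branching (length xs + length ([] :: nat list))"
      have "x # xs \<notin> branch xs" by (auto simp: branch_def suffix_def)
      thus "(False, x # xs) \<in> A \<union> B - P xs []"
        using x xs Suc.prems by (auto simp: A_def tree_vertices_def P_def branch_simps)
      fix i assume "i \<in> P xs []"
      then obtain u where "u \<in> branch xs" "i = (False, u)" by (auto simp: P_def branch_simps)
      thus "{\<phi> i, \<phi> (False, x # xs)} \<in> E \<union> F"
        using edge[of i "(False, x # xs)"] tree_edge_branch[of u xs x s 0 False] x xs Suc.prems by auto
    qed
    then obtain x where "x < branching k" "rainbow_clique (E \<union> F) c (\<phi> ` insert (False, x # xs) (P xs []))"
      using xs by auto
    moreover have "insert (False, x # xs) (P xs []) = P (x # xs) []" by (simp add: P_def branch_simps)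
    ultimately show ?case using xs by (intro exI[of _ "x # xs"]) auto
  qed
  then obtain xs where xs: "length xs = s" "tree_path 0 xs" "rainbow_clique (E \<union> F) c (\<phi> ` P xs [])" by blast
  have xsA: "Pair False ` branch xs \<subseteq> A" using branch_subset_tree[of xs s 0 False] xs by (simp add: A_def)
  have "\<exists>ys. length ys = k \<and> tree_path s ys \<and> rainbow_clique (E \<union> F) c (\<phi> ` P xs ys)" if "k \<le> t" for k
    using that
  proof (induction k)
    case 0
    show ?case using xs by (intro exI[of _ "[]"]) auto
  next
    case (Suc k)
    then obtain ys where ys: "length ys = k" "tree_path s ys" "rainbow_clique (E \<union> F) c (\<phi> ` P xs ys)" by auto
    have ysB: "Pair True ` branch ys \<subseteq> B" using branch_subset_tree[of ys t s True] ys Suc.prems by (simp add: B_def)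
    have "\<exists>x<branching (length xs + length ys). rainbow_clique (E \<union> F) c (\<phi> ` insert (True, x # ys) (P xs ys))"
    proof (rule step[OF ys(3)])
      show "P xs ys \<subseteq> A \<union> B" using xsA ysB by (auto simp: P_def)
    next
      fix x assume x: "x < branching (length xs + length ys)"
      have "x # ys \<notin> branch ys" by (auto simp: branch_def suffix_def)
      moreover have xB: "(True, x # ys) \<in> B"
        using x xs ys Suc.prems by (auto simp: B_def tree_vertices_def)
      ultimately show "(True, x # ys) \<in> A \<union> B - P xs ys" by (auto simp: P_def)
      fix i assume "i \<in> P xs ys"
      then consider u where "u \<in> branch xs" "i = (False, u)" | u where "u \<in> branch ys" "i = (True, u)"
        by (auto simp: P_def)
      thus "{\<phi> i, \<phi> (True, x # ys)} \<in> E \<union> F"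
      proof cases
        case 1
        thus ?thesis using cross[OF _ xB] xsA by auto
      next
        case 2
        thus ?thesis
          using edge[of i "(True, x # ys)"] tree_edge_branch[of u ys x t s True] x xs ys Suc.prems by auto
      qed
    qed
    then obtain x where "x < branching (s + k)" "rainbow_clique (E \<union> F) c (\<phi> ` insert (True, x # ys) (P xs ys))"
      using xs ys by auto
    moreover have "insert (True, x # ys) (P xs ys) = P xs (x # ys)" by (simp add: P_def branch_simps)
    ultimately show ?case using ys by (intro exI[of _ "x # ys"]) auto
  qed
  then obtain ys where ys: "length ys = t" "tree_path s ys" "rainbow_clique (E \<union> F) c (\<phi> ` P xs ys)" by blast
  have "Pair True ` branch ys \<subseteq> B" using branch_subset_tree[of ys t s True] ys by (simp add: B_def)
  hence "card (\<phi> ` P xs ys) = s + t"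
    using cP[of xs ys] xs ys xsA card_image[OF inj_on_subset[OF inj, of "P xs ys"]] by (auto simp: P_def)
  thus "has_rainbow_clique (E \<union> F) c (s + t)"
    using ys(3) unfolding has_rainbow_clique_def rainbow_clique_def by blast
qed

section \<open>Density of the tree patterns\<close>

lemma dense_bounded_Un:
  assumes 1: "dense_bounded a I\<^sub>1 H\<^sub>1" and 2: "dense_bounded a I\<^sub>2 H\<^sub>2" and disj: "I\<^sub>1 \<inter> I\<^sub>2 = {}"
    and H: "H\<^sub>1 \<subseteq> Pow I\<^sub>1" "H\<^sub>2 \<subseteq> Pow I\<^sub>2" and fin: "finite I\<^sub>1" "finite I\<^sub>2" and a: "a \<ge> 0"
  shows "dense_bounded a (I\<^sub>1 \<union> I\<^sub>2) (H\<^sub>1 \<union> H\<^sub>2)"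
  unfolding dense_bounded_def
proof (intro allI impI)
  fix S assume S: "S \<subseteq> I\<^sub>1 \<union> I\<^sub>2"
  have eq: "{e\<in>H\<^sub>1 \<union> H\<^sub>2. e \<subseteq> S} = {e\<in>H\<^sub>1. e \<subseteq> S \<inter> I\<^sub>1} \<union> {e\<in>H\<^sub>2. e \<subseteq> S \<inter> I\<^sub>2}"
    using H by auto
  have "card {e\<in>H\<^sub>1 \<union> H\<^sub>2. e \<subseteq> S} \<le> card {e\<in>H\<^sub>1. e \<subseteq> S \<inter> I\<^sub>1} + card {e\<in>H\<^sub>2. e \<subseteq> S \<inter> I\<^sub>2}"
    unfolding eq by (rule card_Un_le)
  hence "a * card {e\<in>H\<^sub>1 \<union> H\<^sub>2. e \<subseteq> S} \<le>
      a * (real (card {e\<in>H\<^sub>1. e \<subseteq> S \<inter> I\<^sub>1}) + real (card {e\<in>H\<^sub>2. e \<subseteq> S \<inter> I\<^sub>2}))"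
    using a by (intro mult_left_mono) (auto simp flip: of_nat_add)
  also have "\<dots> \<le> real (card (S \<inter> I\<^sub>1)) + real (card (S \<inter> I\<^sub>2))"
    using 1 2 unfolding dense_bounded_def by (auto simp: distrib_left intro!: add_mono)
  also have "\<dots> = card (S \<inter> I\<^sub>1 \<union> S \<inter> I\<^sub>2)"
    using fin disj by (subst card_Un_disjoint) auto
  also have "S \<inter> I\<^sub>1 \<union> S \<inter> I\<^sub>2 = S" using S by auto
  finally show "a * card {e\<in>H\<^sub>1 \<union> H\<^sub>2. e \<subseteq> S} \<le> card S" .
qed

text \<open>Charge every edge to its deeper endpoint: a vertex has at most m - 1 proper ancestors,
  so any set \<open>S\<close> spans at most (m - 1)|S| edges.\<close>

lemma dense_bounded_tree_depth:
  assumes a: "0 \<le> a" "a * (real m - 1) \<le> 1" and m: "m \<ge> 1"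
  shows "dense_bounded a (tree_vertices b k m) (tree_edges b k m)"
  unfolding dense_bounded_def
proof (intro allI impI)
  fix S assume S: "S \<subseteq> tree_vertices b k m"
  have finS: "finite S" using S finite_tree_vertices finite_subset by blast
  define anc where "anc v = branch (snd v) - {snd v}" for v :: "bool \<times> nat list"
  have fa: "finite (anc v)" for v by (simp add: anc_def finite_branch)
  have "{e\<in>tree_edges b k m. e \<subseteq> S} \<subseteq> (\<Union>v\<in>S. (\<lambda>u. {(b, u), v}) ` anc v)"
  proof
    fix e assume "e \<in> {e\<in>tree_edges b k m. e \<subseteq> S}"
    then obtain xs ys where e: "e = {(b, xs), (b, ys)}" "xs \<noteq> []" "strict_suffix xs ys" "e \<subseteq> S"
      unfolding tree_edges_def by auto
    thus "e \<in> (\<Union>v\<in>S. (\<lambda>u. {(b, u), v}) ` anc v)"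
      by (intro UN_I[of "(b, ys)"]) (auto simp: anc_def branch_def strict_suffix_def)
  qed
  hence "card {e\<in>tree_edges b k m. e \<subseteq> S} \<le> card (\<Union>v\<in>S. (\<lambda>u. {(b, u), v}) ` anc v)"
    using finS fa by (intro card_mono) auto
  also have "\<dots> \<le> (\<Sum>v\<in>S. card ((\<lambda>u. {(b, u), v}) ` anc v))" by (rule card_UN_le[OF finS])
  also have "\<dots> \<le> (\<Sum>v\<in>S. m - 1)"
  proof (rule sum_mono)
    fix v assume "v \<in> S"
    hence v: "snd v \<noteq> []" "length (snd v) \<le> m" using S by (auto simp: tree_vertices_def)
    have "card ((\<lambda>u. {(b, u), v}) ` anc v) \<le> card (anc v)" by (rule card_image_le[OF fa])
    also have "\<dots> = length (snd v) - 1"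
      unfolding anc_def using v by (subst card_Diff_singleton) (auto simp: branch_def card_branch[unfolded branch_def])
    finally show "card ((\<lambda>u. {(b, u), v}) ` anc v) \<le> m - 1" using v by linarith
  qed
  finally have "real (card {e\<in>tree_edges b k m. e \<subseteq> S}) \<le> real (card S * (m - 1))"
    unfolding of_nat_le_iff by simp
  hence "a * card {e\<in>tree_edges b k m. e \<subseteq> S} \<le> a * real (card S * (m - 1))"
    using a by (intro mult_left_mono) auto
  also have "\<dots> = (a * (real m - 1)) * card S" using m by (simp add: of_nat_diff)
  also have "\<dots> \<le> 1 * real (card S)" using a by (intro mult_right_mono) auto
  finally show "a * card {e\<in>tree_edges b k m. e \<subseteq> S} \<le> card S" by simp
qed

text \<open>A tree without branching above the last level: a clique on \<open>m\<close> vertices joined completely to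
  an independent set of leaves.\<close>

lemma dense_bounded_tree_broom:
  assumes one: "\<And>i. i < m \<Longrightarrow> branching (k + i) = 1"
    and a: "0 \<le> a"
    and arith: "\<And>x y. x \<le> m \<Longrightarrow> y \<le> branching (k + m) \<Longrightarrow> a * (real (x choose 2) + real x * real y) \<le> real x + real y"
  shows "dense_bounded a (tree_vertices b k (Suc m)) (tree_edges b k (Suc m))"
  unfolding dense_bounded_def
proof (intro allI impI)
  fix S assume S: "S \<subseteq> tree_vertices b k (Suc m)"
  have finS: "finite S" using S finite_tree_vertices finite_subset by blast
  define X where "X = {v\<in>S. length (snd v) \<le> m}"
  define Y where "Y = {v\<in>S. length (snd v) = Suc m}"
  have XY: "S = X \<union> Y" "X \<inter> Y = {}" using S by (auto simp: X_def Y_def tree_vertices_def)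
  have fin: "finite X" "finite Y" using finS by (auto simp: X_def Y_def)
  \<comment> \<open>Where there is only one child per vertex, all choices are 0, so each level up to
    \<open>m\<close> consists of a single vertex.\<close>
  have rep: "xs = replicate (length xs) 0" if "tree_path k xs" "length xs \<le> m" for xs
    using that one by (induction xs) auto
  have "X \<subseteq> (\<lambda>i. (b, replicate i 0)) ` {1..m}"
  proof
    fix v assume "v \<in> X"
    then obtain xs where xs: "v = (b, xs)" "xs \<noteq> []" "length xs \<le> m" "tree_path k xs"
      using S by (auto simp: X_def tree_vertices_def)
    thus "v \<in> (\<lambda>i. (b, replicate i 0)) ` {1..m}"
      using rep[of xs] by (intro image_eqI[of _ _ "length xs"]) (auto simp: Suc_le_eq)
  qed
  hence "card X \<le> card ((\<lambda>i. (b, replicate i 0::nat list)) ` {1..m})" by (intro card_mono) auto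
  also have "\<dots> \<le> m" using card_image_le[of "{1..m}" "\<lambda>i. (b, replicate i 0::nat list)"] by simp
  finally have cX: "card X \<le> m" .
  have "Y \<subseteq> (\<lambda>x. (b, x # replicate m 0)) ` {..<branching (k + m)}"
  proof
    fix v assume "v \<in> Y"
    then obtain xs where xs: "v = (b, xs)" "length xs = Suc m" "tree_path k xs"
      using S by (auto simp: Y_def tree_vertices_def)
    then obtain x zs where "xs = x # zs" "length zs = m" by (auto simp: length_Suc_conv)
    thus "v \<in> (\<lambda>x. (b, x # replicate m 0)) ` {..<branching (k + m)}"
      using rep[of zs] xs by auto
  qed
  hence "card Y \<le> card ((\<lambda>x. (b, x # replicate m 0)) ` {..<branching (k + m)})" by (intro card_mono) auto
  also have "\<dots> \<le> branching (k + m)"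
    using card_image_le[of "{..<branching (k + m)}" "\<lambda>x. (b, x # replicate m 0)"] by simp
  finally have cY: "card Y \<le> branching (k + m)" .
  have "{e\<in>tree_edges b k (Suc m). e \<subseteq> S} \<subseteq>
      {e. e \<subseteq> X \<and> card e = 2} \<union> (\<lambda>(u, v). {u, v}) ` (X \<times> Y)"
  proof
    fix e assume "e \<in> {e\<in>tree_edges b k (Suc m). e \<subseteq> S}"
    then obtain xs ys where e: "e = {(b, xs), (b, ys)}" "strict_suffix xs ys" "length ys \<le> Suc m" "e \<subseteq> S"
      unfolding tree_edges_def by auto
    have ne: "xs \<noteq> ys" "suffix xs ys" using e(2) by (auto simp: strict_suffix_def)
    hence "length xs < length ys" by (auto simp: suffix_def)
    hence x: "(b, xs) \<in> X" using e by (auto simp: X_def)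
    have "(b, ys) \<in> X \<or> (b, ys) \<in> Y" using e by (auto simp: X_def Y_def)
    thus "e \<in> {e. e \<subseteq> X \<and> card e = 2} \<union> (\<lambda>(u, v). {u, v}) ` (X \<times> Y)"
      using x e(1) ne(1) by auto
  qed
  hence "card {e\<in>tree_edges b k (Suc m). e \<subseteq> S} \<le>
      card ({e. e \<subseteq> X \<and> card e = 2} \<union> (\<lambda>(u, v). {u, v}) ` (X \<times> Y))"
    using fin by (intro card_mono) auto
  also have "\<dots> \<le> card {e. e \<subseteq> X \<and> card e = 2} + card ((\<lambda>(u, v). {u, v}) ` (X \<times> Y))"
    by (rule card_Un_le)
  also have "\<dots> \<le> (card X choose 2) + card X * card Y"
    using fin card_image_le[of "X \<times> Y" "\<lambda>(u, v). {u, v}"]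
    by (simp add: n_subsets card_cartesian_product)
  finally have "real (card {e\<in>tree_edges b k (Suc m). e \<subseteq> S}) \<le> real ((card X choose 2) + card X * card Y)"
    by (rule of_nat_mono)
  hence "real (card {e\<in>tree_edges b k (Suc m). e \<subseteq> S}) \<le> real (card X choose 2) + real (card X) * real (card Y)"
    by simp
  hence "a * card {e\<in>tree_edges b k (Suc m). e \<subseteq> S} \<le> a * (real (card X choose 2) + real (card X) * real (card Y))"
    using a by (intro mult_left_mono) auto
  also have "\<dots> \<le> real (card X) + real (card Y)" by (rule arith[OF cX cY])
  also have "\<dots> = card S" using XY fin by (simp add: card_Un_disjoint)
  finally show "a * card {e\<in>tree_edges b k (Suc m). e \<subseteq> S} \<le> card S" .
qed

lemma one_statement_tree:
  fixes a d :: real and p :: "nat \<Rightarrow> real" and G :: "nat \<Rightarrow> nat set set"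
  assumes st: "s \<ge> 1" "t \<ge> 1" and a: "a \<ge> 0"
    and A: "dense_bounded a (tree_vertices False 0 s) (tree_edges False 0 s)"
    and B: "dense_bounded a (tree_vertices True s t) (tree_edges True s t)"
    and d: "d > 0" and p: "\<And>n. 0 \<le> p n \<and> p n \<le> 1"
    and lim: "filterlim (\<lambda>n. p n / real n powr (-a)) at_top sequentially"
    and G: "\<And>n. G n \<in> dense_family d n"
  shows "(\<lambda>n. rbw_prob n (G n) (p n) (s + t)) \<longlonglongrightarrow> 1"
proof (rule one_statement)
  let ?A = "tree_vertices False 0 s" and ?B = "tree_vertices True s t"
  let ?H = "tree_edges False 0 s \<union> tree_edges True s t"
  show "finite ?A" "finite ?B" by (rule finite_tree_vertices)+
  show "?A \<noteq> {}" "?B \<noteq> {}" using st by (auto intro!: tree_vertices_nonempty)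
  show AB: "?A \<inter> ?B = {}" by (auto simp: tree_vertices_def)
  show "?H \<subseteq> {e. e \<subseteq> ?A \<union> ?B \<and> card e = 2}"
    using tree_edges_subset[of False 0 s] tree_edges_subset[of True s t] by blast
  show "dense_bounded a (?A \<union> ?B) ?H"
    using tree_edges_subset[of False 0 s] tree_edges_subset[of True s t]
    by (intro dense_bounded_Un A B AB finite_tree_vertices a) auto
  show "rbw_arrow (E \<union> F) (s + t)"
    if "\<phi> \<in> embeddings (?A \<union> ?B) n" "\<phi> \<in> biclique_maps ?A ?B n E" "(`) \<phi> ` ?H \<subseteq> F" for n E F \<phi>
    using tree_pattern_arrow[OF that] .
qed (use d p lim G in auto)

section \<open>The exponents of the three 1-statements\<close>

lemma branching_eval:
  "branching 0 = 1" "branching (Suc 0) = 1" "branching 2 = 1" "branching (Suc (Suc 0)) = 1" "branching 3 = 4"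
  by (simp_all add: branching_def choose_two)

text \<open>Split 2 + 2. The first tree is an edge; in the second the root has
  \<open>branching 3 = 4\<close> children. Equality in the density condition occurs at x = 1, y = 4,
  the full star, which fixes 5/4.\<close>

lemma one_statement_K4:
  assumes "d > 0" "\<And>n. 0 \<le> p n \<and> p n \<le> 1" "\<And>n. G n \<in> dense_family d n"
    and "filterlim (\<lambda>n. p n / real n powr (-5/4)) at_top sequentially"
  shows "(\<lambda>n. rbw_prob n (G n) (p n) 4) \<longlonglongrightarrow> 1"
proof -
  have "dense_bounded (5/4) (tree_vertices False 0 (Suc 1)) (tree_edges False 0 (Suc 1))"
  proof (rule dense_bounded_tree_broom)
    fix x y :: nat assume "x \<le> 1" "y \<le> branching (0 + 1)"
    hence "x \<in> {0, 1}" "y \<le> 1" by (auto simp: branching_eval)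
    thus "5 / 4 * (real (x choose 2) + real x * real y) \<le> real x + real y"
      by (auto simp: choose_two)
  qed (auto simp: branching_eval)
  moreover have "dense_bounded (5/4) (tree_vertices True 2 (Suc 1)) (tree_edges True 2 (Suc 1))"
  proof (rule dense_bounded_tree_broom)
    fix x y :: nat assume "x \<le> 1" "y \<le> branching (2 + 1)"
    hence "x \<in> {0, 1}" "y \<le> 4" by (auto simp: branching_eval)
    thus "5 / 4 * (real (x choose 2) + real x * real y) \<le> real x + real y"
      by (auto simp: choose_two)
  qed (auto simp: branching_eval)
  ultimately have "(\<lambda>n. rbw_prob n (G n) (p n) (2 + 2)) \<longlonglongrightarrow> 1"
    using assms by (intro one_statement_tree[where a = "5/4" and d = d]) (auto simp: numeral_2_eq_2)
  thus ?thesis by simp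
qed

text \<open>Split 3 + 2. The larger part is built first, while no branching occurs, so it stays a
  plain triangle. Equality occurs at x = 2, y = 1; the other side has depth 2 and is a
  forest.\<close>

lemma one_statement_K5:
  assumes "d > 0" "\<And>n. 0 \<le> p n \<and> p n \<le> 1" "\<And>n. G n \<in> dense_family d n"
    and "filterlim (\<lambda>n. p n / real n powr (-1)) at_top sequentially"
  shows "(\<lambda>n. rbw_prob n (G n) (p n) 5) \<longlonglongrightarrow> 1"
proof -
  have "dense_bounded 1 (tree_vertices False 0 (Suc 2)) (tree_edges False 0 (Suc 2))"
  proof (rule dense_bounded_tree_broom)
    fix x y :: nat assume "x \<le> 2" "y \<le> branching (0 + 2)"
    hence "x \<in> {0, 1, 2}" "y \<le> 1" by (auto simp: branching_eval)
    thus "1 * (real (x choose 2) + real x * real y) \<le> real x + real y"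
      by (auto simp: choose_two)
  next
    fix i :: nat assume "i < 2"
    hence "i \<in> {0, 1}" by auto
    thus "branching (0 + i) = 1" by (auto simp: branching_eval)
  qed auto
  moreover have "dense_bounded 1 (tree_vertices True 3 2) (tree_edges True 3 2)"
    by (rule dense_bounded_tree_depth) auto
  ultimately have "(\<lambda>n. rbw_prob n (G n) (p n) (3 + 2)) \<longlonglongrightarrow> 1"
    using assms by (intro one_statement_tree[where a = 1 and d = d]) (auto simp: numeral_3_eq_3 numeral_2_eq_2)
  thus ?thesis by simp
qed

text \<open>Split 4 + 3. Equality occurs at x = 3, y = 4, where 3 + 12 = 15 edges lie on 7 vertices.
  The other side has depth 3 and leaves slack, since (7/15) * 2 < 1.\<close>

lemma one_statement_K7:
  assumes "d > 0" "\<And>n. 0 \<le> p n \<and> p n \<le> 1" "\<And>n. G n \<in> dense_family d n"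
    and "filterlim (\<lambda>n. p n / real n powr (-7/15)) at_top sequentially"
  shows "(\<lambda>n. rbw_prob n (G n) (p n) 7) \<longlonglongrightarrow> 1"
proof -
  have "dense_bounded (7/15) (tree_vertices False 0 (Suc 3)) (tree_edges False 0 (Suc 3))"
  proof (rule dense_bounded_tree_broom)
    fix x y :: nat assume "x \<le> 3" "y \<le> branching (0 + 3)"
    hence "x \<in> {0, 1, 2, 3}" "y \<le> 4" by (auto simp: branching_eval)
    thus "7/15 * (real (x choose 2) + real x * real y) \<le> real x + real y"
      by (auto simp: choose_two)
  next
    fix i :: nat assume "i < 3"
    hence "i \<in> {0, 1, 2}" by auto
    thus "branching (0 + i) = 1" by (auto simp: branching_eval)
  qed auto
  moreover have "dense_bounded (7/15) (tree_vertices True 4 3) (tree_edges True 4 3)"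
    by (rule dense_bounded_tree_depth) auto
  ultimately have "(\<lambda>n. rbw_prob n (G n) (p n) (4 + 3)) \<longlonglongrightarrow> 1"
    using assms by (intro one_statement_tree[where a = "7/15" and d = d]) (auto simp: eval_nat_numeral)
  thus ?thesis by simp
qed

section \<open>Colourings over the complete bipartite graph\<close>

definition balanced_bipartite :: "nat \<Rightarrow> nat set set" where
  "balanced_bipartite n = {{u, v} | u v. u < n div 2 \<and> n div 2 \<le> v \<and> v < n}"

lemma balanced_bipartite_subset: "balanced_bipartite n \<subseteq> all_edges n"
proof
  fix e assume "e \<in> balanced_bipartite n"
  then obtain u v where "e = {u, v}" "u < n div 2" "n div 2 \<le> v" "v < n"
    unfolding balanced_bipartite_def by blast
  thus "e \<in> all_edges n" unfolding all_edges_def by (intro CollectI exI[of _ u] exI[of _ v]) auto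
qed

lemma balanced_bipartite_dense:
  assumes "d \<le> 1/2"
  shows "balanced_bipartite n \<in> dense_family d n"
proof -
  define m where "m = n div 2"
  have img: "balanced_bipartite n = (\<lambda>(u, v). {u, v}) ` ({..<m} \<times> {m..<n})"
    by (auto simp: balanced_bipartite_def m_def image_iff; blast)
  have "inj_on (\<lambda>(u, v). {u, v}) ({..<m} \<times> {m..<n})"
    by (auto simp: inj_on_def doubleton_eq_iff)
  hence card: "card (balanced_bipartite n) = m * (n - m)"
    unfolding img by (simp add: card_image card_cartesian_product)
  \<comment> \<open>The bipartite graph contains at least half of all pairs, which is where d <= 1/2
    enters.\<close>
  have "n * (n - 1) \<le> 4 * (m * (n - m))"
  proof (cases "even n")
    case True
    then obtain k where "n = 2 * k" by auto
    thus ?thesis by (simp add: m_def)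
  next
    case False
    then obtain k where "n = 2 * k + 1" by (auto elim: oddE)
    thus ?thesis by (simp add: m_def algebra_simps)
  qed
  hence "(n choose 2) \<le> 2 * (m * (n - m))" unfolding choose_two by linarith
  hence "real (n choose 2) \<le> real (2 * (m * (n - m)))" by (rule of_nat_mono)
  moreover have "d * real (n choose 2) \<le> 1 / 2 * real (n choose 2)"
    using assms by (intro mult_right_mono) auto
  ultimately have "d * real (n choose 2) \<le> real (card (balanced_bipartite n))"
    unfolding card by simp
  thus ?thesis using balanced_bipartite_subset by (simp add: dense_family_def)
qed

definition one_sided :: "nat \<Rightarrow> nat set \<Rightarrow> bool" where
  "one_sided n T \<longleftrightarrow> (\<forall>x\<in>T. x < n div 2) \<or> (\<forall>x\<in>T. n div 2 \<le> x)"

lemma one_sided_clique_edges: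
  assumes "one_sided n T" "T \<subseteq> S" "clique_edges S \<subseteq> balanced_bipartite n \<union> F"
  shows "clique_edges T \<subseteq> F"
proof
  fix e assume e: "e \<in> clique_edges T"
  hence "e \<notin> balanced_bipartite n"
    using assms(1) by (auto simp: clique_edges_eq one_sided_def balanced_bipartite_def dest: leD)
  thus "e \<in> F" using e assms(3) clique_edges_mono[OF assms(2)] by auto
qed

lemma one_sided_subset:
  assumes S: "finite S" "2 * k - 1 \<le> card S"
  shows "\<exists>T\<subseteq>S. card T = k \<and> one_sided n T"
proof -
  let ?A = "{x\<in>S. x < n div 2}" and ?B = "{x\<in>S. n div 2 \<le> x}"
  have "S = ?A \<union> ?B" by auto
  hence "card S = card ?A + card ?B" using S(1) by (subst card_Un_disjoint[symmetric]) auto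
  hence "k \<le> card ?A \<or> k \<le> card ?B" using S(2) by linarith
  thus ?thesis
  proof
    assume "k \<le> card ?A"
    then obtain T where "T \<subseteq> ?A" "card T = k" by (meson obtain_subset_with_card_n)
    thus ?thesis by (intro exI[of _ T]) (auto simp: one_sided_def)
  next
    assume "k \<le> card ?B"
    then obtain T where "T \<subseteq> ?B" "card T = k" by (meson obtain_subset_with_card_n)
    thus ?thesis by (intro exI[of _ T]) (auto simp: one_sided_def)
  qed
qed

lemma inj_to_nat:
  assumes "finite S"
  obtains h :: "'a \<Rightarrow> nat" where "inj_on h S"
  using finite_imp_inj_to_nat_seg[OF assms] by blast

text \<open>Among 2k - 1 vertices some k lie on one side, and there all edges come from
  \<open>F\<close>, where the given colouring has no rainbow K_k. Edges outside \<open>F\<close> can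
  therefore receive private colours.\<close>

lemma not_arrow_odd_clique:
  assumes F: "F \<subseteq> all_edges n" and c: "proper_colouring F c" "\<not> has_rainbow_clique F c k"
  shows "\<not> rbw_arrow (balanced_bipartite n \<union> F) (2 * k - 1)"
proof
  assume arrow: "rbw_arrow (balanced_bipartite n \<union> F) (2 * k - 1)"
  obtain h :: "nat set \<Rightarrow> nat" where h: "inj_on h (all_edges n)"
    using inj_to_nat[OF finite_all_edges] by blast
  \<comment> \<open>Even colours inside \<open>F\<close>, odd injective colours outside, so the two
    kinds never clash.\<close>
  define c' where "c' e = (if e \<in> F then 2 * c e else 2 * h e + 1)" for e
  have "proper_colouring (balanced_bipartite n \<union> F) c'"
    unfolding proper_colouring_def
  proof (intro ballI impI)
    fix e f assume e: "e \<in> balanced_bipartite n \<union> F" and f: "f \<in> balanced_bipartite n \<union> F"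
      and ef: "e \<noteq> f \<and> e \<inter> f \<noteq> {}"
    have all: "e \<in> all_edges n" "f \<in> all_edges n" using e f F balanced_bipartite_subset by auto
    have "h e \<noteq> h f" using h all ef by (auto simp: inj_on_def)
    moreover have "c e \<noteq> c f" if "e \<in> F" "f \<in> F" using c(1) ef that by (auto simp: proper_colouring_def)
    moreover have "2 * a \<noteq> 2 * b + 1" for a b :: nat by presburger
    ultimately show "c' e \<noteq> c' f" unfolding c'_def by (metis mult_cancel_left add_right_cancel zero_neq_numeral)
  qed
  then obtain S where S: "finite S" "card S = 2 * k - 1" "clique_edges S \<subseteq> balanced_bipartite n \<union> F"
      "inj_on c' (clique_edges S)"
    using arrow unfolding rbw_arrow_def has_rainbow_clique_def by blast
  obtain T where T: "T \<subseteq> S" "card T = k" "one_sided n T" using one_sided_subset[of S k n] S by auto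
  have TF: "clique_edges T \<subseteq> F" by (rule one_sided_clique_edges[OF T(3,1) S(3)])
  have "inj_on c' (clique_edges T)" using S(4) clique_edges_mono[OF T(1)] inj_on_subset by blast
  hence "inj_on c (clique_edges T)"
    using TF unfolding inj_on_def by (simp add: c'_def subset_iff)
  hence "has_rainbow_clique F c k"
    unfolding has_rainbow_clique_def using T TF S(1) finite_subset by blast
  thus False using c(2) by simp
qed

lemma zero_statement_bipartite:
  fixes a :: real and p :: "nat \<Rightarrow> real"
  assumes d: "d \<le> 1/2" and p: "\<And>n. 0 \<le> p n \<and> p n \<le> 1"
    and lim: "(\<lambda>n. p n / real n powr (-a)) \<longlonglongrightarrow> 0"
    and col: "\<And>n F. F \<subseteq> all_edges n \<Longrightarrow> locally_sparse a K F \<Longrightarrow> \<not> rbw_arrow (balanced_bipartite n \<union> F) l"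
  shows "\<exists>G. (\<forall>n. G n \<in> dense_family d n) \<and> (\<lambda>n. rbw_prob n (G n) (p n) l) \<longlonglongrightarrow> 0"
proof (intro exI conjI allI)
  show "balanced_bipartite n \<in> dense_family d n" for n by (rule balanced_bipartite_dense[OF d])
  show "(\<lambda>n. rbw_prob n (balanced_bipartite n) (p n) l) \<longlonglongrightarrow> 0"
    by (rule zero_statement[where a = a and K = K, OF p lim]) (rule col)
qed

lemma locally_sparse_clique:
  assumes "locally_sparse a K F" "card T = k" "k > 0" "k \<le> K" "clique_edges T \<subseteq> F"
  shows "a * real (k choose 2) < k"
proof -
  have T: "finite T" "T \<noteq> {}" using assms(2,3) by (auto simp: card_gt_0_iff)
  have "edge_count F T = k choose 2"
    using assms(2,5) T by (simp add: edge_count_def Int_absorb1 card_clique_edges)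
  thus ?thesis using assms T unfolding locally_sparse_def by metis
qed

text \<open>Sparseness on three vertices excludes triangles, since 3 < 3 fails. An injective
  colouring then already has no rainbow K_3.\<close>

lemma zero_statement_K5:
  assumes "d \<le> 1/2" "\<And>n. 0 \<le> p n \<and> p n \<le> 1" "(\<lambda>n. p n / real n powr (-1)) \<longlonglongrightarrow> 0"
  shows "\<exists>G. (\<forall>n. G n \<in> dense_family d n) \<and> (\<lambda>n. rbw_prob n (G n) (p n) 5) \<longlonglongrightarrow> 0"
proof (rule zero_statement_bipartite[OF assms])
  fix n F assume F: "F \<subseteq> all_edges n" "locally_sparse 1 3 F"
  obtain h :: "nat set \<Rightarrow> nat" where h: "inj_on h F"
    using inj_to_nat[of F] F(1) finite_all_edges finite_subset by metis
  have "proper_colouring F h" using h by (auto simp: proper_colouring_def inj_on_def)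
  moreover have "\<not> has_rainbow_clique F h 3"
    using locally_sparse_clique[OF F(2), of _ 3] by (auto simp: has_rainbow_clique_def choose_two)
  ultimately show "\<not> rbw_arrow (balanced_bipartite n \<union> F) 5"
    using not_arrow_odd_clique[OF F(1), of h 3] by simp
qed

section \<open>Sparse graphs have proper colourings without rainbow \<open>K\<^sub>4\<close>\<close>

definition quads :: "nat set set \<Rightarrow> nat set set" where
  "quads F = {Q. card Q = 4 \<and> clique_edges Q \<subseteq> F}"

text \<open>\<open>g\<close> selects a perfect matching \<open>{g Q, Q - g Q}\<close> of every \<open>K\<^sub>4\<close>; if different copies of \<open>K\<^sub>4\<close> use
  disjoint matchings, then giving both edges of each matching the same colour is proper.\<close>

definition matching_choice :: "nat set set \<Rightarrow> (nat set \<Rightarrow> nat set) \<Rightarrow> bool" where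
  "matching_choice \<Q> g \<longleftrightarrow> (\<forall>Q\<in>\<Q>. g Q \<subseteq> Q \<and> card (g Q) = 2) \<and>
     (\<forall>Q\<in>\<Q>. \<forall>R\<in>\<Q>. Q \<noteq> R \<longrightarrow> {g Q, Q - g Q} \<inter> {g R, R - g R} = {})"

lemma colouring_of_matching_choice:
  assumes finF: "finite F" and finQ: "finite (quads F)" and g: "matching_choice (quads F) g"
  shows "\<exists>c. proper_colouring F c \<and> \<not> has_rainbow_clique F c 4"
proof -
  obtain h :: "nat set \<Rightarrow> nat" where h: "inj_on h F" using inj_to_nat[OF finF] by blast
  obtain k :: "nat set \<Rightarrow> nat" where k: "inj_on k (quads F)" using inj_to_nat[OF finQ] by blast
  define M where "M Q = {g Q, Q - g Q}" for Q
  have uniq: "Q = R" if "Q \<in> quads F" "R \<in> quads F" "e \<in> M Q" "e \<in> M R" for Q R e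
    using g that unfolding matching_choice_def M_def by blast
  define q where "q e = (THE Q. Q \<in> quads F \<and> e \<in> M Q)" for e
  have q: "q e = Q" if "Q \<in> quads F" "e \<in> M Q" for Q e
    unfolding q_def by (rule the_equality) (use that uniq in blast)+
  \<comment> \<open>Even colours name the K_4 whose matching contains the edge, odd colours are
    injective. A repeated colour thus occurs only on the two disjoint edges of one matching.\<close>
  define c where "c e = (if \<exists>Q\<in>quads F. e \<in> M Q then 2 * k (q e) else 2 * h e + 1)" for e
  have cM: "c e = 2 * k Q" if "Q \<in> quads F" "e \<in> M Q" for Q e
  proof -
    have "\<exists>Q\<in>quads F. e \<in> M Q" using that by blast
    thus ?thesis using q[OF that] by (simp add: c_def)
  qed
  have "proper_colouring F c"
    unfolding proper_colouring_def
  proof (intro ballI impI notI)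
    fix e f assume ef: "e \<in> F" "f \<in> F" "e \<noteq> f \<and> e \<inter> f \<noteq> {}" and eq: "c e = c f"
    have par: "2 * a \<noteq> 2 * b + 1" for a b :: nat by presburger
    show False
    proof (cases "\<exists>Q\<in>quads F. e \<in> M Q")
      case True
      then obtain Q where Q: "Q \<in> quads F" "e \<in> M Q" by blast
      have "\<exists>R\<in>quads F. f \<in> M R"
        using eq cM[OF Q] par[of "k Q" "h f"] by (auto simp: c_def split: if_splits)
      then obtain R where R: "R \<in> quads F" "f \<in> M R" by blast
      have "k Q = k R" using eq cM[OF Q] cM[OF R] by simp
      hence "Q = R" using k Q R by (auto simp: inj_on_def)
      thus False using Q R ef(3) by (auto simp: M_def)
    next
      case False
      hence "\<not> (\<exists>R\<in>quads F. f \<in> M R)" using eq cM par by (metis c_def)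
      hence "h e = h f" using False eq by (simp add: c_def)
      thus False using h ef by (auto simp: inj_on_def)
    qed
  qed
  moreover have "\<not> inj_on c (clique_edges Q)" if "card Q = 4" "clique_edges Q \<subseteq> F" for Q
  proof
    assume inj: "inj_on c (clique_edges Q)"
    have Q: "Q \<in> quads F" using that by (simp add: quads_def)
    hence gQ: "g Q \<subseteq> Q" "card (g Q) = 2" using g by (auto simp: matching_choice_def)
    have "finite Q" using that(1) by (metis card.infinite zero_neq_numeral)
    hence "card (Q - g Q) = 2" using gQ that(1) by (simp add: card_Diff_subset finite_subset)
    hence "g Q \<in> clique_edges Q" "Q - g Q \<in> clique_edges Q" using gQ by (auto simp: clique_edges_eq)
    moreover have "c (g Q) = c (Q - g Q)" using cM[OF Q] by (simp add: M_def)
    ultimately have "g Q = Q - g Q" using inj by (meson inj_onD)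
    hence "g Q = {}" by blast
    thus False using gQ by simp
  qed
  ultimately show ?thesis unfolding has_rainbow_clique_def by blast
qed

text \<open>Put the five vertices on a regular pentagon. The K_4 missing a vertex receives the side
  opposite to that vertex and the diagonal parallel to this side; the five rotations of this pair
  partition the ten edges.\<close>

lemma matching_choice_K5:
  assumes S: "card S = 5" and \<Q>: "\<And>Q. Q \<in> \<Q> \<Longrightarrow> Q \<subseteq> S \<and> card Q = 4"
  shows "\<exists>g. matching_choice \<Q> g"
proof -
  obtain v1 v2 v3 v4 v5 where v: "S = {v1, v2, v3, v4, v5}" "distinct [v1, v2, v3, v4, v5]"
  proof -
    have "finite S" using S by (metis card.infinite zero_neq_numeral)
    then obtain xs where xs: "set xs = S" "distinct xs" using finite_distinct_list by blast
    hence "length xs = 5" using S distinct_card by fastforce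
    then obtain v1 v2 v3 v4 v5 where "xs = [v1, v2, v3, v4, v5]"
      by (auto simp: numeral_eq_Suc length_Suc_conv)
    thus ?thesis using that xs by auto
  qed
  define g where "g Q = (if v1 \<notin> Q then {v2, v5} else if v2 \<notin> Q then {v3, v1} else
    if v3 \<notin> Q then {v4, v2} else if v4 \<notin> Q then {v5, v3} else {v1, v4})" for Q
  have cases: "Q = {v2, v3, v4, v5} \<or> Q = {v1, v3, v4, v5} \<or> Q = {v1, v2, v4, v5} \<or>
      Q = {v1, v2, v3, v5} \<or> Q = {v1, v2, v3, v4}" if "Q \<in> \<Q>" for Q
  proof -
    have Q: "Q \<subseteq> S" "card Q = 4" using \<Q>[OF that] by auto
    have "finite S" using v(1) by simp
    hence "card (S - Q) = 1" using Q S by (simp add: card_Diff_subset finite_subset)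
    then obtain x where x: "S - Q = {x}" by (auto simp: card_1_singleton_iff)
    hence "Q = S - {x}" "x \<in> S" using Q by auto
    thus ?thesis using v by auto
  qed
  have "matching_choice \<Q> g"
    unfolding matching_choice_def
  proof (intro conjI ballI impI)
    fix Q assume "Q \<in> \<Q>"
    from cases[OF this] show "g Q \<subseteq> Q" "card (g Q) = 2"
      using v(2) by (elim disjE; auto simp: g_def)+
  next
    fix Q R assume QR: "Q \<in> \<Q>" "R \<in> \<Q>" "Q \<noteq> R"
    have ne: "v1 \<noteq> v2" "v1 \<noteq> v3" "v1 \<noteq> v4" "v1 \<noteq> v5" "v2 \<noteq> v3" "v2 \<noteq> v4" "v2 \<noteq> v5"
      "v3 \<noteq> v4" "v3 \<noteq> v5" "v4 \<noteq> v5" using v(2) by auto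
    define m where "m P = {g P, P - g P}" for P
    have M: "(m P = {{v2, v5}, {v3, v4}} \<and> P = {v2, v3, v4, v5}) \<or>
             (m P = {{v3, v1}, {v4, v5}} \<and> P = {v1, v3, v4, v5}) \<or>
             (m P = {{v4, v2}, {v5, v1}} \<and> P = {v1, v2, v4, v5}) \<or>
             (m P = {{v5, v3}, {v1, v2}} \<and> P = {v1, v2, v3, v5}) \<or>
             (m P = {{v1, v4}, {v2, v3}} \<and> P = {v1, v2, v3, v4})" if "P \<in> \<Q>" for P
      using cases[OF that]
      by (elim disjE; simp add: m_def g_def insert_Diff_if ne ne[symmetric] insert_commute)
    have "m Q \<inter> m R = {}"
      using M[OF QR(1)] M[OF QR(2)] QR(3)
      by (elim disjE conjE) (simp_all add: doubleton_eq_iff ne ne[symmetric])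
    thus "{g Q, Q - g Q} \<inter> {g R, R - g R} = {}" by (simp add: m_def)
  qed
  thus ?thesis by blast
qed

text \<open>Weighted so that a graph of density below \<open>15/7\<close> has positive potential.\<close>

definition potential :: "nat set set \<Rightarrow> nat set \<Rightarrow> int" where
  "potential F S = 15 * int (card S) - 7 * int (edge_count F S)"

lemma potential_pos:
  assumes "locally_sparse (7/15) K F" "finite S" "S \<noteq> {}" "card S \<le> K"
  shows "potential F S > 0"
proof -
  have "7 / 15 * real (edge_count F S) < real (card S)"
    using assms unfolding locally_sparse_def by blast
  hence "real (7 * edge_count F S) < real (15 * card S)" by simp
  hence "7 * edge_count F S < 15 * card S" unfolding of_nat_less_iff .
  thus ?thesis by (simp add: potential_def)
qed

lemma quads_finite: "Q \<in> quads F \<Longrightarrow> finite Q"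
  unfolding quads_def by (metis (mono_tags, lifting) card.infinite mem_Collect_eq zero_neq_numeral)

lemma quads_edge: "Q \<in> quads F \<Longrightarrow> u \<in> Q \<Longrightarrow> v \<in> Q \<Longrightarrow> u \<noteq> v \<Longrightarrow> {u, v} \<in> F"
  by (auto simp: quads_def clique_edges_def)

lemma quads_card: "Q \<in> quads F \<Longrightarrow> card Q = 4"
  by (simp add: quads_def)

lemma potential_quad: "Q \<in> quads F \<Longrightarrow> potential F Q = 18"
  using card_clique_edges[OF quads_finite, of Q F]
  by (auto simp: potential_def edge_count_def quads_def Int_absorb1 choose_two)

text \<open>The constants are \<open>7 * 5 - 15 * 2 = 5\<close> for sharing an edge and \<open>7 * 3 - 15 = 6\<close> for sharing a
  triangle.\<close>

lemma potential_attach: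
  assumes S: "finite S" and Q: "Q \<in> quads F" "\<not> Q \<subseteq> S" "card (Q \<inter> S) \<ge> 2" and R: "R \<in> quads F"
  shows "potential F (S \<union> Q) \<le> potential F S - (if card (Q \<inter> S) = 2 then 5 else 6)
    - 7 * int (card ((R \<inter> Q) - S) * card ((R \<inter> S) - Q))"
proof -
  define j where "j = card (Q \<inter> S)"
  have finQ: "finite Q" using Q(1) by (rule quads_finite)
  have cQ: "card Q = 4" using Q(1) by (rule quads_card)
  have "Q \<inter> S \<subset> Q" using Q(2) by auto
  hence "j < 4" using psubset_card_mono[OF finQ] cQ by (simp add: j_def)
  hence j: "j = 2 \<or> j = 3" using Q(3) by (auto simp: j_def)
  \<comment> \<open>Edges of \<open>R\<close> from new vertices of \<open>Q\<close> to old vertices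
    outside \<open>Q\<close> belong neither to \<open>Q\<close> nor to \<open>S\<close>, so each
    costs a further 7.\<close>
  define X where "X = (\<lambda>(u, v). {u, v}) ` (((R \<inter> Q) - S) \<times> ((R \<inter> S) - Q))"
  define Y where "Y = clique_edges Q - clique_edges (Q \<inter> S)"
  define Z where "Z = F \<inter> clique_edges S"
  have cX: "card X = card ((R \<inter> Q) - S) * card ((R \<inter> S) - Q)"
    unfolding X_def by (subst card_image) (auto simp: inj_on_def doubleton_eq_iff card_cartesian_product)
  have cY: "card Y = 6 - (j choose 2)"
  proof -
    have "card Y = card (clique_edges Q) - card (clique_edges (Q \<inter> S))"
      unfolding Y_def using finQ by (intro card_Diff_subset finite_clique_edges clique_edges_mono) auto
    thus ?thesis using finQ cQ by (simp add: card_clique_edges j_def choose_two)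
  qed
  have fin: "finite X" "finite Y" "finite Z"
    using finQ S finite_clique_edges by (auto simp: X_def Y_def Z_def)
  have "X \<subseteq> F" using quads_edge[OF R] by (auto simp: X_def)
  moreover have "X \<subseteq> clique_edges (S \<union> Q)" by (auto simp: X_def clique_edges_eq card_2_iff)
  moreover have "Y \<subseteq> F \<inter> clique_edges (S \<union> Q)" using Q(1) by (auto simp: Y_def quads_def clique_edges_eq)
  moreover have "Z \<subseteq> F \<inter> clique_edges (S \<union> Q)" by (auto simp: Z_def clique_edges_eq)
  ultimately have sub: "X \<union> Y \<union> Z \<subseteq> F \<inter> clique_edges (S \<union> Q)" by blast
  have "X \<inter> Y = {}" by (auto simp: X_def Y_def clique_edges_eq)
  moreover have "X \<inter> Z = {}" by (auto simp: X_def Z_def clique_edges_eq)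
  moreover have "Y \<inter> Z = {}" by (auto simp: Y_def Z_def clique_edges_eq)
  ultimately have "card (X \<union> Y \<union> Z) = card X + card Y + card Z"
    using fin by (simp add: card_Un_disjoint Int_Un_distrib2)
  moreover have "card (X \<union> Y \<union> Z) \<le> edge_count F (S \<union> Q)"
    unfolding edge_count_def using S finQ by (intro card_mono[OF _ sub]) (simp add: finite_clique_edges)
  ultimately have e: "card X + card Y + edge_count F S \<le> edge_count F (S \<union> Q)"
    by (simp add: Z_def edge_count_def)
  have v: "card (S \<union> Q) + j = card S + 4"
    using card_Un_Int[OF S finQ] cQ by (simp add: j_def Int_commute)
  show ?thesis
    using j e v cY unfolding potential_def cX[symmetric] j_def[symmetric] by (auto simp: choose_two)
qed

text \<open>Attaching a K_4 along at least an edge lowers the potential by at least 5 and would make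
  it nonpositive. It adds at most 2 vertices, so sparseness up to 12 applies to sets of size
  10.\<close>

lemma potential_closed:
  assumes F: "locally_sparse (7/15) 12 F" and T: "finite T" "card T \<le> 10" "potential F T \<le> 5"
    and Q: "Q \<in> quads F" "card (Q \<inter> T) \<ge> 2"
  shows "Q \<subseteq> T"
proof (rule ccontr)
  assume nsub: "\<not> Q \<subseteq> T"
  have finQ: "finite Q" using Q(1) by (rule quads_finite)
  have "card (T \<union> Q) + card (Q \<inter> T) = card T + 4"
    using card_Un_Int[OF T(1) finQ] quads_card[OF Q(1)] by (simp add: Int_commute)
  hence "card (T \<union> Q) \<le> 12" using T(2) Q(2) by linarith
  moreover have "T \<union> Q \<noteq> {}" using nsub by auto
  ultimately have "potential F (T \<union> Q) > 0" using T finQ by (intro potential_pos[OF F]) auto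
  moreover have "(Q \<inter> T) - Q = {}" by auto
  hence "card ((Q \<inter> T) - Q) = 0" by (simp only: card.empty)
  ultimately show False
    using potential_attach[OF T(1) Q(1) nsub Q(2) Q(1)] T(3)
    by (simp only: Int_absorb mult_0_right of_nat_0 diff_0_right split: if_splits)
qed

text \<open>A \<open>K\<^sub>4\<close> in a minimal bad family has each of its three perfect matchings blocked by another
  member, and one member cannot block two of them.\<close>

lemma blocked_quad:
  assumes bad: "\<nexists>g. matching_choice \<Q> g" and g: "matching_choice (\<Q> - {Q}) g"
    and Q: "Q \<in> \<Q>" "card Q = 4"
  shows "\<exists>Q\<^sub>1\<in>\<Q> - {Q}. \<exists>Q\<^sub>2\<in>\<Q> - {Q}. \<exists>Q\<^sub>3\<in>\<Q> - {Q}. \<exists>f\<^sub>1 f\<^sub>2 f\<^sub>3. distinct [Q\<^sub>1, Q\<^sub>2, Q\<^sub>3] \<and>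
    f\<^sub>1 \<subseteq> Q \<inter> Q\<^sub>1 \<and> f\<^sub>2 \<subseteq> Q \<inter> Q\<^sub>2 \<and> f\<^sub>3 \<subseteq> Q \<inter> Q\<^sub>3 \<and> card f\<^sub>1 = 2 \<and> card f\<^sub>2 = 2 \<and> card f\<^sub>3 = 2 \<and>
    card (f\<^sub>1 \<inter> f\<^sub>2) = 1 \<and> card (f\<^sub>1 \<inter> f\<^sub>3) = 1 \<and> card (f\<^sub>2 \<inter> f\<^sub>3) = 1"
proof -
  obtain x y z w where v: "Q = {x, y, z, w}" "distinct [x, y, z, w]"
  proof -
    have "finite Q" using Q by (metis card.infinite zero_neq_numeral)
    then obtain xs where xs: "set xs = Q" "distinct xs" using finite_distinct_list by blast
    hence "length xs = 4" using Q distinct_card by fastforce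
    then obtain x y z w where "xs = [x, y, z, w]" by (auto simp: numeral_eq_Suc length_Suc_conv)
    thus ?thesis using that xs by auto
  qed
  define M where "M R = {g R, R - g R}" for R
  \<comment> \<open>Otherwise \<open>Q\<close> could be given the free matching, completing
    \<open>g\<close> to the whole family.\<close>
  have blocked: "\<exists>R\<in>\<Q> - {Q}. \<exists>f\<in>{e, Q - e}. f \<in> M R" if e: "e \<subseteq> Q" "card e = 2" for e
  proof (rule ccontr)
    assume "\<not> ?thesis"
    hence no: "{e, Q - e} \<inter> {g R, R - g R} = {}" if "R \<in> \<Q> - {Q}" for R
      using that unfolding M_def by blast
    have "matching_choice \<Q> (g(Q := e))"
      unfolding matching_choice_def
    proof (intro conjI ballI impI)
      fix R assume "R \<in> \<Q>"
      thus "(g(Q := e)) R \<subseteq> R" "card ((g(Q := e)) R) = 2"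
        using g e by (auto simp: matching_choice_def)
    next
      fix R R' assume R: "R \<in> \<Q>" "R' \<in> \<Q>" "R \<noteq> R'"
      show "{(g(Q := e)) R, R - (g(Q := e)) R} \<inter> {(g(Q := e)) R', R' - (g(Q := e)) R'} = {}"
      proof (cases "R = Q")
        case True
        thus ?thesis using no[of R'] R by simp
      next
        case False
        show ?thesis
        proof (cases "R' = Q")
          case True
          thus ?thesis using no[of R] R False by (simp add: Int_commute)
        next
          case False': False
          have "\<forall>R\<in>\<Q> - {Q}. \<forall>R'\<in>\<Q> - {Q}. R \<noteq> R' \<longrightarrow> {g R, R - g R} \<inter> {g R', R' - g R'} = {}"
            using g unfolding matching_choice_def by blast
          hence "{g R, R - g R} \<inter> {g R', R' - g R'} = {}" using R False False' by blast
          thus ?thesis using False False' by simp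
        qed
      qed
    qed
    thus False using bad by blast
  qed
  have sub: "f \<subseteq> R" if "f \<in> M R" "R \<in> \<Q> - {Q}" for f R
    using that g unfolding M_def matching_choice_def by blast
  \<comment> \<open>The two edges of one matching are disjoint, so edges meeting in exactly one
    vertex are used by different members.\<close>
  have meet: "R \<noteq> R'" if "f \<in> M R" "f' \<in> M R'" "card (f \<inter> f') = 1" "card f = 2" for f f' R R'
  proof
    assume "R = R'"
    hence "f = f' \<or> f \<inter> f' = {}" using that(1,2) unfolding M_def by blast
    thus False using that(3,4) by auto
  qed
  \<comment> \<open>One blocked edge is taken from each of the three perfect matchings of the K_4.
    Edges from different matchings always meet in exactly one vertex.\<close>
  obtain Q\<^sub>1 f\<^sub>1 where 1: "Q\<^sub>1 \<in> \<Q> - {Q}" "f\<^sub>1 \<in> {{x, y}, {z, w}}" "f\<^sub>1 \<in> M Q\<^sub>1"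
  proof -
    have "Q - {x, y} = {z, w}" using v by auto
    thus ?thesis using blocked[of "{x, y}"] v that by auto
  qed
  obtain Q\<^sub>2 f\<^sub>2 where 2: "Q\<^sub>2 \<in> \<Q> - {Q}" "f\<^sub>2 \<in> {{x, z}, {y, w}}" "f\<^sub>2 \<in> M Q\<^sub>2"
  proof -
    have "Q - {x, z} = {y, w}" using v by auto
    thus ?thesis using blocked[of "{x, z}"] v that by auto
  qed
  obtain Q\<^sub>3 f\<^sub>3 where 3: "Q\<^sub>3 \<in> \<Q> - {Q}" "f\<^sub>3 \<in> {{x, w}, {y, z}}" "f\<^sub>3 \<in> M Q\<^sub>3"
  proof -
    have "Q - {x, w} = {y, z}" using v by auto
    thus ?thesis using blocked[of "{x, w}"] v that by auto
  qed
  have card2: "card f\<^sub>1 = 2" "card f\<^sub>2 = 2" "card f\<^sub>3 = 2" using 1(2) 2(2) 3(2) v(2) by auto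
  have inQ: "f\<^sub>1 \<subseteq> Q" "f\<^sub>2 \<subseteq> Q" "f\<^sub>3 \<subseteq> Q" using 1(2) 2(2) 3(2) v(1) by auto
  have card1: "card (f\<^sub>1 \<inter> f\<^sub>2) = 1" "card (f\<^sub>1 \<inter> f\<^sub>3) = 1" "card (f\<^sub>2 \<inter> f\<^sub>3) = 1"
    using 1(2) 2(2) 3(2) v(2) by auto
  have "distinct [Q\<^sub>1, Q\<^sub>2, Q\<^sub>3]"
    using meet[OF 1(3) 2(3) card1(1) card2(1)] meet[OF 1(3) 3(3) card1(2) card2(1)]
      meet[OF 2(3) 3(3) card1(3) card2(2)] by simp
  thus ?thesis
    using card2 card1 inQ sub[OF 1(3,1)] sub[OF 2(3,1)] sub[OF 3(3,1)]
    by (intro bexI[OF _ 1(1)] bexI[OF _ 2(1)] bexI[OF _ 3(1)]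
        exI[of _ f\<^sub>1] exI[of _ f\<^sub>2] exI[of _ f\<^sub>3] conjI Int_greatest) assumption+
qed

text \<open>At most one of the three blocking neighbours is the exception \<open>N\<^sub>0\<close>.
  The other two would both block \<open>e\<close> itself, although distinct blocked edges are
  guaranteed.\<close>

lemma not_pinned:
  assumes bad: "\<nexists>g. matching_choice \<Q> g" and g: "matching_choice (\<Q> - {Q}) g"
    and Q: "Q \<in> \<Q>" "card Q = 4" and e: "card e = 2"
    and pin: "\<And>N. N \<in> \<Q> \<Longrightarrow> N \<noteq> Q \<Longrightarrow> N \<noteq> N\<^sub>0 \<Longrightarrow> card (N \<inter> Q) \<ge> 2 \<Longrightarrow> N \<inter> Q \<subseteq> e"
  shows False
proof -
  have fine: "finite e" using e by (metis card.infinite zero_neq_numeral)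
  have finQ: "finite Q" using Q by (metis card.infinite zero_neq_numeral)
  obtain Q\<^sub>1 Q\<^sub>2 Q\<^sub>3 f\<^sub>1 f\<^sub>2 f\<^sub>3 where q: "Q\<^sub>1 \<in> \<Q> - {Q}" "Q\<^sub>2 \<in> \<Q> - {Q}" "Q\<^sub>3 \<in> \<Q> - {Q}" "distinct [Q\<^sub>1, Q\<^sub>2, Q\<^sub>3]"
    and f: "f\<^sub>1 \<subseteq> Q \<inter> Q\<^sub>1" "f\<^sub>2 \<subseteq> Q \<inter> Q\<^sub>2" "f\<^sub>3 \<subseteq> Q \<inter> Q\<^sub>3" "card f\<^sub>1 = 2" "card f\<^sub>2 = 2" "card f\<^sub>3 = 2"
      "card (f\<^sub>1 \<inter> f\<^sub>2) = 1" "card (f\<^sub>1 \<inter> f\<^sub>3) = 1" "card (f\<^sub>2 \<inter> f\<^sub>3) = 1"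
    using blocked_quad[OF bad g Q] by blast
  have eq: "f = e" if "N \<in> \<Q> - {Q}" "N \<noteq> N\<^sub>0" "f \<subseteq> Q \<inter> N" "card f = 2" for N f
  proof -
    have "card f \<le> card (N \<inter> Q)" using that(3) finQ by (intro card_mono) auto
    hence "f \<subseteq> e" using pin[of N] that by auto
    thus ?thesis using card_subset_eq[OF fine] that(4) e by auto
  qed
  have "f\<^sub>1 = f\<^sub>2 \<or> f\<^sub>1 = f\<^sub>3 \<or> f\<^sub>2 = f\<^sub>3"
    using eq[OF q(1) _ f(1,4)] eq[OF q(2) _ f(2,5)] eq[OF q(3) _ f(3,6)] q(4) by auto
  thus False using f by auto
qed

text \<open>Take a minimal bad family. A K_4 has potential 18 and each attachment costs at least 5,
  so three attachments leave at most 5 and the union is closed: every neighbour of its members lies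
  inside. One of the last two attached K_4 then meets its neighbours, with at most one exception, in
  a single edge, contradicting \<open>not_pinned\<close>. The union has at most 4 + 2 + 2 + 2 = 10
  vertices, and closedness tests one K_4 more, whence 12.\<close>

lemma matching_choice_exists:
  assumes F: "locally_sparse (7/15) 12 F" and fin: "finite \<Q>" and sub: "\<Q> \<subseteq> quads F"
  shows "\<exists>g. matching_choice \<Q> g"
  using fin sub
proof (induction \<Q> rule: finite_psubset_induct)
  case (psubset \<Q>)
  show ?case
  proof (rule ccontr)
    assume bad: "\<not> (\<exists>g. matching_choice \<Q> g)"
    have IH: "\<exists>g. matching_choice \<R> g" if "\<R> \<subset> \<Q>" for \<R>
      using psubset.IH[OF that] psubset.prems that by blast
    have quad: "Q \<in> quads F" if "Q \<in> \<Q>" for Q using that psubset.prems by blast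
    have fin: "finite Q" and c4: "card Q = 4" if "Q \<in> \<Q>" for Q
      using quads_finite[OF quad[OF that]] quads_card[OF quad[OF that]] by auto
    have minus: "\<exists>g. matching_choice (\<Q> - {Q}) g" if "Q \<in> \<Q>" for Q
      using that by (intro IH) auto
    have pinned: False if Q: "Q \<in> \<Q>" and e: "card e = 2"
      and pin: "\<And>N. N \<in> \<Q> \<Longrightarrow> N \<noteq> Q \<Longrightarrow> N \<noteq> N\<^sub>0 \<Longrightarrow> card (N \<inter> Q) \<ge> 2 \<Longrightarrow> N \<inter> Q \<subseteq> e" for Q e N\<^sub>0
    proof -
      obtain g where "matching_choice (\<Q> - {Q}) g" using minus[OF Q] by blast
      from not_pinned[OF bad this Q c4[OF Q] e pin] show False .
    qed
    have eq4: "P = Q" if "P \<in> \<Q>" "Q \<in> \<Q>" "P \<subseteq> Q" for P Q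
      using card_subset_eq[OF fin[OF that(2)] that(3)] c4 that by simp
    have attach: "potential F (S \<union> Q) \<le> potential F S - (if card (Q \<inter> S) = 2 then 5 else 6)
        - 7 * int (card ((R \<inter> Q) - S) * card ((R \<inter> S) - Q))"
      if "finite S" "Q \<in> \<Q>" "R \<in> \<Q>" "\<not> Q \<subseteq> S" "card (Q \<inter> S) \<ge> 2" for S Q R
      using potential_attach[OF that(1) quad[OF that(2)] that(4,5) quad[OF that(3)]] .
    have attach': "potential F (S \<union> Q) \<le> potential F S - (if card (Q \<inter> S) = 2 then 5 else 6)"
      if "finite S" "Q \<in> \<Q>" "\<not> Q \<subseteq> S" "card (Q \<inter> S) \<ge> 2" for S Q
    proof -
      have "0 \<le> 7 * int (card ((Q \<inter> Q) - S) * card ((Q \<inter> S) - Q))" by simp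
      thus ?thesis using attach[OF that(1,2,2,3,4)] by linarith
    qed
    \<comment> \<open>A further member inside \<open>S \<union> Q\<close> needs edges between \<open>Q - S\<close> and \<open>S - Q\<close>.\<close>
    have attach_extra: "potential F (S \<union> Q) \<le> potential F S - 5 - 7 * int k"
      if S: "finite S" and Q: "Q \<in> \<Q>" "\<not> Q \<subseteq> S" "card (Q \<inter> S) \<ge> 2"
        and R: "R \<in> \<Q>" "k \<le> card ((R \<inter> Q) - S) * card ((R \<inter> S) - Q)" for S Q R and k :: nat
    proof -
      define z where "z = card ((R \<inter> Q) - S) * card ((R \<inter> S) - Q)"
      have "int k \<le> int z" using R(2) by (simp only: z_def of_nat_le_iff)
      moreover have "potential F (S \<union> Q) \<le> potential F S - (if card (Q \<inter> S) = 2 then 5 else 6) - 7 * int z"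
        unfolding z_def by (rule attach[OF S Q(1) R(1) Q(2,3)])
      ultimately show ?thesis by (auto split: if_splits)
    qed
    have pos: "potential F T > 0" if "finite T" "T \<noteq> {}" "card T \<le> 12" for T
      using potential_pos[OF F that] .
    have closed: "N \<subseteq> T" if "finite T" "card T \<le> 10" "potential F T \<le> 5" "N \<in> \<Q>" "card (N \<inter> T) \<ge> 2" for N T
      using potential_closed[OF F that(1-3) quad[OF that(4)] that(5)] .
    have inter_ge: "card (N \<inter> T) \<ge> 2" if "f \<subseteq> N" "f \<subseteq> T" "card f = 2" "N \<in> \<Q>" for N T f
    proof -
      have "card f \<le> card (N \<inter> T)" using that fin[OF that(4)] by (intro card_mono) auto
      thus ?thesis using that by simp
    qed
    have cardUn: "card (S \<union> Q) + card (Q \<inter> S) = card S + 4" if "finite S" "Q \<in> \<Q>" for S Q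
      using card_Un_Int[OF that(1) fin[OF that(2)]] c4[OF that(2)] by (simp add: Int_commute)
    \<comment> \<open>Attaching \<open>Q\<close> costs at least 5, and a further member using new
      and old vertices brings an extra edge of cost 7. Together these exhaust a potential of at most
      12.\<close>
    have new_vertex: "R \<subseteq> S" if S: "finite S" "card S \<le> 10" "S \<noteq> {}" "potential F S \<le> 12"
      and Q: "Q \<in> \<Q>" "\<not> Q \<subseteq> S" "card (Q \<inter> S) \<ge> 2" and R: "R \<in> \<Q>" "R \<subseteq> S \<union> Q" "R \<noteq> Q" for S Q R
    proof (rule ccontr)
      assume nR: "\<not> R \<subseteq> S"
      have "\<not> R \<subseteq> Q" using eq4[OF R(1) Q(1)] R(3) by auto
      then obtain v where v: "v \<in> R" "v \<notin> Q" by auto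
      obtain u where u: "u \<in> R" "u \<notin> S" using nR by auto
      have "u \<in> (R \<inter> Q) - S" "v \<in> (R \<inter> S) - Q" using u v R(2) by auto
      hence "card ((R \<inter> Q) - S) > 0" "card ((R \<inter> S) - Q) > 0"
        using fin[OF R(1)] by (auto simp: card_gt_0_iff)
      hence "1 \<le> card ((R \<inter> Q) - S) * card ((R \<inter> S) - Q)" by (simp add: Suc_le_eq)
      from attach_extra[OF S(1) Q R(1) this] have "potential F (S \<union> Q) \<le> 0" using S(4) by simp
      moreover have "card (S \<union> Q) \<le> 12" using cardUn[OF S(1) Q(1)] S(2) Q(3) by linarith
      hence "potential F (S \<union> Q) > 0" using S fin[OF Q(1)] by (intro pos) auto
      ultimately show False by simp
    qed
    have neighbours: "\<exists>Q\<^sub>1\<in>\<Q>. \<exists>Q\<^sub>2\<in>\<Q>. \<exists>Q\<^sub>3\<in>\<Q>. \<exists>f\<^sub>1 f\<^sub>2 f\<^sub>3. distinct [Q, Q\<^sub>1, Q\<^sub>2, Q\<^sub>3] \<and>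
      f\<^sub>1 \<subseteq> Q \<inter> Q\<^sub>1 \<and> f\<^sub>2 \<subseteq> Q \<inter> Q\<^sub>2 \<and> f\<^sub>3 \<subseteq> Q \<inter> Q\<^sub>3 \<and> card f\<^sub>1 = 2 \<and> card f\<^sub>2 = 2 \<and> card f\<^sub>3 = 2 \<and>
      card (f\<^sub>1 \<inter> f\<^sub>2) = 1 \<and> card (f\<^sub>1 \<inter> f\<^sub>3) = 1 \<and> card (f\<^sub>2 \<inter> f\<^sub>3) = 1" if Q: "Q \<in> \<Q>" for Q
    proof -
      obtain g where "matching_choice (\<Q> - {Q}) g" using minus[OF Q] by blast
      from blocked_quad[OF bad this Q c4[OF Q]]
      obtain Q\<^sub>1 Q\<^sub>2 Q\<^sub>3 f\<^sub>1 f\<^sub>2 f\<^sub>3 where q: "Q\<^sub>1 \<in> \<Q> - {Q}" "Q\<^sub>2 \<in> \<Q> - {Q}" "Q\<^sub>3 \<in> \<Q> - {Q}"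
        "distinct [Q\<^sub>1, Q\<^sub>2, Q\<^sub>3]"
        and f: "f\<^sub>1 \<subseteq> Q \<inter> Q\<^sub>1 \<and> f\<^sub>2 \<subseteq> Q \<inter> Q\<^sub>2 \<and> f\<^sub>3 \<subseteq> Q \<inter> Q\<^sub>3 \<and> card f\<^sub>1 = 2 \<and> card f\<^sub>2 = 2 \<and> card f\<^sub>3 = 2 \<and>
          card (f\<^sub>1 \<inter> f\<^sub>2) = 1 \<and> card (f\<^sub>1 \<inter> f\<^sub>3) = 1 \<and> card (f\<^sub>2 \<inter> f\<^sub>3) = 1"
        by blast
      have "distinct [Q, Q\<^sub>1, Q\<^sub>2, Q\<^sub>3]" using q by auto
      with f q show ?thesis by blast
    qed
    show False
    \<comment> \<open>Growth starts either from two members that share a triangle or, if no such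
      pair exists, from one member and its three neighbours.\<close>
    proof (cases "\<exists>Q\<in>\<Q>. \<exists>P\<in>\<Q>. Q \<noteq> P \<and> card (Q \<inter> P) > 2")
      case True
      then obtain Q P where QP: "Q \<in> \<Q>" "P \<in> \<Q>" "Q \<noteq> P" "card (Q \<inter> P) > 2" by blast
      define S where "S = Q \<union> P"
      have finS: "finite S" using fin QP by (simp add: S_def)
      have S0: "S \<noteq> {}" using c4[OF QP(1)] by (auto simp: S_def)
      have nPQ: "\<not> P \<subseteq> Q" using eq4[OF QP(2,1)] QP(3) by auto
      have "card (P \<inter> Q) < card P" using nPQ fin[OF QP(2)] by (intro psubset_card_mono) auto
      hence i3: "card (P \<inter> Q) = 3" using QP(4) c4[OF QP(2)] by (simp add: Int_commute)
      have cS: "card S = 5" using cardUn[OF fin[OF QP(1)] QP(2)] i3 c4[OF QP(1)] by (simp add: S_def)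
      have pS: "potential F S \<le> 12"
        using attach'[OF fin[OF QP(1)] QP(2) nPQ] i3 potential_quad[OF quad[OF QP(1)]] by (simp add: S_def)
      show False
      \<comment> \<open>The five vertices span 9 or 10 edges, with potential 12 or 5, so this asks
        whether they form a K_5.\<close>
      proof (cases "potential F S \<le> 5")
        case True
        define \<Q>\<^sub>1 where "\<Q>\<^sub>1 = {N\<in>\<Q>. N \<subseteq> S}"
        obtain g\<^sub>1 where g1: "matching_choice \<Q>\<^sub>1 g\<^sub>1"
          using matching_choice_K5[OF cS, of \<Q>\<^sub>1] c4 by (auto simp: \<Q>\<^sub>1_def)
        have "Q \<in> \<Q>\<^sub>1" using QP by (auto simp: \<Q>\<^sub>1_def S_def)
        hence "\<Q> - \<Q>\<^sub>1 \<subset> \<Q>" using QP by auto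
        then obtain g\<^sub>2 where g2: "matching_choice (\<Q> - \<Q>\<^sub>1) g\<^sub>2" using IH by blast
        define g where "g N = (if N \<subseteq> S then g\<^sub>1 N else g\<^sub>2 N)" for N
        \<comment> \<open>A K_5 is closed, so members outside it share no edge with it. The pentagon
          choice inside and the inductive choice outside can be combined.\<close>
        have cl: "card (N \<inter> S) < 2" if "N \<in> \<Q> - \<Q>\<^sub>1" for N
          using closed[OF finS _ True, of N] cS that by (fastforce simp: \<Q>\<^sub>1_def)
        have sub2: "e \<subseteq> N \<and> card e = 2" if "N \<in> \<Q>" "g N \<subseteq> N" "card (g N) = 2" "e \<in> {g N, N - g N}" for N e
          using that c4[OF that(1)] fin[OF that(1)] by (auto simp: card_Diff_subset finite_subset)
        have val: "g N \<subseteq> N" "card (g N) = 2" if "N \<in> \<Q>" for N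
          using g1 g2 that unfolding matching_choice_def g_def \<Q>\<^sub>1_def by auto
        have cross: "{g N, N - g N} \<inter> {g M, M - g M} = {}" if N: "N \<in> \<Q>\<^sub>1" and M: "M \<in> \<Q> - \<Q>\<^sub>1" for N M
        proof (rule ccontr)
          assume "\<not> ?thesis"
          then obtain e where e: "e \<in> {g N, N - g N}" "e \<in> {g M, M - g M}" by blast
          have NM: "N \<in> \<Q>" "N \<subseteq> S" "M \<in> \<Q>" using N M by (auto simp: \<Q>\<^sub>1_def)
          have "e \<subseteq> N" using sub2[OF NM(1) val[OF NM(1)] e(1)] by simp
          moreover have "e \<subseteq> M" "card e = 2" using sub2[OF NM(3) val[OF NM(3)] e(2)] by simp_all
          ultimately have "card (M \<inter> S) \<ge> 2" using NM by (intro inter_ge) auto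
          thus False using cl[OF M] by simp
        qed
        have "matching_choice \<Q> g"
          unfolding matching_choice_def
        proof (intro conjI ballI impI)
          fix N M assume NM: "N \<in> \<Q>" "M \<in> \<Q>" "N \<noteq> M"
          consider "N \<in> \<Q>\<^sub>1" "M \<in> \<Q>\<^sub>1" | "N \<in> \<Q>\<^sub>1" "M \<in> \<Q> - \<Q>\<^sub>1" | "N \<in> \<Q> - \<Q>\<^sub>1" "M \<in> \<Q>\<^sub>1"
            | "N \<in> \<Q> - \<Q>\<^sub>1" "M \<in> \<Q> - \<Q>\<^sub>1" using NM by blast
          thus "{g N, N - g N} \<inter> {g M, M - g M} = {}"
          proof cases
            case 1
            hence "g N = g\<^sub>1 N" "g M = g\<^sub>1 M" by (auto simp: g_def \<Q>\<^sub>1_def)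
            thus ?thesis using g1 1 NM(3) unfolding matching_choice_def by (simp only:) blast
          next
            case 2
            thus ?thesis by (rule cross)
          next
            case 3
            thus ?thesis using cross[of M N] by (simp add: Int_commute)
          next
            case 4
            hence "g N = g\<^sub>2 N" "g M = g\<^sub>2 M" by (auto simp: g_def \<Q>\<^sub>1_def)
            thus ?thesis using g2 4 NM(3) unfolding matching_choice_def by (simp only:) blast
          qed
        qed (use val in auto)
        thus False using bad by blast
      next
        case False
        have inS: "R = Q \<or> R = P" if R: "R \<in> \<Q>" "R \<subseteq> S" for R
        proof (rule ccontr)
          assume nR: "\<not> (R = Q \<or> R = P)"
          have "\<not> R \<subseteq> P" "\<not> R \<subseteq> Q" using eq4[OF R(1)] QP nR by auto
          then obtain u v where "u \<in> (R \<inter> P) - Q" "v \<in> (R \<inter> Q) - P" using R(2) unfolding S_def by blast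
          hence "card ((R \<inter> P) - Q) > 0" "card ((R \<inter> Q) - P) > 0"
            using fin[OF R(1)] by (auto simp: card_gt_0_iff)
          moreover define z where "z = card ((R \<inter> P) - Q) * card ((R \<inter> Q) - P)"
          ultimately have "0 < z" by simp
          hence "1 \<le> int z" by simp
          moreover have "potential F S \<le> potential F Q - (if card (P \<inter> Q) = 2 then 5 else 6) - 7 * int z"
            unfolding z_def S_def using i3 by (intro attach fin QP R nPQ) simp
          ultimately have "potential F S \<le> 5"
            using i3 potential_quad[OF quad[OF QP(1)]] by simp
          thus False using False by simp
        qed
        have "\<exists>P\<^sub>1\<in>\<Q>. \<exists>P\<^sub>2\<in>\<Q>. P\<^sub>1 \<noteq> P\<^sub>2 \<and> P\<^sub>1 \<notin> {Q, P} \<and> P\<^sub>2 \<notin> {Q, P} \<and> card (P\<^sub>1 \<inter> Q) \<ge> 2 \<and> card (P\<^sub>2 \<inter> Q) \<ge> 2"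
        \<comment> \<open>At most one of the three neighbours of \<open>Q\<close> is
          \<open>P\<close>, so two others remain.\<close>
        proof -
          obtain Q\<^sub>1 Q\<^sub>2 Q\<^sub>3 f\<^sub>1 f\<^sub>2 f\<^sub>3 where q: "Q\<^sub>1 \<in> \<Q>" "Q\<^sub>2 \<in> \<Q>" "Q\<^sub>3 \<in> \<Q>" "distinct [Q, Q\<^sub>1, Q\<^sub>2, Q\<^sub>3]"
            and f: "f\<^sub>1 \<subseteq> Q \<inter> Q\<^sub>1" "f\<^sub>2 \<subseteq> Q \<inter> Q\<^sub>2" "f\<^sub>3 \<subseteq> Q \<inter> Q\<^sub>3" "card f\<^sub>1 = 2" "card f\<^sub>2 = 2" "card f\<^sub>3 = 2"
            using neighbours[OF QP(1)] by blast
          have "card (Q\<^sub>1 \<inter> Q) \<ge> 2" "card (Q\<^sub>2 \<inter> Q) \<ge> 2" "card (Q\<^sub>3 \<inter> Q) \<ge> 2"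
            using f q inter_ge[of f\<^sub>1 Q\<^sub>1 Q] inter_ge[of f\<^sub>2 Q\<^sub>2 Q] inter_ge[of f\<^sub>3 Q\<^sub>3 Q] by auto
          moreover have "P \<noteq> Q\<^sub>1 \<and> P \<noteq> Q\<^sub>2 \<or> P \<noteq> Q\<^sub>1 \<and> P \<noteq> Q\<^sub>3 \<or> P \<noteq> Q\<^sub>2 \<and> P \<noteq> Q\<^sub>3"
            using q(4) by auto
          moreover have "Q\<^sub>1 \<noteq> Q" "Q\<^sub>2 \<noteq> Q" "Q\<^sub>3 \<noteq> Q" "Q\<^sub>1 \<noteq> Q\<^sub>2" "Q\<^sub>1 \<noteq> Q\<^sub>3" "Q\<^sub>2 \<noteq> Q\<^sub>3" using q(4) by auto
          ultimately show ?thesis using q(1-3) by (metis insertE singletonD)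
        qed
        then obtain P\<^sub>1 P\<^sub>2 where P: "P\<^sub>1 \<in> \<Q>" "P\<^sub>2 \<in> \<Q>" "P\<^sub>1 \<noteq> P\<^sub>2" "P\<^sub>1 \<notin> {Q, P}" "P\<^sub>2 \<notin> {Q, P}"
          "card (P\<^sub>1 \<inter> Q) \<ge> 2" "card (P\<^sub>2 \<inter> Q) \<ge> 2" by blast
        have more: "card (N \<inter> U) \<ge> 2" if "card (N \<inter> Q) \<ge> 2" "Q \<subseteq> U" "N \<in> \<Q>" for N U
        proof -
          have "card (N \<inter> Q) \<le> card (N \<inter> U)" using that fin[OF that(3)] by (intro card_mono) auto
          thus ?thesis using that by simp
        qed
        define T where "T = S \<union> P\<^sub>1"
        have QS: "Q \<subseteq> S" "S \<subseteq> T" by (auto simp: S_def T_def)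
        have n1: "\<not> P\<^sub>1 \<subseteq> S" and n2S: "\<not> P\<^sub>2 \<subseteq> S" using inS P by auto
        have i1: "card (P\<^sub>1 \<inter> S) \<ge> 2" using more[OF P(6) QS(1) P(1)] .
        have finT: "finite T" using finS fin P by (simp add: T_def)
        have cT: "card T \<le> 7" using cardUn[OF finS P(1)] i1 cS by (simp add: T_def)
        have T0: "T \<noteq> {}" using S0 by (simp add: T_def)
        have pT: "potential F T \<le> potential F S - (if card (P\<^sub>1 \<inter> S) = 2 then 5 else 6)"
          using attach'[OF finS P(1) n1 i1] by (simp add: T_def)
        have inT: "R \<subseteq> S" if "R \<in> \<Q>" "R \<subseteq> T" "R \<noteq> P\<^sub>1" for R
          using new_vertex[OF finS _ S0 pS P(1) n1 i1 that(1) _ that(3)] that(2) cS by (simp add: T_def)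
        have n2: "\<not> P\<^sub>2 \<subseteq> T" using inT[OF P(2)] n2S P(3) by auto
        have i2: "card (P\<^sub>2 \<inter> T) \<ge> 2" using more[OF P(7) _ P(2)] QS by blast
        define U where "U = T \<union> P\<^sub>2"
        have finU: "finite U" using finT fin P by (simp add: U_def)
        have cU: "card U \<le> 9" using cardUn[OF finT P(2)] i2 cT by (simp add: U_def)
        have U0: "U \<noteq> {}" using T0 by (simp add: U_def)
        have pU: "potential F U \<le> potential F T - (if card (P\<^sub>2 \<inter> T) = 2 then 5 else 6)"
          using attach'[OF finT P(2) n2 i2] by (simp add: U_def)
        \<comment> \<open>From 12 at the start, two attachments leave at most 2.\<close>
        have pU5: "potential F U \<le> 5" using pU pT pS by (auto split: if_splits)
        have inU: "R \<subseteq> T" if "R \<in> \<Q>" "R \<subseteq> U" "R \<noteq> P\<^sub>2" for R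
          using new_vertex[OF finT _ T0 _ P(2) n2 i2 that(1) _ that(3)] that(2) cT pT pS
          by (auto simp: U_def split: if_splits)
        have nbU: "N \<subseteq> U" if "N \<in> \<Q>" "R \<subseteq> U" "card (N \<inter> R) \<ge> 2" for N R
        proof -
          have "card (N \<inter> R) \<le> card (N \<inter> U)" using that fin[OF that(1)] by (intro card_mono) auto
          thus ?thesis using closed[OF finU _ pU5 that(1)] cU that(3) by linarith
        qed
        have sub: "P\<^sub>1 \<subseteq> U" "P\<^sub>2 \<subseteq> U" by (auto simp: U_def T_def)
        show False
        \<comment> \<open>If the last member meets the earlier ones in just an edge, that edge pins
          it, because all its neighbours lie in \<open>T\<close>.\<close>
        proof (cases "card (P\<^sub>2 \<inter> T) = 2")
          case True
          show False
          proof (rule pinned[OF P(2) True])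
            fix N assume "N \<in> \<Q>" "N \<noteq> P\<^sub>2" "card (N \<inter> P\<^sub>2) \<ge> 2"
            thus "N \<inter> P\<^sub>2 \<subseteq> P\<^sub>2 \<inter> T" using inU[of N] nbU[OF _ sub(2)] by blast
          qed
        next
          case False
          \<comment> \<open>Sharing a triangle in both attachments would cost 6 + 6 and exhaust the
            potential 12. So the earlier member is pinned, with the last one as the permitted
            exception.\<close>
          have c2: "card (P\<^sub>1 \<inter> S) = 2"
          proof (rule ccontr)
            assume "card (P\<^sub>1 \<inter> S) \<noteq> 2"
            hence "potential F U \<le> 0" using pU pT pS False by simp
            moreover have "potential F U > 0" using finU U0 cU by (intro pos) auto
            ultimately show False by simp
          qed
          show False
          proof (rule pinned[OF P(1) c2])
            fix N assume "N \<in> \<Q>" "N \<noteq> P\<^sub>1" "N \<noteq> P\<^sub>2" "card (N \<inter> P\<^sub>1) \<ge> 2"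
            thus "N \<inter> P\<^sub>1 \<subseteq> P\<^sub>1 \<inter> S" using inT[of N] inU[of N] nbU[OF _ sub(1)] by blast
          qed
        qed
      qed
    next
      case False
      hence le2: "card (Q \<inter> P) \<le> 2" if "Q \<in> \<Q>" "P \<in> \<Q>" "Q \<noteq> P" for Q P
        using that by (meson not_less)
      have "\<Q> \<noteq> {}" using bad by (auto simp: matching_choice_def)
      then obtain Q where Q: "Q \<in> \<Q>" by blast
      obtain Q\<^sub>1 Q\<^sub>2 Q\<^sub>3 f\<^sub>1 f\<^sub>2 f\<^sub>3 where q: "Q\<^sub>1 \<in> \<Q>" "Q\<^sub>2 \<in> \<Q>" "Q\<^sub>3 \<in> \<Q>" "distinct [Q, Q\<^sub>1, Q\<^sub>2, Q\<^sub>3]"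
        and f: "f\<^sub>1 \<subseteq> Q \<inter> Q\<^sub>1" "f\<^sub>2 \<subseteq> Q \<inter> Q\<^sub>2" "f\<^sub>3 \<subseteq> Q \<inter> Q\<^sub>3" "card f\<^sub>1 = 2" "card f\<^sub>2 = 2" "card f\<^sub>3 = 2"
          "card (f\<^sub>1 \<inter> f\<^sub>2) = 1" "card (f\<^sub>1 \<inter> f\<^sub>3) = 1" "card (f\<^sub>2 \<inter> f\<^sub>3) = 1"
        using neighbours[OF Q] by blast
      have ne: "Q\<^sub>1 \<noteq> Q" "Q\<^sub>2 \<noteq> Q" "Q\<^sub>3 \<noteq> Q" "Q\<^sub>1 \<noteq> Q\<^sub>2" "Q\<^sub>1 \<noteq> Q\<^sub>3" "Q\<^sub>2 \<noteq> Q\<^sub>3" using q(4) by auto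
      have inter_eq: "f = Q \<inter> N" if "N \<in> \<Q>" "N \<noteq> Q" "f \<subseteq> Q \<inter> N" "card f = 2" for N f
        using le2[OF Q that(1)] that fin[OF Q] card_seteq[of "Q \<inter> N" f] by auto
      have fe: "f\<^sub>1 = Q \<inter> Q\<^sub>1" "f\<^sub>2 = Q \<inter> Q\<^sub>2" "f\<^sub>3 = Q \<inter> Q\<^sub>3"
        using inter_eq q ne f by blast+
      have out: "card (R \<inter> S - P) \<ge> 2" if "R \<in> \<Q>" "P \<in> \<Q>" "R \<noteq> P" "R \<subseteq> S \<union> P" for R P S
      proof -
        have "R \<inter> S - P = R - (R \<inter> P)" using that(4) by auto
        moreover have "card (R - (R \<inter> P)) = 4 - card (R \<inter> P)"
          using fin[OF that(1)] c4[OF that(1)] by (subst card_Diff_subset) auto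
        ultimately show ?thesis using le2[OF that(1-3)] by simp
      qed
      define S where "S = Q \<union> Q\<^sub>1"
      have n1: "\<not> Q\<^sub>1 \<subseteq> Q" using eq4[OF q(1) Q] ne by auto
      have i1: "card (Q\<^sub>1 \<inter> Q) \<ge> 2" using f(1) by (intro inter_ge[OF _ _ f(4) q(1)]) auto
      have finS: "finite S" using fin Q q by (simp add: S_def)
      have S0: "S \<noteq> {}" using c4[OF Q] by (auto simp: S_def)
      have cS: "card S \<le> 6" using cardUn[OF fin[OF Q] q(1)] i1 c4[OF Q] by (simp add: S_def)
      have pS: "potential F S \<le> 13"
        using attach'[OF fin[OF Q] q(1) n1 i1] potential_quad[OF quad[OF Q]] by (simp add: S_def split: if_splits)
      have pS_extra: "potential F S \<le> 13 - 7 * int k" if "R \<in> \<Q>" "k \<le> card ((R \<inter> Q\<^sub>1) - Q) * card ((R \<inter> Q) - Q\<^sub>1)" for R and k :: nat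
        using attach_extra[OF fin[OF Q] q(1) n1 i1 that] potential_quad[OF quad[OF Q]] by (simp add: S_def)
      have inS: "R = Q \<or> R = Q\<^sub>1" if R: "R \<in> \<Q>" "R \<subseteq> S" for R
      proof (rule ccontr)
        assume nR: "\<not> (R = Q \<or> R = Q\<^sub>1)"
        have "card ((R \<inter> Q\<^sub>1) - Q) \<ge> 2" using out[of R Q Q\<^sub>1] R Q nR by (auto simp: S_def)
        moreover have "card ((R \<inter> Q) - Q\<^sub>1) \<ge> 2" using out[of R Q\<^sub>1 Q] R q(1) nR by (auto simp: S_def)
        \<comment> \<open>At least four extra edges would cost 28, against a potential of at most
          13.\<close>
        ultimately have "2 * 2 \<le> card ((R \<inter> Q\<^sub>1) - Q) * card ((R \<inter> Q) - Q\<^sub>1)" by (intro mult_le_mono)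
        from pS_extra[OF R(1) this] have "potential F S \<le> 0" by simp
        moreover have "potential F S > 0" using finS S0 cS by (intro pos) auto
        ultimately show False by simp
      qed
      define T where "T = S \<union> Q\<^sub>2"
      have n2: "\<not> Q\<^sub>2 \<subseteq> S" using inS[OF q(2)] ne by auto
      have i2: "card (Q\<^sub>2 \<inter> S) \<ge> 2" using f(2) by (intro inter_ge[OF _ _ f(5) q(2)]) (auto simp: S_def)
      have finT: "finite T" using finS fin q by (simp add: T_def)
      have T0: "T \<noteq> {}" using S0 by (simp add: T_def)
      have cT: "card T \<le> 8" using cardUn[OF finS q(2)] i2 cS by (simp add: T_def)
      have pT: "potential F T \<le> potential F S - 5"
        using attach'[OF finS q(2) n2 i2] by (simp add: T_def split: if_splits)
      have pT_extra: "potential F T \<le> potential F S - 5 - 7 * int k" if "R \<in> \<Q>" "k \<le> card ((R \<inter> Q\<^sub>2) - S) * card ((R \<inter> S) - Q\<^sub>2)" for R and k :: nat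
        using attach_extra[OF finS q(2) n2 i2 that] by (simp add: T_def)
      have posT: "potential F T > 0" using finT T0 cT by (intro pos) auto
      have card_pos: "card X > 0" if "x \<in> X" "X \<subseteq> R" "R \<in> \<Q>" for x X R
        using that fin[OF that(3)] by (auto simp: card_gt_0_iff dest: finite_subset)
      have inT: "R \<subseteq> S \<or> R = Q\<^sub>2" if R: "R \<in> \<Q>" "R \<subseteq> T" for R
      proof (rule ccontr)
        assume nR: "\<not> (R \<subseteq> S \<or> R = Q\<^sub>2)"
        then obtain u where "u \<in> (R \<inter> Q\<^sub>2) - S" using R(2) unfolding T_def by blast
        hence "card ((R \<inter> Q\<^sub>2) - S) \<ge> 1"
            using card_pos[of u "(R \<inter> Q\<^sub>2) - S" "R"] R(1) by (auto simp: Suc_le_eq)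
        moreover have "card ((R \<inter> S) - Q\<^sub>2) \<ge> 2" using out[of R Q\<^sub>2 S] R q(2) nR by (auto simp: T_def)
        \<comment> \<open>Two extra edges cost 14, while 13 - 5 = 8 is all that remains after
          attaching.\<close>
        ultimately have "1 * 2 \<le> card ((R \<inter> Q\<^sub>2) - S) * card ((R \<inter> S) - Q\<^sub>2)" by (intro mult_le_mono)
        from pT_extra[OF R(1) this] pS posT show False by simp
      qed
      define U where "U = T \<union> Q\<^sub>3"
      have n3: "\<not> Q\<^sub>3 \<subseteq> T" using inT[OF q(3)] inS[OF q(3)] ne by auto
      have i3: "card (Q\<^sub>3 \<inter> T) \<ge> 2" using f(3) by (intro inter_ge[OF _ _ f(6) q(3)]) (auto simp: S_def T_def)
      have finU: "finite U" using finT fin q by (simp add: U_def)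
      have U0: "U \<noteq> {}" using T0 by (simp add: U_def)
      have cU: "card U \<le> 10" using cardUn[OF finT q(3)] i3 cT by (simp add: U_def)
      have pU: "potential F U \<le> potential F T - 5"
        using attach'[OF finT q(3) n3 i3] by (simp add: U_def split: if_splits)
      have posU: "potential F U > 0" using finU U0 cU by (intro pos) auto
      have pU5: "potential F U \<le> 5" using pU pT pS by simp
      have "f\<^sub>3 \<noteq> f\<^sub>1" "f\<^sub>3 \<noteq> f\<^sub>2" using f by auto
      hence nf: "\<not> f\<^sub>3 \<subseteq> f\<^sub>1" "\<not> f\<^sub>3 \<subseteq> f\<^sub>2"
        using card_subset_eq[of f\<^sub>1 f\<^sub>3] card_subset_eq[of f\<^sub>2 f\<^sub>3] f fin[OF Q] fe by auto
      have "Q\<^sub>3 \<inter> T \<subseteq> f\<^sub>3"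
      \<comment> \<open>A further common vertex would yield one edge beyond the three attachments,
        and 18 - 5 - 5 - 5 - 7 is negative. The other end of that edge exists because the shared
        edges are distinct.\<close>
      proof (rule ccontr)
        assume "\<not> Q\<^sub>3 \<inter> T \<subseteq> f\<^sub>3"
        then obtain t where t: "t \<in> Q\<^sub>3" "t \<in> T" "t \<notin> Q" unfolding fe by blast
        show False
        proof (cases "t \<in> S")
          case True
          hence "t \<in> (Q\<^sub>3 \<inter> Q\<^sub>1) - Q" using t by (auto simp: S_def)
          hence "card ((Q\<^sub>3 \<inter> Q\<^sub>1) - Q) \<ge> 1"
            using card_pos[of t "(Q\<^sub>3 \<inter> Q\<^sub>1) - Q" "Q\<^sub>3"] q(3) by (auto simp: Suc_le_eq)
          moreover obtain v where "v \<in> (Q\<^sub>3 \<inter> Q) - Q\<^sub>1" using nf(1) unfolding fe by blast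
          hence "card ((Q\<^sub>3 \<inter> Q) - Q\<^sub>1) \<ge> 1"
            using card_pos[of v "(Q\<^sub>3 \<inter> Q) - Q\<^sub>1" "Q\<^sub>3"] q(3) by (auto simp: Suc_le_eq)
          ultimately have "1 * 1 \<le> card ((Q\<^sub>3 \<inter> Q\<^sub>1) - Q) * card ((Q\<^sub>3 \<inter> Q) - Q\<^sub>1)" by (intro mult_le_mono)
          from pS_extra[OF q(3) this] pT pU posU show False by simp
        next
          case False
          hence "t \<in> (Q\<^sub>3 \<inter> Q\<^sub>2) - S" using t by (auto simp: T_def)
          hence "card ((Q\<^sub>3 \<inter> Q\<^sub>2) - S) \<ge> 1"
            using card_pos[of t "(Q\<^sub>3 \<inter> Q\<^sub>2) - S" "Q\<^sub>3"] q(3) by (auto simp: Suc_le_eq)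
          moreover obtain v where "v \<in> (Q\<^sub>3 \<inter> S) - Q\<^sub>2" using nf(2) unfolding fe S_def by blast
          hence "card ((Q\<^sub>3 \<inter> S) - Q\<^sub>2) \<ge> 1"
            using card_pos[of v "(Q\<^sub>3 \<inter> S) - Q\<^sub>2" "Q\<^sub>3"] q(3) by (auto simp: Suc_le_eq)
          ultimately have "1 * 1 \<le> card ((Q\<^sub>3 \<inter> Q\<^sub>2) - S) * card ((Q\<^sub>3 \<inter> S) - Q\<^sub>2)" by (intro mult_le_mono)
          from pT_extra[OF q(3) this] pS pU posU show False by simp
        qed
      qed
      show False
      proof (rule pinned[OF q(3) f(6)])
        fix N assume N: "N \<in> \<Q>" "N \<noteq> Q\<^sub>3" "card (N \<inter> Q\<^sub>3) \<ge> 2"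
        have "card (N \<inter> Q\<^sub>3) \<le> card (N \<inter> U)" using fin[OF N(1)] by (intro card_mono) (auto simp: U_def)
        hence "N \<subseteq> U" using closed[OF finU cU pU5 N(1)] N(3) by linarith
        hence "N \<subseteq> T"
          using new_vertex[OF finT _ T0 _ q(3) n3 i3 N(1) _ N(2)] cT pT pS by (simp add: U_def)
        thus "N \<inter> Q\<^sub>3 \<subseteq> f\<^sub>3" using \<open>Q\<^sub>3 \<inter> T \<subseteq> f\<^sub>3\<close> by blast
      qed
    qed
  qed
qed

lemma zero_statement_K7:
  assumes "d \<le> 1/2" "\<And>n. 0 \<le> p n \<and> p n \<le> 1" "(\<lambda>n. p n / real n powr (-7/15)) \<longlonglongrightarrow> 0"
  shows "\<exists>G. (\<forall>n. G n \<in> dense_family d n) \<and> (\<lambda>n. rbw_prob n (G n) (p n) 7) \<longlonglongrightarrow> 0"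
proof (rule zero_statement_bipartite)
  show "(\<lambda>n. p n / real n powr (- (7/15))) \<longlonglongrightarrow> 0" using assms(3) by simp
  fix n F assume F: "F \<subseteq> all_edges n" "locally_sparse (7/15) 12 F"
  have finF: "finite F" using F(1) finite_all_edges finite_subset by blast
  have "quads F \<subseteq> Pow {..<n}"
  proof
    fix Q assume Q: "Q \<in> quads F"
    have "x < n" if "x \<in> Q" for x
    proof -
      have "\<not> Q \<subseteq> {x}" using quads_card[OF Q] card_mono[of "{x}" Q] by auto
      then obtain y where "y \<in> Q" "x \<noteq> y" using that by blast
      hence "{x, y} \<in> all_edges n" using quads_edge[OF Q that] F(1) by blast
      thus ?thesis by (auto simp: all_edges_eq clique_edges_eq)
    qed
    thus "Q \<in> Pow {..<n}" by auto
  qed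
  hence fin: "finite (quads F)" by (rule finite_subset) auto
  obtain c where "proper_colouring F c" "\<not> has_rainbow_clique F c 4"
    using matching_choice_exists[OF F(2) fin] colouring_of_matching_choice[OF finF fin] by blast
  thus "\<not> rbw_arrow (balanced_bipartite n \<union> F) 7"
    using not_arrow_odd_clique[OF F(1), of c 4] by simp
qed (use assms in auto)

section \<open>Four-vertex trees and rainbow \<open>K\<^sub>4\<close>\<close>

text \<open>Every tree on at most four vertices lies in the star with centre 0 and leaves 1, 2, 3 or in the
  path 4, 5, 6, 7. The first table colours the edges inside a tree (9 marks a non-edge), the second
  the edges between a tree on one side and a tree on the other side; it was found by solving for
  property \<open>gadget_not_rainbow\<close>. With a star of four leaves no such table exists.\<close>

definition gadget_inner :: "nat \<Rightarrow> nat \<Rightarrow> nat" where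
  "gadget_inner i j =
    [[9, 0, 1, 2, 9, 9, 9, 9],
     [0, 9, 9, 9, 9, 9, 9, 9],
     [1, 9, 9, 9, 9, 9, 9, 9],
     [2, 9, 9, 9, 9, 9, 9, 9],
     [9, 9, 9, 9, 9, 0, 9, 9],
     [9, 9, 9, 9, 0, 9, 1, 9],
     [9, 9, 9, 9, 9, 1, 9, 0],
     [9, 9, 9, 9, 9, 9, 0, 9]] ! i ! j"

definition gadget_cross :: "nat \<Rightarrow> nat \<Rightarrow> nat" where
  "gadget_cross i j =
    [[0, 1, 2, 3, 0, 1, 2, 3],
     [3, 2, 0, 1, 2, 3, 1, 0],
     [1, 3, 4, 0, 3, 0, 4, 2],
     [2, 0, 1, 4, 1, 2, 3, 4],
     [0, 2, 3, 1, 0, 1, 2, 3],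
     [1, 3, 0, 2, 1, 2, 3, 0],
     [2, 1, 4, 3, 2, 3, 0, 1],
     [3, 0, 2, 4, 3, 0, 1, 2]] ! i ! j"

definition gadget_edges :: "(nat \<times> nat) list" where
  "gadget_edges = [(0, 1), (0, 2), (0, 3), (1, 0), (2, 0), (3, 0),
     (4, 5), (5, 6), (6, 7), (5, 4), (6, 5), (7, 6)]"

definition gadget_adj :: "nat \<Rightarrow> nat \<Rightarrow> bool" where
  "gadget_adj i j \<longleftrightarrow> (i, j) \<in> set gadget_edges"

lemma gadget_inner_less: "gadget_adj i j \<Longrightarrow> gadget_inner i j < 3"
  and gadget_inner_sym: "gadget_adj i j \<Longrightarrow> gadget_inner j i = gadget_inner i j"
proof -
  have "\<forall>(i, j)\<in>set gadget_edges. gadget_inner i j < 3 \<and> gadget_inner j i = gadget_inner i j"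
    by code_simp
  thus "gadget_adj i j \<Longrightarrow> gadget_inner i j < 3" "gadget_adj i j \<Longrightarrow> gadget_inner j i = gadget_inner i j"
    unfolding gadget_adj_def by fast+
qed

lemma gadget_inner_inj:
  assumes "gadget_adj i j" "gadget_adj i k" "gadget_inner i j = gadget_inner i k"
  shows "j = k"
proof -
  have "\<forall>(i, j)\<in>set gadget_edges. \<forall>(i', k)\<in>set gadget_edges.
      i = i' \<longrightarrow> gadget_inner i j = gadget_inner i' k \<longrightarrow> j = k"
    by code_simp
  thus ?thesis using assms unfolding gadget_adj_def by fast
qed

text \<open>A proper colouring of K_4 can repeat a colour only on opposite edges. The three
  alternatives are the three opposite pairs: the two tree edges, and the two pairs of cross
  edges.\<close>

lemma gadget_not_rainbow:
  assumes "gadget_adj i j" "gadget_adj k l"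
  shows "gadget_inner i j = gadget_inner k l \<or> gadget_cross i k = gadget_cross j l \<or>
    gadget_cross i l = gadget_cross j k"
proof -
  have "\<forall>(i, j)\<in>set gadget_edges. \<forall>(k, l)\<in>set gadget_edges.
      gadget_inner i j = gadget_inner k l \<or> gadget_cross i k = gadget_cross j l \<or>
      gadget_cross i l = gadget_cross j k"
    by code_simp
  thus ?thesis using assms unfolding gadget_adj_def by fast
qed

text \<open>Properness is required only along one row or column within a single shape, since one
  tree never uses vertices of both; hence \<open>div 4\<close>.\<close>

lemma gadget_cross_inj:
  assumes "i < 8" "j < 8" "k < 8" "j div 4 = k div 4"
  shows "gadget_cross i j = gadget_cross i k \<Longrightarrow> j = k" "gadget_cross j i = gadget_cross k i \<Longrightarrow> j = k"
proof -
  have "\<forall>i\<in>set [0..<8]. \<forall>j\<in>set [0..<8]. \<forall>k\<in>set [0..<8]. j div 4 = k div 4 \<longrightarrow>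
      (gadget_cross i j = gadget_cross i k \<longrightarrow> j = k) \<and> (gadget_cross j i = gadget_cross k i \<longrightarrow> j = k)"
    by code_simp
  thus "gadget_cross i j = gadget_cross i k \<Longrightarrow> j = k" "gadget_cross j i = gadget_cross k i \<Longrightarrow> j = k"
    using assms by auto
qed

text \<open>A placement of a component into one shape, \<open>div 4\<close> telling the star from
  the path. Edges need only map to gadget edges, so subforests of the shapes qualify.\<close>

definition block_state :: "nat set \<Rightarrow> nat set set \<Rightarrow> (nat \<Rightarrow> nat) \<Rightarrow> bool" where
  "block_state C H \<sigma> \<longleftrightarrow> inj_on \<sigma> C \<and> (\<forall>x\<in>C. \<sigma> x < 8) \<and> (\<forall>x\<in>C. \<forall>y\<in>C. \<sigma> x div 4 = \<sigma> y div 4) \<and>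
     (\<forall>x y. {x, y} \<in> H \<longrightarrow> gadget_adj (\<sigma> x) (\<sigma> y))"

lemma block_state_path:
  assumes d: "distinct [a, b, c, d]" and C: "C = {a, b, c, d}" and H: "H \<subseteq> {{a, b}, {b, c}, {c, d}}"
  shows "\<exists>\<sigma>. block_state C H \<sigma>"
proof -
  define \<sigma> where "\<sigma> x = (if x = a then 4 else if x = b then 5 else if x = c then 6 else 7 :: nat)" for x
  have \<sigma>: "\<sigma> a = 4" "\<sigma> b = 5" "\<sigma> c = 6" "\<sigma> d = 7" using d by (auto simp: \<sigma>_def)
  have adj: "gadget_adj (\<sigma> x) (\<sigma> y)" if "{x, y} \<in> H" for x y
  proof -
    have "{x, y} = {a, b} \<or> {x, y} = {b, c} \<or> {x, y} = {c, d}" using that H by blast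
    then consider "x = a" "y = b" | "x = b" "y = a" | "x = b" "y = c" | "x = c" "y = b"
      | "x = c" "y = d" | "x = d" "y = c" unfolding doubleton_eq_iff by blast
    thus ?thesis by cases (simp_all add: \<sigma> gadget_adj_def gadget_edges_def)
  qed
  have range: "\<sigma> x \<in> {4, 5, 6, 7}" for x by (simp add: \<sigma>_def)
  have div: "\<sigma> x div 4 = 1" for x using range[of x] by auto
  have "block_state C H \<sigma>"
    unfolding block_state_def
  proof (intro conjI ballI allI impI)
    show "inj_on \<sigma> C" unfolding C inj_on_def by (simp add: \<sigma>)
    show "\<sigma> x < 8" for x using range[of x] by auto
    show "\<sigma> x div 4 = \<sigma> y div 4" for x y by (simp only: div)
  qed (rule adj)
  thus ?thesis by blast
qed

lemma block_state_star:
  assumes C: "finite C" "card C \<le> 4" and x: "x \<in> C" and H: "\<And>e. e \<in> H \<Longrightarrow> e \<subseteq> C \<and> card e = 2 \<and> x \<in> e"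
  shows "\<exists>\<sigma>. block_state C H \<sigma>"
proof -
  have "card (C - {x}) \<le> card {1, 2, 3 :: nat}" using C x by simp
  then obtain g where g: "g ` (C - {x}) \<subseteq> {1, 2, 3 :: nat}" "inj_on g (C - {x})"
    using card_le_inj[of "C - {x}" "{1, 2, 3 :: nat}"] C by auto
  define \<sigma> where "\<sigma> y = (if y = x then 0 else g y)" for y
  have gC: "g y = 1 \<or> g y = 2 \<or> g y = 3" if "y \<in> C" "y \<noteq> x" for y using g that by blast
  have range: "\<sigma> y \<in> {0, 1, 2, 3}" if "y \<in> C" for y using gC[OF that] by (auto simp: \<sigma>_def)
  have div: "\<sigma> y div 4 = 0" if "y \<in> C" for y using range[OF that] by auto
  have "block_state C H \<sigma>"
    unfolding block_state_def
  proof (intro conjI ballI allI impI)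
    show "inj_on \<sigma> C"
    proof (rule inj_onI)
      fix y z assume "y \<in> C" "z \<in> C" "\<sigma> y = \<sigma> z"
      thus "y = z"
        using gC[of y] gC[of z] inj_onD[OF g(2), of y z] by (auto simp: \<sigma>_def split: if_splits)
    qed
    show "\<sigma> y < 8" if "y \<in> C" for y using range[OF that] by auto
    show "\<sigma> y div 4 = \<sigma> z div 4" if "y \<in> C" "z \<in> C" for y z using div that by simp
  next
    fix y z assume "{y, z} \<in> H"
    from H[OF this] have "y \<noteq> z" "y \<in> C" "z \<in> C" "x = y \<or> x = z" by auto
    thus "gadget_adj (\<sigma> y) (\<sigma> z)"
      using gC[of y] gC[of z] by (auto simp: \<sigma>_def gadget_adj_def gadget_edges_def)
  qed
  thus ?thesis by blast
qed

text \<open>Two disjoint edges use up all four vertices, and at most one further edge joins them: a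
  subgraph of a path. If all edges meet pairwise and there is no triangle, they have a common
  vertex: a star.\<close>

lemma block_state_exists:
  assumes C: "finite C" "card C \<le> 4" and H: "H \<subseteq> clique_edges C" "card H \<le> 3"
    and tri: "\<And>x y z. {x, y} \<in> H \<Longrightarrow> {y, z} \<in> H \<Longrightarrow> {x, z} \<notin> H"
  shows "\<exists>\<sigma>. block_state C H \<sigma>"
proof (cases "\<exists>e\<in>H. \<exists>f\<in>H. e \<inter> f = {}")
  case True
  then obtain e f where ef: "e \<in> H" "f \<in> H" "e \<inter> f = {}" by blast
  have finH: "finite H" using H(1) C finite_clique_edges finite_subset by blast
  have sub: "e \<subseteq> C" "f \<subseteq> C" and c2: "card e = 2" "card f = 2" using ef H(1) by (auto simp: clique_edges_eq)
  have fin: "finite e" "finite f" using sub C(1) finite_subset by auto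
  have "card (e \<union> f) = 4" using ef(3) c2 fin by (simp add: card_Un_disjoint)
  hence CU: "C = e \<union> f" using card_seteq[of C "e \<union> f"] C sub by auto
  have "\<exists>a b c d. e = {a, b} \<and> f = {c, d} \<and> a \<noteq> b \<and> c \<noteq> d \<and> H \<subseteq> {{a, b}, {b, c}, {c, d}}"
  proof (cases "H \<subseteq> {e, f}")
    case True
    obtain a b where "e = {a, b}" "a \<noteq> b" using c2(1) by (auto simp: card_2_iff)
    moreover obtain c d where "f = {c, d}" "c \<noteq> d" using c2(2) by (auto simp: card_2_iff)
    ultimately show ?thesis using True by blast
  next
    case False
    then obtain h where h: "h \<in> H" "h \<noteq> e" "h \<noteq> f" by blast
    have "e \<noteq> f" using ef(3) c2 by auto
    hence "card {e, f, h} = 3" using h by auto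
    hence Heq: "H = {e, f, h}" using card_seteq[of H "{e, f, h}"] finH ef h H(2) by auto
    have hC: "h \<subseteq> e \<union> f" "card h = 2" using h(1) H(1) CU by (auto simp: clique_edges_eq)
    have "\<not> h \<subseteq> f" using card_subset_eq[OF fin(2), of h] hC c2 h by auto
    then obtain b where b: "b \<in> h" "b \<in> e" using hC by blast
    have "\<not> h \<subseteq> e" using card_subset_eq[OF fin(1), of h] hC c2 h by auto
    then obtain c where c: "c \<in> h" "c \<in> f" using hC by blast
    have bc: "b \<noteq> c" using b c ef(3) by auto
    have "h = {b, c}" using hC(2) b c bc by (auto simp: card_2_iff)
    moreover obtain a where "e = {a, b}" "a \<noteq> b" using c2(1) b by (auto simp: card_2_iff)
    moreover obtain d where "f = {c, d}" "c \<noteq> d" using c2(2) c by (auto simp: card_2_iff)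
    ultimately show ?thesis using Heq by blast
  qed
  then obtain a b c d where abcd: "e = {a, b}" "f = {c, d}" "a \<noteq> b" "c \<noteq> d" "H \<subseteq> {{a, b}, {b, c}, {c, d}}"
    by blast
  moreover have "distinct [a, b, c, d]" "C = {a, b, c, d}" using abcd ef(3) CU by auto
  ultimately show ?thesis by (intro block_state_path) auto
next
  case False
  hence meet: "e \<inter> f \<noteq> {}" if "e \<in> H" "f \<in> H" for e f using that by blast
  have H2: "e \<subseteq> C \<and> card e = 2" if "e \<in> H" for e using that H(1) by (auto simp: clique_edges_eq)
  show ?thesis
  proof (cases "C = {}")
    case True
    hence "H = {}" using H2 by fastforce
    thus ?thesis using True by (auto simp: block_state_def)
  next
    case False
    have "\<exists>x\<in>C. \<forall>e\<in>H. x \<in> e"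
    proof (cases "H = {}")
      case True
      thus ?thesis using False by auto
    next
      case False
      then obtain e where e: "e \<in> H" by blast
      then obtain a b where ab: "e = {a, b}" "a \<noteq> b" using H2[OF e] by (auto simp: card_2_iff)
      have abC: "a \<in> C" "b \<in> C" using H2[OF e] ab by auto
      have other: "\<exists>z. g = {y, z} \<and> y \<noteq> z \<and> z \<noteq> x" if "g \<in> H" "x \<notin> g" "e = {x, y}" for g x y
      proof -
        have "y \<in> g" using meet[OF e that(1)] that(2,3) by auto
        thus ?thesis using H2[OF that(1)] that(2) by (auto simp: card_2_iff)
      qed
      show ?thesis
      proof (rule ccontr)
        assume no: "\<not> ?thesis"
        obtain f where f: "f \<in> H" "a \<notin> f" using no abC by blast
        obtain g where g: "g \<in> H" "b \<notin> g" using no abC by blast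
        obtain c where c: "f = {b, c}" "b \<noteq> c" "c \<noteq> a" using other[OF f ab(1)] by blast
        obtain d where d: "g = {a, d}" "a \<noteq> d" "d \<noteq> b"
          using other[OF g] ab(1) by (auto simp: insert_commute)
        have "c = d" using meet[OF f(1) g(1)] c d ab(2) by auto
        thus False using tri[of a b c] e f g ab c d by simp
      qed
    qed
    then obtain x where "x \<in> C" "\<forall>e\<in>H. x \<in> e" by blast
    thus ?thesis using H2 by (intro block_state_star[OF C, of x]) auto
  qed
qed

section \<open>Components of sparse graphs and the colouring for K_4\<close>

definition edge_rel :: "nat set set \<Rightarrow> (nat \<times> nat) set" where
  "edge_rel F = {(u, v). {u, v} \<in> F}"

text \<open>A largest set \<open>S\<close> of at most four vertices that contains \<open>v\<close> and spans at least \<open>card S - 1\<close>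
  edges is closed under adjacency: otherwise five vertices would span four edges.\<close>

lemma component_small:
  assumes F: "locally_sparse (5/4) 5 F"
  shows "finite ((edge_rel F)\<^sup>* `` {v}) \<and> card ((edge_rel F)\<^sup>* `` {v}) \<le> 4"
proof -
  define good where "good S \<longleftrightarrow> finite S \<and> v \<in> S \<and> card S \<le> 4 \<and> card S \<le> edge_count F S + 1" for S
  have "good {v}" by (simp add: good_def)
  moreover have "\<forall>S. good S \<longrightarrow> card S < 5" by (auto simp: good_def)
  ultimately obtain S where S: "good S" and max: "\<And>T. good T \<Longrightarrow> card T \<le> card S"
    using ex_has_greatest_nat[of good "{v}" card 5] by blast
  have finS: "finite S" using S by (simp add: good_def)
  have closed: "y \<in> S" if x: "x \<in> S" and xy: "{x, y} \<in> F" for x y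
  proof (rule ccontr)
    assume y: "y \<notin> S"
    let ?T = "insert y S"
    have "{x, y} \<in> clique_edges ?T" "{x, y} \<notin> clique_edges S"
      using x y by (auto simp: clique_edges_eq card_2_iff)
    hence "insert {x, y} (F \<inter> clique_edges S) \<subseteq> F \<inter> clique_edges ?T"
      using xy clique_edges_mono[of S ?T] by auto
    hence "card (insert {x, y} (F \<inter> clique_edges S)) \<le> edge_count F ?T"
      unfolding edge_count_def using finS by (intro card_mono) (auto simp: finite_clique_edges)
    hence ec: "edge_count F S + 1 \<le> edge_count F ?T"
      using \<open>{x, y} \<notin> clique_edges S\<close> finS by (simp add: edge_count_def finite_clique_edges)
    have cT: "card ?T = card S + 1" using y finS by simp
    have "\<not> good ?T" using max[of ?T] cT by auto
    moreover have "card S \<le> 4" "card S \<le> edge_count F S + 1" "v \<in> S" using S by (auto simp: good_def)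
    ultimately have "card ?T = 5" using ec cT finS unfolding good_def by auto
    moreover have "5 / 4 * real (edge_count F ?T) < real (card ?T)"
      using F[unfolded locally_sparse_def, rule_format, of ?T] finS \<open>card ?T = 5\<close> by simp
    moreover have "card S \<le> edge_count F S + 1" using S by (simp add: good_def)
    hence "edge_count F ?T \<ge> 4" using ec cT \<open>card ?T = 5\<close> by linarith
    hence "real (edge_count F ?T) \<ge> 4" by simp
    ultimately show False by linarith
  qed
  have "u \<in> S" if "(v, u) \<in> (edge_rel F)\<^sup>*" for u
    using that
  proof (induction rule: rtrancl_induct)
    case base
    show ?case using S by (simp add: good_def)
  next
    case (step x y)
    thus ?case using closed by (auto simp: edge_rel_def)
  qed
  hence "(edge_rel F)\<^sup>* `` {v} \<subseteq> S" by auto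
  moreover have "card S \<le> 4" using S by (simp add: good_def)
  ultimately show ?thesis using finS by (meson card_mono finite_subset le_trans)
qed

lemma locally_sparse_subset:
  assumes "locally_sparse a K F" "F' \<subseteq> F" "a \<ge> 0"
  shows "locally_sparse a K F'"
  unfolding locally_sparse_def
proof (intro allI impI)
  fix S :: "nat set" assume S: "finite S" "S \<noteq> {}" "card S \<le> K"
  have "edge_count F' S \<le> edge_count F S"
    unfolding edge_count_def using assms(2) S by (intro card_mono) (auto simp: finite_clique_edges)
  hence "a * real (edge_count F' S) \<le> a * real (edge_count F S)" using assms(3) by (intro mult_left_mono) auto
  thus "a * real (edge_count F' S) < real (card S)"
    using assms(1) S unfolding locally_sparse_def by fastforce
qed

text \<open>Without triangles in \<open>F\<close>, a K_4 has two vertices on each side, hence one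
  edge in a component on either side. The gadget tables for this pair of components repeat a colour
  on opposite edges.\<close>

lemma not_arrow_K4:
  assumes F: "F \<subseteq> all_edges n" and sparse: "locally_sparse (5/4) 5 F"
  shows "\<not> rbw_arrow (balanced_bipartite n \<union> F) 4"
proof
  assume arrow: "rbw_arrow (balanced_bipartite n \<union> F) 4"
  define m where "m = n div 2"
  \<comment> \<open>Random edges across the bipartition are absorbed by the complete bipartite
    graph.\<close>
  define I where "I = F - balanced_bipartite n"
  have sparseI: "locally_sparse (5/4) 5 I"
    using locally_sparse_subset[OF sparse] by (auto simp: I_def)
  have bip: "{u, v} \<in> balanced_bipartite n" if "u < m" "m \<le> v" "v < n" for u v
    using that by (auto simp: balanced_bipartite_def m_def)
  have inner: "u \<noteq> v" "u < n" "v < n" "u < m \<longleftrightarrow> v < m" if "{u, v} \<in> I" for u v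
  proof -
    have uv: "{u, v} \<in> all_edges n" "{u, v} \<notin> balanced_bipartite n" using that F by (auto simp: I_def)
    thus "u \<noteq> v" "u < n" "v < n" by (auto simp: all_edges_eq clique_edges_eq)
    thus "u < m \<longleftrightarrow> v < m"
      using uv(2) bip[of u v] bip[of v u] \<open>u < n\<close> \<open>v < n\<close> by (metis insert_commute not_less)
  qed
  define comp where "comp v = (edge_rel I)\<^sup>* `` {v}" for v
  have compC: "finite (comp v)" "card (comp v) \<le> 4" for v
    using component_small[OF sparseI] by (auto simp: comp_def)
  have symI: "sym (edge_rel I)" by (auto simp: sym_def edge_rel_def insert_commute)
  have comp_self: "v \<in> comp v" for v by (simp add: comp_def)
  have comp_eq: "comp u = comp v" if "u \<in> comp v" for u v
  proof -
    have vu: "(v, u) \<in> (edge_rel I)\<^sup>*" using that by (simp add: comp_def)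
    hence "(u, v) \<in> (edge_rel I)\<^sup>*" using sym_rtrancl[OF symI] by (auto dest: symD)
    thus ?thesis using vu unfolding comp_def by (auto intro: rtrancl_trans)
  qed
  have comp_edge: "comp u = comp v" if "{u, v} \<in> I" for u v
    using that by (intro comp_eq) (auto simp: comp_def edge_rel_def insert_commute)
  have ex: "\<exists>\<sigma>. block_state (comp v) (I \<inter> clique_edges (comp v)) \<sigma>" for v
  proof (rule block_state_exists[OF compC])
    have ne: "comp v \<noteq> {}" using comp_self[of v] by auto
    have "5 / 4 * real (edge_count I (comp v)) < real (card (comp v))"
      using sparseI compC[of v] ne unfolding locally_sparse_def by simp
    hence "5 / 4 * real (card (I \<inter> clique_edges (comp v))) < 4"
      using compC(2)[of v] unfolding edge_count_def by linarith
    thus "card (I \<inter> clique_edges (comp v)) \<le> 3" by simp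
    fix x y z assume xyz: "{x, y} \<in> I \<inter> clique_edges (comp v)" "{y, z} \<in> I \<inter> clique_edges (comp v)"
    show "{x, z} \<notin> I \<inter> clique_edges (comp v)"
    proof
      assume xz: "{x, z} \<in> I \<inter> clique_edges (comp v)"
      have d: "x \<noteq> y" "y \<noteq> z" "x \<noteq> z" using inner(1) xyz xz by auto
      have "clique_edges {x, y, z} \<subseteq> I" using xyz xz by (auto simp: clique_edges_def insert_commute)
      hence "5 / 4 * real (3 choose 2) < real 3"
        using d by (intro locally_sparse_clique[OF sparseI, of "{x, y, z}"]) auto
      thus False by (simp add: choose_two)
    qed
  qed auto
  define \<sigma> where "\<sigma> C = (SOME s. block_state C (I \<inter> clique_edges C) s)" for C
  have \<sigma>: "block_state (comp v) (I \<inter> clique_edges (comp v)) (\<sigma> (comp v))" for v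
    unfolding \<sigma>_def by (rule someI_ex[OF ex])
  define st where "st v = \<sigma> (comp v) v" for v
  have st8: "st v < 8" for v
    using \<sigma>[of v] comp_self[of v] by (auto simp: block_state_def st_def)
  have st_eq: "st u div 4 = st v div 4" "st u = st v \<Longrightarrow> u = v" if "comp u = comp v" for u v
  proof -
    have uv: "u \<in> comp v" "v \<in> comp v" using comp_self[of u] comp_self[of v] that by auto
    have "\<sigma> (comp v) u div 4 = \<sigma> (comp v) v div 4" using \<sigma>[of v] uv unfolding block_state_def by blast
    thus "st u div 4 = st v div 4" unfolding st_def that .
    have inj: "inj_on (\<sigma> (comp v)) (comp v)" using \<sigma>[of v] by (simp add: block_state_def)
    show "u = v" if "st u = st v"
    proof -
      have "\<sigma> (comp v) u = \<sigma> (comp v) v" using that \<open>comp u = comp v\<close> by (simp add: st_def)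
      thus ?thesis by (rule inj_onD[OF inj _ uv])
    qed
  qed
  have st_adj: "gadget_adj (st u) (st v)" if "{u, v} \<in> I" for u v
  proof -
    have eq: "comp u = comp v" by (rule comp_edge[OF that])
    hence "u \<in> comp v" "v \<in> comp v" using comp_self[of u] comp_self[of v] by auto
    hence "{u, v} \<in> I \<inter> clique_edges (comp v)"
      using that inner(1)[OF that] by (auto simp: clique_edges_eq)
    hence "gadget_adj (\<sigma> (comp v) u) (\<sigma> (comp v) v)"
      using \<sigma>[of v] unfolding block_state_def by blast
    thus ?thesis by (simp add: st_def eq)
  qed
  obtain h :: "nat set \<Rightarrow> nat" where h: "inj_on h (comp ` {..<n})"
    using inj_to_nat[of "comp ` {..<n}"] by auto
  have h_eq: "comp u = comp v" if "h (comp u) = h (comp v)" "u < n" "v < n" for u v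
    using inj_onD[OF h that(1)] that by auto
  \<comment> \<open>Naming both components separates cross edges between different pairs of
    components, so properness reduces to one pair. The offset 3 keeps clear of the inner colours 0,
    1, 2.\<close>
  define code where "code u v = 3 + prod_encode (prod_encode (h (comp u), h (comp v)), gadget_cross (st u) (st v))" for u v
  \<comment> \<open>Edges are unordered, but \<open>Min\<close> of a cross edge is always its
    endpoint in the lower half; inside a component the table is symmetric.\<close>
  define c where "c e = (if e \<in> I then gadget_inner (st (Min e)) (st (Max e)) else code (Min e) (Max e))" for e
  have c_inner: "c {u, v} = gadget_inner (st u) (st v)" if "{u, v} \<in> I" for u v
    using that gadget_inner_sym[OF st_adj[OF that]] by (auto simp: c_def min_def max_def)
  have c_cross: "c {u, v} = code u v" if "u < m" "m \<le> v" "v < n" for u v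
    using that bip[OF that] by (auto simp: c_def I_def min_def max_def)
  have E: "e \<in> I \<or> (\<exists>u v. e = {u, v} \<and> u < m \<and> m \<le> v \<and> v < n)" if "e \<in> balanced_bipartite n \<union> F" for e
    using that by (auto simp: I_def balanced_bipartite_def m_def)
  have mixed: "c e \<noteq> c f" if "e \<in> I" "f = {u, v}" "u < m" "m \<le> v" "v < n" for e f u v
  proof -
    have "e \<in> all_edges n" using that F by (auto simp: I_def)
    then obtain x y where "e = {x, y}" by (auto simp: all_edges_def)
    hence "c e < 3" using that c_inner st_adj gadget_inner_less by auto
    moreover have "c f \<ge> 3" using c_cross that by (auto simp: code_def)
    ultimately show ?thesis by simp
  qed
  have cross_inj: "u = x \<and> v = y" if uv: "u < m" "m \<le> v" "v < n" and xy: "x < m" "m \<le> y" "y < n"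
      and code: "code u v = code x y" and share: "u = x \<or> v = y" for u v x y
  proof -
    have "prod_encode (prod_encode (h (comp u), h (comp v)), gadget_cross (st u) (st v)) =
        prod_encode (prod_encode (h (comp x), h (comp y)), gadget_cross (st x) (st y))"
      using code by (simp add: code_def)
    hence hc: "h (comp u) = h (comp x)" "h (comp v) = h (comp y)"
      and g: "gadget_cross (st u) (st v) = gadget_cross (st x) (st y)" by auto
    have cu: "comp u = comp x" and cv: "comp v = comp y" using h_eq hc uv xy by auto
    show ?thesis
      using share
    proof
      assume "u = x"
      hence "st v = st y" using g gadget_cross_inj(1)[OF st8 st8 st8 st_eq(1)[OF cv]] by simp
      thus ?thesis using st_eq(2)[OF cv] \<open>u = x\<close> by simp
    next
      assume "v = y"
      hence "st u = st x" using g gadget_cross_inj(2)[OF st8 st8 st8 st_eq(1)[OF cu]] by simp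
      thus ?thesis using st_eq(2)[OF cu] \<open>v = y\<close> by simp
    qed
  qed
  have "proper_colouring (balanced_bipartite n \<union> F) c"
    unfolding proper_colouring_def
  proof (intro ballI impI notI)
    fix e f assume ef: "e \<in> balanced_bipartite n \<union> F" "f \<in> balanced_bipartite n \<union> F"
      "e \<noteq> f \<and> e \<inter> f \<noteq> {}" and eq: "c e = c f"
    show False
    proof (cases "e \<in> I")
      case True
      hence fI: "f \<in> I" using E[OF ef(2)] mixed eq by blast
      obtain x where x: "x \<in> e" "x \<in> f" using ef(3) by blast
      have two: "\<exists>y. g = {x, y}" if "g \<in> I" "x \<in> g" for g
      proof -
        have "g \<in> all_edges n" using that F by (auto simp: I_def)
        thus ?thesis using that by (auto simp: all_edges_def)
      qed
      obtain y z where yz: "e = {x, y}" "f = {x, z}" using two[OF True x(1)] two[OF fI x(2)] by blast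
      have "st y = st z"
        using gadget_inner_inj[OF st_adj st_adj] True fI eq c_inner yz by metis
      moreover have "comp y = comp z" using comp_edge[of x y] comp_edge[of x z] True fI yz by simp
      ultimately show False using st_eq(2) ef(3) yz by blast
    next
      case False
      then obtain u v where uv: "e = {u, v}" "u < m" "m \<le> v" "v < n" using E[OF ef(1)] by blast
      have "f \<notin> I" using mixed[OF _ uv] eq by metis
      then obtain x y where xy: "f = {x, y}" "x < m" "m \<le> y" "y < n" using E[OF ef(2)] by blast
      have "u = x \<or> v = y" using ef(3) uv xy by auto
      moreover have "code u v = code x y" using eq c_cross uv xy by simp
      ultimately have "u = x \<and> v = y" using cross_inj[OF uv(2-4) xy(2-4)] by blast
      thus False using ef(3) uv xy by simp
    qed
  qed
  then obtain S where S: "finite S" "card S = 4" "clique_edges S \<subseteq> balanced_bipartite n \<union> F"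
      "inj_on c (clique_edges S)"
    using arrow unfolding rbw_arrow_def has_rainbow_clique_def by blast
  have small: "card T \<le> 2" if "T \<subseteq> S" "one_sided n T" for T
  proof (rule ccontr)
    assume "\<not> card T \<le> 2"
    then obtain R where R: "R \<subseteq> T" "card R = 3" using obtain_subset_with_card_n[of 3 T] by auto
    have "one_sided n R" using that(2) R(1) by (auto simp: one_sided_def)
    hence "clique_edges R \<subseteq> F" using one_sided_clique_edges S(3) R(1) that(1) by blast
    hence "5 / 4 * real (3 choose 2) < real 3"
      using R by (intro locally_sparse_clique[OF sparse, of R]) auto
    thus False by (simp add: choose_two)
  qed
  let ?A = "{x\<in>S. x < m}" and ?B = "{x\<in>S. m \<le> x}"
  have "card ?A \<le> 2" "card ?B \<le> 2" by (intro small; auto simp: one_sided_def m_def)+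
  moreover have "card S = card ?A + card ?B"
  proof -
    have "S = ?A \<union> ?B" by auto
    thus ?thesis using S(1) by (subst card_Un_disjoint[symmetric]) auto
  qed
  ultimately have "card ?A = 2" "card ?B = 2" using S(2) by linarith+
  then obtain x y u v where xy: "?A = {x, y}" "x \<noteq> y" and uv: "?B = {u, v}" "u \<noteq> v"
    by (auto simp: card_2_iff)
  have mem: "x \<in> S" "y \<in> S" "u \<in> S" "v \<in> S" "x < m" "y < m" "m \<le> u" "m \<le> v" using xy(1) uv(1) by blast+
  have edges: "{p, q} \<in> clique_edges S" if "p \<in> S" "q \<in> S" "p \<noteq> q" for p q
    using that by (auto simp: clique_edges_eq)
  have "{x, y} \<in> I"
    using edges[OF mem(1,2) xy(2)] S(3) mem by (auto simp: I_def balanced_bipartite_def m_def doubleton_eq_iff)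
  moreover have "{u, v} \<in> I"
    using edges[OF mem(3,4) uv(2)] S(3) mem by (auto simp: I_def balanced_bipartite_def m_def doubleton_eq_iff)
  ultimately have I2: "{x, y} \<in> I" "{u, v} \<in> I" by auto
  have un: "u < n" "v < n" using inner I2 by auto
  have neq: "c {p, q} \<noteq> c {p', q'}" if "p \<in> S" "q \<in> S" "p' \<in> S" "q' \<in> S" "p \<noteq> q" "p' \<noteq> q'" "{p, q} \<noteq> {p', q'}" for p q p' q'
    using inj_onD[OF S(4) _ edges[OF that(1,2,5)] edges[OF that(3,4,6)]] that(7) by blast
  have comps: "comp x = comp y" "comp u = comp v" using comp_edge I2 by auto
  \<comment> \<open>These are the three pairs of opposite edges, one of which the gadget colours
    alike.\<close>
  have "c {x, y} \<noteq> c {u, v}" using mem xy uv by (intro neq) (auto simp: doubleton_eq_iff)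
  moreover have "c {x, u} \<noteq> c {y, v}" using mem xy uv by (intro neq) (auto simp: doubleton_eq_iff)
  moreover have "c {x, v} \<noteq> c {y, u}" using mem xy uv by (intro neq) (auto simp: doubleton_eq_iff)
  moreover have "c {x, u} = code x u" "c {y, v} = code y v" "c {x, v} = code x v" "c {y, u} = code y u"
    using c_cross mem un by auto
  moreover have "c {x, y} = gadget_inner (st x) (st y)" "c {u, v} = gadget_inner (st u) (st v)"
    using c_inner I2 by auto
  ultimately show False
    using gadget_not_rainbow[OF st_adj[OF I2(1)] st_adj[OF I2(2)]] comps by (auto simp: code_def)
qed

lemma zero_statement_K4:
  assumes "d \<le> 1/2" "\<And>n. 0 \<le> p n \<and> p n \<le> 1" "(\<lambda>n. p n / real n powr (-5/4)) \<longlonglongrightarrow> 0"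
  shows "\<exists>G. (\<forall>n. G n \<in> dense_family d n) \<and> (\<lambda>n. rbw_prob n (G n) (p n) 4) \<longlonglongrightarrow> 0"
proof (rule zero_statement_bipartite)
  show "(\<lambda>n. p n / real n powr (- (5/4))) \<longlonglongrightarrow> 0" using assms(3) by simp
qed (use assms not_arrow_K4 in auto)

lemma is_rbw_thresholdI:
  assumes one: "\<And>p G. (\<And>n. 0 \<le> p n \<and> p n \<le> 1) \<Longrightarrow> (\<And>n. G n \<in> dense_family d n) \<Longrightarrow>
      filterlim (\<lambda>n. p n / phat n) at_top sequentially \<Longrightarrow> (\<lambda>n. rbw_prob n (G n) (p n) l) \<longlonglongrightarrow> 1"
    and zero: "\<And>p. (\<And>n. 0 \<le> p n \<and> p n \<le> 1) \<Longrightarrow> (\<lambda>n. p n / phat n) \<longlonglongrightarrow> 0 \<Longrightarrow>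
      \<exists>G. (\<forall>n. G n \<in> dense_family d n) \<and> (\<lambda>n. rbw_prob n (G n) (p n) l) \<longlonglongrightarrow> 0"
  shows "is_rbw_threshold d l phat"
  unfolding is_rbw_threshold_def
proof (intro conjI allI impI)
  fix p G
  assume "(\<forall>n. 0 \<le> p n \<and> p n \<le> 1) \<and> filterlim (\<lambda>n. p n / phat n) at_top sequentially"
    and "\<forall>n. G n \<in> dense_family d n"
  thus "(\<lambda>n. rbw_prob n (G n) (p n) l) \<longlonglongrightarrow> 1" by (intro one) blast+
next
  fix p
  assume "(\<forall>n. 0 \<le> p n \<and> p n \<le> 1) \<and> (\<lambda>n. p n / phat n) \<longlonglongrightarrow> 0"
  thus "\<exists>G. (\<forall>n. G n \<in> dense_family d n) \<and> (\<lambda>n. rbw_prob n (G n) (p n) l) \<longlonglongrightarrow> 0"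
    by (intro zero) blast+
qed

theorem theorem1p2:
  fixes d :: real
  assumes "0 < d" and "d \<le> 1/2"
  shows "is_rbw_threshold d 4 (\<lambda>n. real n powr (-5/4)) \<and>
         is_rbw_threshold d 5 (\<lambda>n. real n powr (-1)) \<and>
         is_rbw_threshold d 7 (\<lambda>n. real n powr (-7/15))"
proof (intro conjI)
  show "is_rbw_threshold d 4 (\<lambda>n. real n powr (-5/4))"
    by (rule is_rbw_thresholdI[OF one_statement_K4[OF assms(1)] zero_statement_K4[OF assms(2)]])
  show "is_rbw_threshold d 5 (\<lambda>n. real n powr (-1))"
    by (rule is_rbw_thresholdI[OF one_statement_K5[OF assms(1)] zero_statement_K5[OF assms(2)]])
  show "is_rbw_threshold d 7 (\<lambda>n. real n powr (-7/15))"
    by (rule is_rbw_thresholdI[OF one_statement_K7[OF assms(1)] zero_statement_K7[OF assms(2)]])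
qed

end
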